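(* Let $k\ge1$. For $x\ge 3$, \[ \mathcal R_k(x)=R_k(\log_2 x+\beta)+O_k\left(\frac{(\log_2 x)^{k-1}}{\log x}\right), \] where $R_k$ is the polynomial of degree $k$ \[ R_k(X)=\sum_{n_1+2n_2+\cdots+kn_k=k}\ \left(\prod_{j=2}^k\frac{(P(j)/j)^{n_j}}{n_j!}\right)\sum_{i=0}^{n_1}\frac{a_{i,n_1}}{n_1!}X^i, \] the outer sum ranging over all tuples of nonnegative integers $(n_1,\dots,n_k)$ with $n_1+2n_2+\cdots+kn_k=k$, and \[ a_{i,n}=\sum_{m=0}^{n-i}\binom{n}{m,\,i,\,n-m-i}(-\gamma)^{n-m-i}\left(\frac1\Gamma\right)^{(m)}(1). \]
   Context: $p$ denotes primes; $\log_2 x=\log\log x$. $\mathcal R_k(x)=\sum_{n\le x,\ \Omega(n)=k}1/n$, where $\Omega(n)$ counts prime factors with multiplicity. $\beta=\gamma+\sum_p(1/p+\log(1-1/p))$ is the Mertens constant, $\gamma$ the Euler–Mascheroni constant, $\Gamma$ the gamma function, $P(s)=\sum_p p^{-s}$ the prime zeta function, and $\binom{n}{a,b,c}$ the multinomial coefficient. *)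

theory Defs
  imports "HOL-Analysis.Analysis" "HOL-Computational_Algebra.Computational_Algebra"
begin

definition prime_Omega :: "nat \<Rightarrow> nat" where
  "prime_Omega n = size (prime_factorization n)"

definition recip_sum :: "nat \<Rightarrow> real \<Rightarrow> real" where
  "recip_sum k x = (\<Sum>n | n \<ge> 1 \<and> real n \<le> x \<and> prime_Omega n = k. 1 / real n)"

definition mertens_const :: real where
  "mertens_const =
     euler_mascheroni + (\<Sum>\<^sub>\<infinity>p | prime (p::nat). 1 / real p + ln (1 - 1 / real p))"

text \<open>Only real arguments are needed; the sum converges for \<open>s > 1\<close>.\<close>

definition prime_zeta :: "real \<Rightarrow> real" where
  "prime_zeta s = (\<Sum>\<^sub>\<infinity>p | prime (p::nat). real p powr (- s))"

text \<open>
  The trinomial coefficient with lower entries \<open>a, b, c\<close>; its upper entry is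
  necessarily \<open>a + b + c\<close>.
\<close>

definition trinomial :: "nat \<Rightarrow> nat \<Rightarrow> nat \<Rightarrow> real" where
  "trinomial a b c = fact (a + b + c) / (fact a * fact b * fact c)"

definition a_coeff :: "nat \<Rightarrow> nat \<Rightarrow> real" where
  "a_coeff i n = (\<Sum>m = 0..n - i. trinomial m i (n - m - i) *
      (- euler_mascheroni) ^ (n - m - i) * (deriv ^^ m) (\<lambda>s::real. 1 / Gamma s) 1)"

text \<open>
  Tuples \<open>(n\<^sub>1, \<dots>, n\<^sub>k)\<close> are functions on \<open>{1..k}\<close>; extensionality makes the
  representation unique, so that each tuple is counted once in sums over this set.
\<close>

definition weighted_tuples :: "nat \<Rightarrow> (nat \<Rightarrow> nat) set" where
  "weighted_tuples k = {n \<in> {1..k} \<rightarrow>\<^sub>E UNIV. (\<Sum>j = 1..k. j * n j) = k}"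

lemma finite_weighted_tuples: "finite (weighted_tuples k)"
proof (rule finite_subset)
  show "weighted_tuples k \<subseteq> {1..k} \<rightarrow>\<^sub>E {..k}"
  proof
    fix n assume n: "n \<in> weighted_tuples k"
    have "n j \<le> k" if j: "j \<in> {1..k}" for j
    proof -
      have "n j \<le> j * n j" using j by simp
      also have "\<dots> \<le> (\<Sum>j = 1..k. j * n j)"
        using j by (intro member_le_sum) auto
      also have "\<dots> = k" using n by (simp add: weighted_tuples_def)
      finally show ?thesis .
    qed
    then show "n \<in> {1..k} \<rightarrow>\<^sub>E {..k}"
      using n by (auto simp: weighted_tuples_def PiE_iff)
  qed
qed (simp add: finite_PiE)

definition R_poly :: "nat \<Rightarrow> real poly" where
  "R_poly k = (\<Sum>n\<in>weighted_tuples k.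
     smult (\<Prod>j = 2..k. (prime_zeta (real j) / real j) ^ n j / fact (n j))
       (\<Sum>i = 0..n 1. monom (a_coeff i (n 1) / fact (n 1)) i))"

end

theory Submission
  imports Defs
begin

text \<open>
  Write \<open>r\<^sub>k(v)\<close> for the sum at \<open>x = e\<^sup>v\<close>. Splitting \<open>ln n\<close> over the prime factors of \<open>n\<close> and using
  Mertens' first theorem, the sum of \<open>ln n / n\<close> over \<open>\<Omega>(n) = k + 1\<close>, \<open>n \<le> e\<^sup>v\<close>, equals
  \<open>\<integral>\<^sub>0\<^sup>v r\<^sub>k + O(r\<^sub>k(v))\<close>; Abel summation then recovers \<open>r\<^sub>k\<^sub>+\<^sub>1\<close>. By induction \<open>r\<^sub>k(v) = Q\<^sub>k(ln v)\<close> up to an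
  error \<open>O((ln v)\<^sup>k\<^sup>-\<^sup>1 / v)\<close>, for polynomials with \<open>Q\<^sub>0 = 1\<close> and \<open>Q\<^sub>k\<^sub>+\<^sub>1' = Q\<^sub>k\<close> whose constant terms are not
  explicit.

  To identify \<open>Q\<^sub>k\<close>, take Laplace transforms: with \<open>s = 1 / N\<close> and \<open>Y = ln N\<close>, the Dirichlet series
  \<open>F\<^sub>k(1 + s)\<close> of \<open>\<Omega>(n) = k\<close> is \<open>\<integral>\<^sub>0\<^sup>\<infinity> e\<^sup>-\<^sup>w r\<^sub>k(w / s) dw\<close>, which is within \<open>o(1)\<close> of the coefficient of \<open>z\<^sup>k\<close> in
  \<open>\<Gamma>(1 + z) \<Sum>\<^sub>k Q\<^sub>k(Y) z\<^sup>k\<close>. Newton's identities give \<open>F\<^sub>k(1 + s)\<close> as the coefficient of \<open>z\<^sup>k\<close> in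
  \<open>exp (\<Sum>\<^sub>j P(j(1 + s)) z\<^sup>j / j)\<close>, where \<open>P(1 + s) = Y + \<beta> - \<gamma> + O(s)\<close> by the Euler product. Two polynomials
  in \<open>Y\<close> that differ by \<open>o(1)\<close> are equal, so \<open>\<Sum>\<^sub>k Q\<^sub>k(Y) z\<^sup>k\<close> is
  \<open>exp ((Y + \<beta> - \<gamma>) z + \<Sum>\<^sub>j\<^sub>\<ge>\<^sub>2 P(j) z\<^sup>j / j) / \<Gamma>(1 + z)\<close>, which is the generating function of \<open>R\<^sub>k(Y + \<beta>)\<close>.
\<close>

section \<open>Mertens' first theorem\<close>

lemma prod_primes_dvd:
  fixes c :: nat
  assumes "finite A" "\<And>p. p \<in> A \<Longrightarrow> prime p" "\<And>p. p \<in> A \<Longrightarrow> p dvd c"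
  shows "\<Prod>A dvd c"
  using assms
proof (induction A rule: finite_induct)
  case (insert p A)
  have "coprime p (\<Prod>A)"
    using insert by (intro prod_coprime_right) (auto intro: primes_coprime)
  thus ?case using insert by (auto intro: divides_mult)
qed auto

text \<open>Row \<open>2 * m + 1\<close> has two equal middle coefficients, and together they are at
  most the row sum \<open>2 * 4 ^ m\<close>.\<close>

lemma odd_central_binomial_le: "(2 * m + 1) choose m \<le> 4 ^ m"
proof -
  have "2 * ((2 * m + 1) choose m) = (\<Sum>i\<in>{m, Suc m}. (2 * m + 1) choose i)"
    using binomial_symmetric[of m "2*m+1"] by simp
  also have "\<dots> \<le> (\<Sum>i\<le>2 * m + 1. (2 * m + 1) choose i)"
    by (intro sum_mono2) auto
  also have "\<dots> = 2 * 4 ^ m"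
    by (subst choose_row_sum) (simp add: power_mult)
  finally show ?thesis by simp
qed

text \<open>Erdos' argument. For \<open>n = 2 * m + 1\<close>, every prime above
  \<open>m + 1\<close> and up to \<open>n\<close> divides \<open>n choose m\<close>, so these primes
  contribute at most \<open>4 ^ m\<close>, and the primes up to \<open>m + 1\<close> are covered by
  induction. An even \<open>n > 2\<close> is not prime, so the product is the one for
  \<open>n - 1\<close>.\<close>

lemma primorial_le: "\<Prod>{p. prime p \<and> p \<le> n} \<le> (4::nat) ^ n"
proof (induction n rule: less_induct)
  case (less n)
  have fin: "finite {p::nat. prime p \<and> p \<le> m}" for m
    by (rule finite_subset[of _ "{..m}"]) auto
  consider "n < 2" | "n = 2" | "n > 2" "even n" | m where "m \<ge> 1" "n = 2 * m + 1"
    by (metis One_nat_def Suc_leI add.commute less_2_cases_iff linorder_neqE_nat mult_0_right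
        oddE plus_1_eq_Suc zero_less_iff_neq_zero)
  thus ?case
  proof cases
    case 1
    hence eq: "{p::nat. prime p \<and> p \<le> n} = {}" by (auto dest: prime_ge_2_nat)
    show ?thesis unfolding eq by simp
  next
    case 2
    have "{p::nat. prime p \<and> p \<le> n} = {2}" using 2 by (auto dest: prime_ge_2_nat)
    thus ?thesis using 2 by simp
  next
    case 3
    have "{p::nat. prime p \<and> p \<le> n} = {p::nat. prime p \<and> p \<le> n - 1}"
      using 3 prime_odd_nat[of n] by (auto simp: le_less)
    also have "\<Prod>\<dots> \<le> 4 ^ (n - 1)" using 3 by (intro less) auto
    also have "\<dots> \<le> (4::nat) ^ n" by (intro power_increasing) auto
    finally show ?thesis .
  next
    case (4 m)
    have split: "{p::nat. prime p \<and> p \<le> n} =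
        {p. prime p \<and> p \<le> m + 1} \<union> {p. prime p \<and> m + 1 < p \<and> p \<le> n}"
      using 4 by auto
    have dvd: "\<Prod>{p. prime p \<and> m + 1 < p \<and> p \<le> n} dvd (n choose m)"
    proof (rule prod_primes_dvd)
      fix p assume "p \<in> {p. prime p \<and> m + 1 < p \<and> p \<le> n}"
      hence p: "prime p" "m + 1 < p" "p \<le> n" by auto
      have "fact m * fact (n - m) * (n choose m) = (fact n :: nat)"
        using 4 by (intro binomial_fact_lemma) auto
      moreover have "p dvd fact n" using p by (simp add: prime_dvd_fact_iff)
      moreover have "\<not> p dvd fact m" "\<not> p dvd fact (n - m)"
        using p 4 by (simp_all add: prime_dvd_fact_iff del: fact_Suc)
      ultimately show "p dvd (n choose m)"
        using p by (metis prime_dvd_mult_iff)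
    qed auto
    have "\<Prod>{p::nat. prime p \<and> p \<le> n} =
        \<Prod>{p. prime p \<and> p \<le> m + 1} * \<Prod>{p. prime p \<and> m + 1 < p \<and> p \<le> n}"
      unfolding split by (intro prod.union_disjoint fin) auto
    also have "\<dots> \<le> 4 ^ (m + 1) * (n choose m)"
      using 4 less[of "m + 1"] dvd_imp_le[OF dvd] by (intro mult_mono) auto
    also have "\<dots> \<le> 4 ^ (m + 1) * 4 ^ m"
      using odd_central_binomial_le[of m] 4 by (intro mult_mono) auto
    also have "\<dots> = 4 ^ n" using 4 by (simp add: power_add[symmetric] mult_2)
    finally show ?thesis .
  qed
qed

lemma finite_primes_le: "finite {p::nat. prime p \<and> real p \<le> x}"
  by (rule finite_subset[of _ "{..nat \<lfloor>x\<rfloor>}"]) (auto simp: le_nat_floor)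

lemma sum_ln_primes_le: "(\<Sum>p | prime (p::nat) \<and> p \<le> n. ln (real p)) \<le> real n * ln 4"
proof -
  have "(\<Sum>p | prime (p::nat) \<and> p \<le> n. ln (real p)) = ln (\<Prod>p | prime (p::nat) \<and> p \<le> n. real p)"
    by (subst ln_prod) (auto simp: prime_gt_0_nat)
  also have "(\<Prod>p | prime (p::nat) \<and> p \<le> n. real p) = real (\<Prod>{p. prime p \<and> p \<le> n})"
    by simp
  also have "ln \<dots> \<le> ln (real (4 ^ n))"
  proof (subst ln_le_cancel_iff)
    have "\<Prod>{p::nat. prime p \<and> p \<le> n} > 0" by (auto simp: prime_gt_0_nat intro: prod_pos)
    thus "real (\<Prod>{p. prime p \<and> p \<le> n}) > 0" by (rule of_nat_0_less_iff[THEN iffD2])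
  qed (use primorial_le in \<open>auto simp: of_nat_le_iff simp del: of_nat_prod of_nat_power\<close>)
  also have "\<dots> = real n * ln 4" by (simp add: ln_realpow)
  finally show ?thesis .
qed

text \<open>Since \<open>ln n \<le> 2 * n powr (1/2)\<close>, comparison with the exponent
  \<open>-3/2\<close> suffices.\<close>

lemma summable_ln_over_square: "summable (\<lambda>n. ln (real n) / real n ^ 2)"
proof (rule summable_comparison_test')
  show "summable (\<lambda>n. 2 * real n powr (-3/2))"
    by (intro summable_mult) (simp add: summable_real_powr_iff)
  fix n :: nat assume n: "n \<ge> 1"
  have "ln (real n) = 2 * ln (real n powr (1/2))" using n by (simp add: ln_powr)
  also have "\<dots> \<le> 2 * real n powr (1/2)"
    using n ln_le_minus_one[of "real n powr (1/2)"] by simp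
  finally have "ln (real n) / real n ^ 2 \<le> 2 * real n powr (1/2) / real n ^ 2"
    by (simp add: divide_right_mono)
  also have "2 * real n powr (1/2) / real n ^ 2 = 2 * (real n powr (1/2) / real n powr 2)"
    using n by simp
  also have "real n powr (1/2) / real n powr 2 = real n powr (-3/2)"
    by (subst powr_diff[symmetric]) simp
  finally show "norm (ln (real n) / real n ^ 2) \<le> 2 * real n powr (-3/2)"
    using n by simp
qed

section \<open>Legendre's formula for the factorial\<close>

lemma ln_eq_sum_multiplicity:
  fixes n :: nat
  assumes "n > 0"
  shows "ln (real n) = (\<Sum>p\<in>prime_factors n. real (multiplicity p n) * ln (real p))"
proof -
  have "real n = real (\<Prod>p\<in>prime_factors n. p ^ multiplicity p n)"
    using assms by (simp add: prime_factorization_nat[symmetric])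
  also have "ln \<dots> = (\<Sum>p\<in>prime_factors n. ln (real p ^ multiplicity p n))"
    by (simp del: of_nat_power) (subst ln_prod; auto simp: prime_factors_gt_0_nat)
  finally show ?thesis
    by (simp add: ln_realpow prime_factors_gt_0_nat)
qed

lemma real_div_bounds:
  fixes N p :: nat
  assumes "p > 0"
  shows "real (N div p) \<le> real N / real p" "real N / real p - 1 \<le> real (N div p)"
proof -
  have "real N = real p * real (N div p) + real (N mod p)"
    by (metis mult_div_mod_eq of_nat_add of_nat_mult)
  moreover have "0 \<le> real (N mod p)" "real (N mod p) \<le> real p" using assms by (auto intro: less_imp_le)
  ultimately show "real (N div p) \<le> real N / real p" "real N / real p - 1 \<le> real (N div p)"
    using assms by (simp_all add: field_simps)
qed

text \<open>Legendre's formula in recursive form: only the multiples \<open>n = p * m\<close>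
  contribute, and passing from \<open>n\<close> to \<open>m\<close> lowers the multiplicity by one.
  This replaces an explicit sum over the powers of \<open>p\<close>.\<close>

lemma sum_multiplicity_rec:
  fixes p :: nat
  assumes "prime p"
  shows "(\<Sum>n=1..N. multiplicity p n) = N div p + (\<Sum>n=1..N div p. multiplicity p n)"
proof -
  have p: "p > 0" using assms by (simp add: prime_gt_0_nat)
  have "(\<Sum>n=1..N. multiplicity p n) = (\<Sum>n\<in>(\<lambda>m. p * m) ` {1..N div p}. multiplicity p n)"
  proof (rule sum.mono_neutral_right)
    show "(\<lambda>m. p * m) ` {1..N div p} \<subseteq> {1..N}"
      using p by (auto simp: less_eq_div_iff_mult_less_eq mult.commute Suc_le_eq)
    show "\<forall>i\<in>{1..N} - (\<lambda>m. p * m) ` {1..N div p}. multiplicity p i = 0"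
    proof
      fix i assume i: "i \<in> {1..N} - (\<lambda>m. p * m) ` {1..N div p}"
      have "\<not> p dvd i"
      proof
        assume "p dvd i"
        then obtain m where m: "i = p * m" by auto
        with i p have "m \<in> {1..N div p}"
          by (auto simp: less_eq_div_iff_mult_less_eq mult.commute Suc_le_eq)
        with i m show False by auto
      qed
      thus "multiplicity p i = 0" by (rule not_dvd_imp_multiplicity_0)
    qed
  qed auto
  also have "\<dots> = (\<Sum>m=1..N div p. multiplicity p (p * m))"
    using p by (subst sum.reindex) (auto simp: inj_on_def)
  also have "\<dots> = (\<Sum>m=1..N div p. 1 + multiplicity p m)"
    using assms p by (intro sum.cong refl) (auto simp: multiplicity_times_same prime_nat_iff)
  finally show ?thesis by (simp only: sum.distrib) simp
qed

text \<open>The bound reproduces itself under the recursion: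
  \<open>N / p * (1 + 1 / (p - 1)) = N / (p - 1)\<close>.\<close>

lemma sum_multiplicity_le:
  fixes p :: nat
  assumes "prime p"
  shows "real (\<Sum>n=1..N. multiplicity p n) \<le> real N / (real p - 1)"
proof (induction N rule: less_induct)
  case (less N)
  have p: "p \<ge> 2" using assms by (rule prime_ge_2_nat)
  show ?case
  proof (cases "N = 0")
    case False
    have "real (\<Sum>n=1..N. multiplicity p n) = real (N div p) + real (\<Sum>n=1..N div p. multiplicity p n)"
      by (subst sum_multiplicity_rec[OF assms]) simp
    also have "\<dots> \<le> real (N div p) + real (N div p) / (real p - 1)"
      using False p by (intro add_mono less) auto
    also have "\<dots> = real (N div p) * (real p / (real p - 1))"
      using p by (simp add: field_simps)
    also have "\<dots> \<le> (real N / real p) * (real p / (real p - 1))"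
      using p by (intro mult_right_mono) (auto simp: real_div_bounds)
    also have "\<dots> = real N / (real p - 1)" using p by simp
    finally show ?thesis .
  qed auto
qed

lemma ln_fact_eq_sum_primes:
  "ln (fact N :: real) =
     (\<Sum>p | prime (p::nat) \<and> p \<le> N. ln (real p) * real (\<Sum>n=1..N. multiplicity p n))"
proof -
  let ?P = "{p::nat. prime p \<and> p \<le> N}"
  have fin: "finite ?P" by (rule finite_subset[of _ "{..N}"]) auto
  have "ln (fact N :: real) = (\<Sum>n=1..N. ln (real n))"
    by (subst fact_prod, subst of_nat_prod, subst ln_prod) auto
  also have "\<dots> = (\<Sum>n=1..N. \<Sum>p\<in>?P. real (multiplicity p n) * ln (real p))"
  proof (rule sum.cong)
    fix n assume n: "n \<in> {1..N}"
    have "ln (real n) = (\<Sum>p\<in>prime_factors n. real (multiplicity p n) * ln (real p))"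
      using n by (intro ln_eq_sum_multiplicity) auto
    also have "\<dots> = (\<Sum>p\<in>?P. real (multiplicity p n) * ln (real p))"
      using n fin
      by (intro sum.mono_neutral_left)
        (auto simp: in_prime_factors_iff not_dvd_imp_multiplicity_0 dest!: dvd_imp_le)
    finally show "ln (real n) = (\<Sum>p\<in>?P. real (multiplicity p n) * ln (real p))" .
  qed auto
  also have "\<dots> = (\<Sum>p\<in>?P. \<Sum>n=1..N. real (multiplicity p n) * ln (real p))"
    by (rule sum.swap)
  finally show ?thesis by (simp add: sum_distrib_left mult.commute)
qed

section \<open>Two estimates of ln N! and their comparison\<close>

lemma power_le_exp:
  fixes x :: real
  assumes "x \<ge> 0"
  shows "x ^ i / fact i \<le> exp x"
proof -
  have sums: "(\<lambda>k. x ^ k /\<^sub>R fact k) sums exp x" by (rule exp_converges)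
  hence "sum (\<lambda>k. x ^ k /\<^sub>R fact k) {i} \<le> (\<Sum>k. x ^ k /\<^sub>R fact k)"
    by (intro sum_le_suminf) (use assms in \<open>auto intro: sums_summable\<close>)
  also have "\<dots> = exp x" using sums_unique[OF sums] by simp
  finally show ?thesis by (simp add: divide_inverse mult.commute)
qed

text \<open>A weak Stirling bound, read off from a single term of the exponential series.\<close>

lemma fact_ge_power_exp: "(real n) ^ n \<le> fact n * exp (real n)"
  using power_le_exp[of "real n" n] by (simp add: field_simps)

lemma ln_nat_nonneg: "ln (real n) \<ge> 0"
  by (cases "n = 0") auto

text \<open>\<open>ln (fact N)\<close> is evaluated twice: it is \<open>N * ln N + O(N)\<close> by
  the weak Stirling bound, and \<open>N\<close> times the prime sum plus \<open>O(N)\<close> by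
  Legendre's formula.\<close>

theorem mertens_first_nat:
  obtains C where "C \<ge> 0" "\<And>N. N \<ge> 1 \<Longrightarrow> \<bar>(\<Sum>p | prime (p::nat) \<and> p \<le> N. ln (real p) / real p) - ln (real N)\<bar> \<le> C"
proof -
  define K where "K = (\<Sum>n. ln (real n) / real n ^ 2)"
  have K0: "K \<ge> 0" unfolding K_def by (intro suminf_nonneg summable_ln_over_square) (auto simp: ln_nat_nonneg)
  show thesis
  proof (rule that[of "1 + 2 * K + ln 4"])
    show "1 + 2 * K + ln 4 \<ge> (0::real)" using K0 by (auto intro!: add_nonneg_nonneg)
    fix N :: nat assume N: "N \<ge> 1"
    let ?P = "{p::nat. prime p \<and> p \<le> N}"
    let ?S = "\<Sum>p\<in>?P. ln (real p) / real p"
    have fin: "finite ?P" by (rule finite_subset[of _ "{..N}"]) auto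
    \<comment> \<open>Upper bound: \<open>p\<close> has at least \<open>N / p - 1\<close> multiples
      up to \<open>N\<close>, and the total loss from rounding is the sum of \<open>ln p\<close>, at
      most \<open>N * ln 4\<close> by Chebyshev's bound.\<close>
    have "real N * ?S - real N * ln 4 \<le> real N * ?S - (\<Sum>p\<in>?P. ln (real p))"
      using sum_ln_primes_le[of N] by simp
    also have "\<dots> = (\<Sum>p\<in>?P. ln (real p) * (real N / real p - 1))"
      by (simp add: sum_distrib_left sum_subtractf algebra_simps)
    also have "\<dots> \<le> (\<Sum>p\<in>?P. ln (real p) * real (\<Sum>n=1..N. multiplicity p n))"
    proof (intro sum_mono mult_left_mono)
      fix p assume p: "p \<in> ?P"
      have "real N / real p - 1 \<le> real (N div p)" using p by (intro real_div_bounds) (auto simp: prime_gt_0_nat)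
      also have "\<dots> \<le> real (\<Sum>n=1..N. multiplicity p n)"
        using p by (subst sum_multiplicity_rec) (auto intro!: sum_nonneg)
      finally show "real N / real p - 1 \<le> real (\<Sum>n=1..N. multiplicity p n)" .
    qed (auto simp: prime_gt_0_nat Suc_leI)
    also have "\<dots> = ln (fact N)" by (rule ln_fact_eq_sum_primes[symmetric])
    also have "\<dots> \<le> ln (real N ^ N)"
      using fact_le_power[of N, where 'a=real] N by (subst ln_le_cancel_iff) auto
    also have "\<dots> = real N * ln (real N)" using N by (simp add: ln_realpow)
    finally have "real N * (?S - ln 4) \<le> real N * ln (real N)" by (simp add: algebra_simps)
    hence upper: "?S - ln 4 \<le> ln (real N)" using N by simp
    \<comment> \<open>Lower bound: \<open>1 / (p - 1)\<close> exceeds \<open>1 / p\<close> by at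
      most \<open>2 / p ^ 2\<close>, and the resulting excess is controlled by the convergent series
      \<open>K\<close>.\<close>
    have "real N * ln (real N) - real N = ln (real N ^ N) - real N" using N by (simp add: ln_realpow)
    also have "\<dots> \<le> ln (fact N * exp (real N)) - real N"
      using fact_ge_power_exp[of N] N by simp
    also have "\<dots> = ln (fact N)" by (simp add: ln_mult)
    also have "\<dots> = (\<Sum>p\<in>?P. ln (real p) * real (\<Sum>n=1..N. multiplicity p n))" by (rule ln_fact_eq_sum_primes)
    also have "\<dots> \<le> (\<Sum>p\<in>?P. ln (real p) * (real N / real p + 2 * real N / real p ^ 2))"
    proof (intro sum_mono mult_left_mono)
      fix p assume p: "p \<in> ?P"
      hence p2: "real p \<ge> 2" using prime_ge_2_nat[of p] by auto
      have "real (\<Sum>n=1..N. multiplicity p n) \<le> real N / (real p - 1)"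
        using p by (intro sum_multiplicity_le) auto
      also have "\<dots> = real N / real p + real N / (real p * (real p - 1))" using p2 by (simp add: field_simps)
      also have "real N / (real p * (real p - 1)) \<le> real N / (real p * (real p / 2))"
        using p2 by (intro divide_left_mono mult_left_mono) auto
      finally show "real (\<Sum>n=1..N. multiplicity p n) \<le> real N / real p + 2 * real N / real p ^ 2"
        by (simp add: power2_eq_square field_simps)
    qed (auto simp: prime_gt_0_nat Suc_leI)
    also have "\<dots> = real N * ?S + 2 * real N * (\<Sum>p\<in>?P. ln (real p) / real p ^ 2)"
      by (simp add: sum.distrib sum_distrib_left algebra_simps)
    also have "(\<Sum>p\<in>?P. ln (real p) / real p ^ 2) \<le> K"
      unfolding K_def by (intro sum_le_suminf summable_ln_over_square fin) (auto simp: ln_nat_nonneg)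
    hence "real N * ?S + 2 * real N * (\<Sum>p\<in>?P. ln (real p) / real p ^ 2) \<le> real N * ?S + 2 * real N * K"
      by (intro add_left_mono mult_left_mono) auto
    finally have "real N * (ln (real N) - 1 - 2 * K) \<le> real N * ?S" by (simp add: algebra_simps)
    hence lower: "ln (real N) - 1 - 2 * K \<le> ?S" using N by simp
    have "ln 4 \<ge> (0::real)" by simp
    with upper lower K0 show "\<bar>?S - ln (real N)\<bar> \<le> 1 + 2 * K + ln 4" by (intro abs_leI) linarith+
  qed
qed

text \<open>Between consecutive integers the prime sum is constant and \<open>ln\<close> grows by at
  most \<open>1 / N \<le> 1\<close>; this accounts for the extra 1 in the constant.\<close>

theorem mertens_first:
  obtains C where "C \<ge> 0" "\<And>x. x \<ge> 1 \<Longrightarrow> \<bar>(\<Sum>p | prime (p::nat) \<and> real p \<le> x. ln (real p) / real p) - ln x\<bar> \<le> C"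
proof -
  obtain C where C: "C \<ge> 0" "\<And>N. N \<ge> 1 \<Longrightarrow> \<bar>(\<Sum>p | prime (p::nat) \<and> p \<le> N. ln (real p) / real p) - ln (real N)\<bar> \<le> C"
    by (rule mertens_first_nat) blast
  show thesis
  proof (rule that[of "C + 1"])
    show "C + 1 \<ge> 0" using C by simp
    fix x :: real assume x: "x \<ge> 1"
    define N where "N = nat \<lfloor>x\<rfloor>"
    have N: "N \<ge> 1" "real N \<le> x" "x \<le> real N + 1" using x unfolding N_def by linarith+
    have eq: "{p::nat. prime p \<and> real p \<le> x} = {p. prime p \<and> p \<le> N}"
      unfolding N_def using x by (auto simp: le_nat_floor) (metis N(2) N_def of_nat_le_iff order_trans)
    have "ln x \<le> ln (real N + 1)" using N by simp
    also have "\<dots> - ln (real N) = ln (1 + 1 / real N)" using N by (subst ln_divide_pos[symmetric]) (auto simp: add_divide_distrib add.commute)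
    also have "\<dots> \<le> 1 / real N" using N by (intro ln_add_one_self_le_self) auto
    also have "\<dots> \<le> 1" using N by simp
    finally have "ln x - ln (real N) \<le> 1" by simp
    moreover have "ln (real N) \<le> ln x" using N by simp
    ultimately show "\<bar>(\<Sum>p | prime (p::nat) \<and> real p \<le> x. ln (real p) / real p) - ln x\<bar> \<le> C + 1"
      unfolding eq using C(2)[OF N(1)] by linarith
  qed
qed

section \<open>Reciprocal sums of almost primes\<close>

definition almost_primes :: "nat \<Rightarrow> real \<Rightarrow> nat set" where
  "almost_primes k x = {n. n \<ge> 1 \<and> real n \<le> x \<and> prime_Omega n = k}"

lemma in_almost_primes_iff [simp]:
  "n \<in> almost_primes k x \<longleftrightarrow> n \<ge> 1 \<and> real n \<le> x \<and> prime_Omega n = k"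
  by (simp add: almost_primes_def)

lemma recip_sum_eq: "recip_sum k x = (\<Sum>n\<in>almost_primes k x. 1 / real n)"
  by (simp add: recip_sum_def almost_primes_def)

text \<open>The weight \<open>ln n\<close> is additive over the prime factors of \<open>n\<close>,
  which makes this sum accessible from the one for smaller \<open>k\<close>; the weight is removed
  again by Abel summation.\<close>

definition log_sum :: "nat \<Rightarrow> real \<Rightarrow> real" where
  "log_sum k x = (\<Sum>n\<in>almost_primes k x. ln (real n) / real n)"

lemma finite_almost_primes: "finite (almost_primes k x)"
  by (rule finite_subset[of _ "{..nat \<lfloor>x\<rfloor>}"]) (auto simp: le_nat_floor)

lemma recip_sum_nonneg: "recip_sum k x \<ge> 0"
  unfolding recip_sum_eq by (intro sum_nonneg) auto

lemma recip_sum_mono: "x \<le> y \<Longrightarrow> recip_sum k x \<le> recip_sum k y"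
  unfolding recip_sum_eq by (intro sum_mono2 finite_almost_primes) auto

lemma prime_Omega_1 [simp]: "prime_Omega 1 = 0" "prime_Omega (Suc 0) = 0"
  by (simp_all add: prime_Omega_def)

lemma prime_Omega_prime_mult:
  assumes "prime p" "m > 0"
  shows "prime_Omega (p * m) = Suc (prime_Omega m)"
  using assms by (simp add: prime_Omega_def prime_factorization_mult prime_gt_0_nat prime_factorization_prime)

lemma prime_Omega_prime_power_mult:
  assumes "prime p" "m > 0"
  shows "prime_Omega (p ^ j * m) = j + prime_Omega m"
  using assms by (induction j) (auto simp: mult.assoc prime_Omega_prime_mult prime_gt_0_nat)

lemma prime_Omega_eq_sum: "prime_Omega n = (\<Sum>p\<in>prime_factors n. multiplicity p n)"
  unfolding prime_Omega_def size_multiset_overloaded_eq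
  by (intro sum.cong refl) (auto simp: count_prime_factorization_prime in_prime_factors_iff)

lemma prime_Omega_eq_0_iff: "n > 0 \<Longrightarrow> prime_Omega n = 0 \<longleftrightarrow> n = 1"
  by (auto simp: prime_Omega_def prime_factorization_empty_iff)

lemma almost_primes_0: "x \<ge> 1 \<Longrightarrow> almost_primes 0 x = {1}"
  by (auto simp: prime_Omega_eq_0_iff)

lemma recip_sum_0: "x \<ge> 1 \<Longrightarrow> recip_sum 0 x = 1"
  unfolding recip_sum_eq by (subst almost_primes_0) auto

text \<open>Pairs \<open>(n, p)\<close> with \<open>p\<close> a prime factor of \<open>n\<close>
  correspond to pairs \<open>(m, p)\<close> through \<open>n = p * m\<close>. Each distinct prime
  occurs once; multiplicities are left to \<open>f\<close>.\<close>

lemma sum_almost_primes_Suc: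
  fixes f :: "nat \<Rightarrow> nat \<Rightarrow> real"
  shows "(\<Sum>n\<in>almost_primes (Suc k) x. \<Sum>p\<in>prime_factors n. f p n) =
         (\<Sum>m\<in>almost_primes k x. \<Sum>p | prime p \<and> real p \<le> x / real m. f p (p * m))"
proof -
  have "(\<Sum>n\<in>almost_primes (Suc k) x. \<Sum>p\<in>prime_factors n. f p n) =
      (\<Sum>(n,p)\<in>Sigma (almost_primes (Suc k) x) prime_factors. f p n)"
    by (intro sum.Sigma) (auto simp: finite_almost_primes)
  also have "\<dots> = (\<Sum>(m,p)\<in>Sigma (almost_primes k x) (\<lambda>m. {p. prime p \<and> real p \<le> x / real m}). f p (p * m))"
  proof (rule sum.reindex_bij_witness[of _ "\<lambda>(m,p). (p * m, p)" "\<lambda>(n,p). (n div p, p)"])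
    fix a assume "a \<in> Sigma (almost_primes (Suc k) x) prime_factors"
    then obtain n p where a: "a = (n, p)" and n: "n \<ge> 1" "real n \<le> x" "prime_Omega n = Suc k"
      and p: "prime p" "p dvd n" by (auto simp: in_prime_factors_iff)
    then obtain m where m: "n = p * m" by auto
    have pos: "p > 0" "m > 0" using n p m by (auto simp: prime_gt_0_nat intro: Nat.gr0I)
    have "prime_Omega m = k" using n p m pos by (simp add: prime_Omega_prime_mult)
    moreover have "real m \<le> x"
    proof -
      have "real m \<le> real (p * m)" using pos by simp
      thus ?thesis using n m by linarith
    qed
    moreover have "real p \<le> x / real m" using n m pos by (simp add: field_simps)
    ultimately show
      "(case a of (n, p) \<Rightarrow> (n div p, p)) \<in> Sigma (almost_primes k x) (\<lambda>m. {p. prime p \<and> real p \<le> x / real m})"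
      "(case case a of (n, p) \<Rightarrow> (n div p, p) of (m, p) \<Rightarrow> (p * m, p)) = a"
      "(case case a of (n, p) \<Rightarrow> (n div p, p) of (m, p) \<Rightarrow> f p (p * m)) = (case a of (n, p) \<Rightarrow> f p n)"
      using a p m pos by auto
  next
    fix b assume "b \<in> Sigma (almost_primes k x) (\<lambda>m. {p. prime p \<and> real p \<le> x / real m})"
    then obtain m p where b: "b = (m, p)" and m: "m \<ge> 1" "real m \<le> x" "prime_Omega m = k"
      and p: "prime p" "real p \<le> x / real m" by auto
    have "real (p * m) \<le> x" using m p by (simp add: field_simps)
    thus "(case b of (m, p) \<Rightarrow> (p * m, p)) \<in> Sigma (almost_primes (Suc k) x) prime_factors"
      "(case case b of (m, p) \<Rightarrow> (p * m, p) of (n, p) \<Rightarrow> (n div p, p)) = b"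
      using b p m by (auto simp: in_prime_factors_iff prime_Omega_prime_mult prime_gt_0_nat Suc_le_eq)
  qed
  also have "\<dots> = (\<Sum>m\<in>almost_primes k x. \<Sum>p | prime p \<and> real p \<le> x / real m. f p (p * m))"
    by (intro sum.Sigma[symmetric]) (auto simp: finite_almost_primes finite_primes_le)
  finally show ?thesis .
qed

lemma multiplicity_prime_times:
  fixes p m :: nat
  assumes "prime p" "m > 0"
  shows "multiplicity p (p * m) = Suc (multiplicity p m)"
  using assms by (subst multiplicity_times_same) (auto simp: prime_nat_iff)

text \<open>
  For \<open>n = p m\<close> the multiplicity of \<open>p\<close> in \<open>n\<close> is \<open>1 + v\<^sub>p(m)\<close>, and the terms \<open>v\<^sub>p(m) ln p / p \<le> v\<^sub>p(m)\<close>
  contribute at most \<open>\<Omega>(m)\<close>. This avoids sums over prime powers.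
\<close>

lemma log_sum_Suc_approx:
  obtains C where "C \<ge> 0" "\<And>k x. x \<ge> 1 \<Longrightarrow>
    \<bar>log_sum (Suc k) x - (\<Sum>m\<in>almost_primes k x. 1 / real m * ln (x / real m))\<bar>
      \<le> (C + real k) * recip_sum k x"
proof -
  obtain C where C: "C \<ge> 0" "\<And>x. x \<ge> 1 \<Longrightarrow> \<bar>(\<Sum>p | prime (p::nat) \<and> real p \<le> x. ln (real p) / real p) - ln x\<bar> \<le> C"
    by (rule mertens_first) blast
  show thesis
  proof (rule that[OF C(1)])
    fix k and x :: real assume x: "x \<ge> 1"
    let ?A = "almost_primes k x" and ?P = "\<lambda>m. {p::nat. prime p \<and> real p \<le> x / real m}"
    let ?th = "\<lambda>m. \<Sum>p\<in>?P m. ln (real p) / real p"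
    let ?e = "\<lambda>m. \<Sum>p\<in>?P m. real (multiplicity p m) * (ln (real p) / real p)"
    have "log_sum (Suc k) x = (\<Sum>n\<in>almost_primes (Suc k) x. \<Sum>p\<in>prime_factors n.
        real (multiplicity p n) * ln (real p) / real n)"
      unfolding log_sum_def by (intro sum.cong refl) (auto simp: ln_eq_sum_multiplicity sum_divide_distrib)
    also have "\<dots> = (\<Sum>m\<in>?A. \<Sum>p\<in>?P m. real (multiplicity p (p * m)) * ln (real p) / real (p * m))"
      by (rule sum_almost_primes_Suc)
    also have "\<dots> = (\<Sum>m\<in>?A. 1 / real m * (?th m + ?e m))"
    proof (intro sum.cong refl)
      fix m assume m: "m \<in> ?A"
      have "(\<Sum>p\<in>?P m. real (multiplicity p (p * m)) * ln (real p) / real (p * m)) =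
          (\<Sum>p\<in>?P m. 1 / real m * (ln (real p) / real p + real (multiplicity p m) * (ln (real p) / real p)))"
        using m by (intro sum.cong refl) (auto simp: multiplicity_prime_times prime_gt_0_nat field_simps)
      thus "(\<Sum>p\<in>?P m. real (multiplicity p (p * m)) * ln (real p) / real (p * m)) = 1 / real m * (?th m + ?e m)"
        by (simp only: sum.distrib[symmetric] sum_distrib_left)
    qed
    finally have eq: "log_sum (Suc k) x - (\<Sum>m\<in>?A. 1 / real m * ln (x / real m)) =
        (\<Sum>m\<in>?A. 1 / real m * (?th m - ln (x / real m) + ?e m))"
      by (simp only: sum_subtractf[symmetric]) (simp add: algebra_simps)
    have "\<bar>\<Sum>m\<in>?A. 1 / real m * (?th m - ln (x / real m) + ?e m)\<bar> \<le> (\<Sum>m\<in>?A. 1 / real m * (C + real k))"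
    proof (rule order_trans[OF sum_abs sum_mono])
      fix m assume m: "m \<in> ?A"
      have "\<bar>?th m - ln (x / real m)\<bar> \<le> C"
        using m by (intro C(2)) (auto simp: field_simps)
      moreover have "?e m \<ge> 0" by (intro sum_nonneg) (auto simp: ln_nat_nonneg)
      moreover have "?e m \<le> real k"
      proof -
        have "?e m \<le> (\<Sum>p\<in>?P m. real (multiplicity p m) * 1)"
        proof (intro sum_mono mult_left_mono)
          fix p assume "p \<in> ?P m"
          hence "p > 0" by (auto simp: prime_gt_0_nat)
          thus "ln (real p) / real p \<le> 1" using ln_le_minus_one[of "real p"] by simp
        qed auto
        also have "\<dots> = (\<Sum>p\<in>?P m \<inter> prime_factors m. real (multiplicity p m))"
          by (simp, intro sum.mono_neutral_right) (auto simp: finite_primes_le prime_factors_multiplicity)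
        also have "\<dots> \<le> (\<Sum>p\<in>prime_factors m. real (multiplicity p m))"
          by (intro sum_mono2) auto
        also have "\<dots> = real k" using m by (auto simp: prime_Omega_eq_sum)
        finally show ?thesis .
      qed
      ultimately show "\<bar>1 / real m * (?th m - ln (x / real m) + ?e m)\<bar> \<le> 1 / real m * (C + real k)"
        using m unfolding abs_mult by (intro mult_mono) auto
    qed
    also have "\<dots> = (C + real k) * recip_sum k x"
      unfolding recip_sum_eq sum_distrib_left by (intro sum.cong) auto
    finally show "\<bar>log_sum (Suc k) x - (\<Sum>m\<in>?A. 1 / real m * ln (x / real m))\<bar> \<le> (C + real k) * recip_sum k x"
      unfolding eq .
  qed
qed

section \<open>Abel summation as integration of step functions\<close>

lemma has_integral_inverse_square:
  fixes c V :: real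
  assumes "0 < c" "c \<le> V"
  shows "((\<lambda>v. 1 / v ^ 2) has_integral (1 / c - 1 / V)) {c..V}"
proof -
  have "((\<lambda>v. 1 / v ^ 2) has_integral (- 1 / V - (- 1 / c))) {c..V}"
    using assms
    by (intro fundamental_theorem_of_calculus)
       (auto simp: has_real_derivative_iff_has_vector_derivative[symmetric] power2_eq_square intro!: derivative_eq_intros)
  thus ?thesis by simp
qed

text \<open>A step function with jump \<open>w n\<close> at \<open>c n\<close> is a finite
  combination of indicators of \<open>{c n..V}\<close>, so it can be integrated against
  \<open>f\<close> term by term.\<close>

lemma has_integral_step_function:
  fixes f :: "real \<Rightarrow> real"
  assumes "finite A" "\<And>n. n \<in> A \<Longrightarrow> a \<le> c n" "\<And>n. n \<in> A \<Longrightarrow> c n \<le> V"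
    "\<And>n. n \<in> A \<Longrightarrow> (f has_integral I n) {c n..V}"
  shows "((\<lambda>v. (\<Sum>n\<in>{n\<in>A. c n \<le> v}. w n) * f v) has_integral (\<Sum>n\<in>A. w n * I n)) {a..V}"
proof -
  have "((\<lambda>v. \<Sum>n\<in>A. w n * (if v \<in> {c n..V} then f v else 0)) has_integral (\<Sum>n\<in>A. w n * I n)) {a..V}"
    using assms
    by (intro has_integral_sum has_integral_mult_right) (assumption, subst has_integral_restrict, auto)
  moreover have "(\<Sum>n\<in>A. w n * (if v \<in> {c n..V} then f v else 0)) = (\<Sum>n\<in>{n\<in>A. c n \<le> v}. w n) * f v"
    if "v \<in> {a..V}" for v
  proof -
    have "(\<Sum>n\<in>A. w n * (if v \<in> {c n..V} then f v else 0)) = (\<Sum>n\<in>A. if c n \<le> v then w n * f v else 0)"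
      using that by (intro sum.cong) auto
    also have "\<dots> = (\<Sum>n\<in>{n\<in>A. c n \<le> v}. w n * f v)"
      using assms(1) by (simp add: sum.inter_filter)
    finally show ?thesis by (simp add: sum_distrib_right)
  qed
  ultimately show ?thesis by (rule has_integral_eq[rotated])
qed

lemma almost_primes_exp:
  assumes "v \<le> V"
  shows "{n \<in> almost_primes k (exp V). ln (real n) \<le> v} = almost_primes k (exp v)"
proof -
  have "real n \<le> exp v \<longleftrightarrow> ln (real n) \<le> v" if "n \<ge> 1" for n
    using that by (metis exp_le_cancel_iff exp_ln of_nat_0_less_iff less_eq_Suc_le One_nat_def)
  moreover have "exp v \<le> exp V" using assms by simp
  ultimately show ?thesis by (auto simp del: exp_le_cancel_iff intro: order_trans[of _ "exp v"])
qed

lemma ln_le_of_almost_prime: "n \<in> almost_primes k (exp V) \<Longrightarrow> ln (real n) \<le> V"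
  using almost_primes_exp[of V V k] by blast

text \<open>Each \<open>m\<close> contributes \<open>1 / m\<close> on an interval of length
  \<open>V - ln m\<close>. This identifies the main term of \<open>log_sum_Suc_approx\<close> as an
  integral of \<open>recip_sum k\<close>.\<close>

lemma has_integral_recip_sum:
  assumes "V \<ge> 0"
  shows "((\<lambda>v. recip_sum k (exp v)) has_integral
    (\<Sum>m\<in>almost_primes k (exp V). 1 / real m * ln (exp V / real m))) {0..V}"
proof -
  have "((\<lambda>v. (\<Sum>n\<in>{n\<in>almost_primes k (exp V). ln (real n) \<le> v}. 1 / real n) * 1) has_integral
      (\<Sum>n\<in>almost_primes k (exp V). 1 / real n * (V - ln (real n)))) {0..V}"
  proof (rule has_integral_step_function)
    fix n assume n: "n \<in> almost_primes k (exp V)"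
    show "((\<lambda>_. 1::real) has_integral V - ln (real n)) {ln (real n)..V}"
      using has_integral_const_real[of "1::real" "ln (real n)" V] ln_le_of_almost_prime[OF n] by simp
  qed (use finite_almost_primes ln_le_of_almost_prime ln_nat_nonneg in auto)
  also have "(\<Sum>n\<in>almost_primes k (exp V). 1 / real n * (V - ln (real n))) =
      (\<Sum>m\<in>almost_primes k (exp V). 1 / real m * ln (exp V / real m))"
    by (intro sum.cong refl) (auto simp: ln_div)
  finally show ?thesis
    by (rule has_integral_eq[rotated]) (simp only: atLeastAtMost_iff almost_primes_exp recip_sum_eq mult_1_right)
qed

text \<open>The weight \<open>ln n\<close> is undone through \<open>1 / ln n - 1 / V\<close>, the
  integral of \<open>1 / v ^ 2\<close> from \<open>ln n\<close> to \<open>V\<close>. With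
  \<open>Suc k\<close> prime factors \<open>n\<close> is at least 2, so all jumps lie above the
  lower limit \<open>1 / 2 < ln 2\<close>.\<close>

lemma has_integral_log_sum:
  assumes "V \<ge> 1 / 2"
  shows "((\<lambda>v. log_sum (Suc k) (exp v) * (1 / v ^ 2)) has_integral
    (recip_sum (Suc k) (exp V) - log_sum (Suc k) (exp V) / V)) {1/2..V}"
proof -
  have ge2: "ln (real n) \<ge> 1 / 2" if "n \<in> almost_primes (Suc k) (exp V)" for n
  proof -
    have "n \<ge> 2" using that by (cases "n = 1") auto
    hence "ln (real n) \<ge> ln 2" by simp
    thus ?thesis using ln2_ge_two_thirds by linarith
  qed
  have "((\<lambda>v. (\<Sum>n\<in>{n\<in>almost_primes (Suc k) (exp V). ln (real n) \<le> v}. ln (real n) / real n) * (1 / v ^ 2)) has_integral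
      (\<Sum>n\<in>almost_primes (Suc k) (exp V). ln (real n) / real n * (1 / ln (real n) - 1 / V))) {1/2..V}"
  proof (rule has_integral_step_function)
    fix n assume n: "n \<in> almost_primes (Suc k) (exp V)"
    show "((\<lambda>v. 1 / v ^ 2) has_integral 1 / ln (real n) - 1 / V) {ln (real n)..V}"
      using ge2[OF n] ln_le_of_almost_prime[OF n] by (intro has_integral_inverse_square) auto
  qed (use finite_almost_primes ln_le_of_almost_prime ge2 in auto)
  also have "(\<Sum>n\<in>almost_primes (Suc k) (exp V). ln (real n) / real n * (1 / ln (real n) - 1 / V)) =
     (\<Sum>n\<in>almost_primes (Suc k) (exp V). 1 / real n - ln (real n) / real n / V)"
  proof (intro sum.cong refl)
    fix n assume n: "n \<in> almost_primes (Suc k) (exp V)"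
    show "ln (real n) / real n * (1 / ln (real n) - 1 / V) = 1 / real n - ln (real n) / real n / V"
      using ge2[OF n] assms by (simp add: right_diff_distrib)
  qed
  also have "\<dots> = recip_sum (Suc k) (exp V) - log_sum (Suc k) (exp V) / V"
    by (simp add: sum_subtractf recip_sum_eq log_sum_def sum_divide_distrib)
  finally show ?thesis
    by (rule has_integral_eq[rotated]) (simp only: atLeastAtMost_iff almost_primes_exp log_sum_def)
qed

section \<open>Polynomial asymptotics with unknown constant terms\<close>

text \<open>Differentiation is nilpotent on polynomials of bounded degree, so the identity plus a
  multiple of it is onto. The defect of the trial solution \<open>Q\<close> is
  \<open>smult c (pderiv Q)\<close>, of smaller degree, and is corrected by induction.\<close>

lemma poly_add_scaled_pderiv_surj:
  fixes Q :: "real poly" and c :: real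
  shows "\<exists>T. T + smult c (pderiv T) = Q \<and> degree T \<le> degree Q"
proof (induction "degree Q" arbitrary: Q rule: less_induct)
  case less
  show ?case
  proof (cases "degree Q = 0")
    case True
    hence "pderiv Q = 0" by (simp add: pderiv_eq_0_iff)
    thus ?thesis by (intro exI[of _ Q]) simp
  next
    case False
    let ?D = "smult c (pderiv Q)"
    have deg: "degree ?D < degree Q"
      using False by (simp add: degree_pderiv)
    from less[OF this] obtain T where T: "T + smult c (pderiv T) = ?D" "degree T \<le> degree ?D"
      by blast
    have "(Q - T) + smult c (pderiv (Q - T)) = Q"
      using T(1) by (simp add: pderiv_diff smult_diff_right algebra_simps)
    moreover have "degree (Q - T) \<le> degree Q"
      using T(2) deg by (intro degree_diff_le) auto
    ultimately show ?thesis by blast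
  qed
qed

lemma pderiv_sum: "pderiv (\<Sum>i\<in>A. f i) = (\<Sum>i\<in>A. pderiv (f i))"
  by (induction A rule: infinite_finite_induct) (auto simp: pderiv_add)

lemma poly_antiderivative_exists:
  fixes Q :: "real poly"
  shows "\<exists>S. pderiv S = Q"
proof -
  have "pderiv (\<Sum>i\<le>degree Q. monom (coeff Q i / real (Suc i)) (Suc i)) = (\<Sum>i\<le>degree Q. monom (coeff Q i) i)"
    unfolding pderiv_sum by (intro sum.cong refl) (simp add: pderiv_monom del: of_nat_Suc)
  thus ?thesis unfolding poly_as_sum_of_monoms by blast
qed

lemma poly_bound:
  fixes Q :: "real poly"
  assumes "degree Q \<le> k"
  obtains C where "C \<ge> 0" "\<And>L. L \<ge> 1 \<Longrightarrow> \<bar>poly Q L\<bar> \<le> C * L ^ k"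
proof (rule that)
  fix L :: real assume L: "L \<ge> 1"
  have "\<bar>poly Q L\<bar> \<le> (\<Sum>i\<le>degree Q. \<bar>coeff Q i\<bar> * L ^ i)"
    unfolding poly_altdef using L by (intro order_trans[OF sum_abs] sum_mono) (simp add: abs_mult)
  also have "\<dots> \<le> (\<Sum>i\<le>degree Q. \<bar>coeff Q i\<bar> * L ^ k)"
    using L assms by (intro sum_mono mult_left_mono power_increasing) auto
  finally show "\<bar>poly Q L\<bar> \<le> (\<Sum>i\<le>degree Q. \<bar>coeff Q i\<bar>) * L ^ k"
    by (simp add: sum_distrib_right)
qed (auto intro: sum_nonneg)

lemma ln_power_over_self_tendsto_0: "((\<lambda>x::real. ln x ^ k / x) \<longlongrightarrow> 0) at_top"
proof -
  have "((\<lambda>x. ln x ^ k / exp (ln x :: real)) \<longlongrightarrow> 0) at_top"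
    by (rule filterlim_compose[OF tendsto_power_div_exp_0 ln_at_top])
  moreover have "eventually (\<lambda>x. ln x ^ k / exp (ln x) = ln x ^ k / (x::real)) at_top"
    using eventually_gt_at_top[of 0] by eventually_elim simp
  ultimately show ?thesis by (rule Lim_transform_eventually)
qed

lemma has_real_derivative_poly_ln:
  fixes v :: real
  assumes "v > 0"
  shows "((\<lambda>v. poly Q (ln v)) has_real_derivative poly (pderiv Q) (ln v) / v) (at v within A)"
proof (rule has_field_derivative_at_within)
  have "((\<lambda>v. poly Q (ln v)) has_real_derivative (poly (pderiv Q) (ln v) * (1 / v))) (at v)"
    by (rule DERIV_chain2[OF poly_DERIV]) (use assms in \<open>auto intro!: derivative_eq_intros\<close>)
  thus "((\<lambda>v. poly Q (ln v)) has_real_derivative poly (pderiv Q) (ln v) / v) (at v)" by simp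
qed

lemma has_integral_of_derivative:
  fixes f :: "real \<Rightarrow> real"
  assumes "a \<le> b" "\<And>x. a \<le> x \<Longrightarrow> x \<le> b \<Longrightarrow> (F has_real_derivative f x) (at x)"
  shows "(f has_integral (F b - F a)) {a..b}"
proof (rule fundamental_theorem_of_calculus[OF assms(1)])
  fix x assume x: "x \<in> {a..b}"
  have "(F has_real_derivative f x) (at x within {a..b})"
    by (rule has_field_derivative_at_within[OF assms(2)]) (use x in auto)
  thus "(F has_vector_derivative f x) (at x within {a..b})"
    by (simp only: has_real_derivative_iff_has_vector_derivative[symmetric])
qed

lemma has_integral_abs_le:
  fixes f g :: "real \<Rightarrow> real"
  assumes "(f has_integral I) A" "(g has_integral J) A" "\<And>x. x \<in> A \<Longrightarrow> \<bar>f x\<bar> \<le> g x"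
  shows "\<bar>I\<bar> \<le> J"
  using integral_norm_bound_integral[of f A g] assms
  by (auto simp: integral_unique dest: has_integral_integrable)

text \<open>
  A tail \<open>\<integral>\<^sub>V\<^sup>\<infinity> \<epsilon>(v) / v\<^sup>2 dv\<close> with \<open>\<epsilon>(v) = O((ln v)\<^sup>k)\<close> is \<open>O((ln V)\<^sup>k / V)\<close>: choose a polynomial
  \<open>W\<close> with \<open>W - W' = X\<^sup>k\<close>, so that \<open>- W(ln v) / v\<close> is an antiderivative of \<open>(ln v)\<^sup>k / v\<^sup>2\<close>.
\<close>

lemma integral_inverse_square_tail:
  fixes \<epsilon> G :: "real \<Rightarrow> real"
  assumes int: "\<And>a V. exp 1 \<le> a \<Longrightarrow> a \<le> V \<Longrightarrow> ((\<lambda>v. \<epsilon> v / v ^ 2) has_integral (G V - G a)) {a..V}"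
  assumes bound: "\<And>v. v \<ge> exp 1 \<Longrightarrow> \<bar>\<epsilon> v\<bar> \<le> K * ln v ^ k"
  obtains c C where "\<And>V. V \<ge> exp 1 \<Longrightarrow> \<bar>G V - c\<bar> \<le> C * (ln V ^ k / V)"
proof -
  obtain W :: "real poly" where W: "W + smult (-1) (pderiv W) = monom 1 k" "degree W \<le> degree (monom (1::real) k)"
    using poly_add_scaled_pderiv_surj by blast
  have degW: "degree W \<le> k" using W(2) by (simp add: degree_monom_eq)
  obtain B where B: "B \<ge> 0" "\<And>L. L \<ge> 1 \<Longrightarrow> \<bar>poly W L\<bar> \<le> B * L ^ k" using poly_bound[OF degW] by blast
  have polyW: "poly W x - poly (pderiv W) x = x ^ k" for x
    using arg_cong[OF W(1), of "\<lambda>p. poly p x"] by (simp add: poly_monom)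
  define e where "e = (\<lambda>V::real. K * B * (ln V ^ k / V))"
  have K: "K \<ge> 0" using bound[of "exp 1"] by simp
  have diff: "\<bar>G V - G a\<bar> \<le> e a + e V" if "exp 1 \<le> a" "a \<le> V" for a V
  proof -
    have pos: "v > 0" if "v \<ge> exp (1::real)" for v by (rule less_le_trans[OF exp_gt_zero that])
    have ge1: "ln v \<ge> 1" if "v \<ge> exp (1::real)" for v using pos[OF that] that by (simp add: ln_ge_iff)
    have "((\<lambda>v. K * (ln v ^ k / v ^ 2)) has_integral (K * (- poly W (ln V) / V - (- poly W (ln a) / a)))) {a..V}"
    proof (intro has_integral_mult_right has_integral_of_derivative)
      fix x assume "a \<le> x" "x \<le> V"
      hence x: "x > 0" using pos that by auto
      show "((\<lambda>x. - poly W (ln x) / x) has_real_derivative (ln x ^ k / x ^ 2)) (at x)"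
      proof -
        have "((\<lambda>x. - poly W (ln x) / x) has_real_derivative
            ((- (poly (pderiv W) (ln x) / x)) * x - (- poly W (ln x)) * 1) / (x * x)) (at x)"
          using x by (intro DERIV_divide DERIV_minus has_real_derivative_poly_ln DERIV_ident) auto
        also have "((- (poly (pderiv W) (ln x) / x)) * x - (- poly W (ln x)) * 1) / (x * x) = ln x ^ k / x ^ 2"
          using x polyW[of "ln x"] by (simp add: power2_eq_square)
        finally show ?thesis .
      qed
    qed (use that in auto)
    moreover have "\<bar>\<epsilon> v / v ^ 2\<bar> \<le> K * (ln v ^ k / v ^ 2)" if "v \<in> {a..V}" for v
      using bound[of v] that \<open>exp 1 \<le> a\<close> by (simp add: abs_divide divide_right_mono)
    ultimately have "\<bar>G V - G a\<bar> \<le> K * (- poly W (ln V) / V - (- poly W (ln a) / a))"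
      by (intro has_integral_abs_le[OF int]) (use that in auto)
    also have "\<dots> \<le> K * (\<bar>poly W (ln V)\<bar> / V + \<bar>poly W (ln a)\<bar> / a)"
    proof (rule mult_left_mono[OF _ K])
      have "- poly W (ln V) / V \<le> \<bar>poly W (ln V)\<bar> / V" "poly W (ln a) / a \<le> \<bar>poly W (ln a)\<bar> / a"
        using pos[of a] pos[of V] that by (intro divide_right_mono; simp)+
      thus "- poly W (ln V) / V - (- poly W (ln a) / a) \<le> \<bar>poly W (ln V)\<bar> / V + \<bar>poly W (ln a)\<bar> / a"
        by simp
    qed
    also have "\<dots> \<le> K * (B * ln V ^ k / V + B * ln a ^ k / a)"
      using K pos[of a] pos[of V] ge1[of a] ge1[of V] that
      by (intro mult_left_mono add_mono divide_right_mono B) auto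
    finally show ?thesis by (simp add: e_def algebra_simps)
  qed
  have e_lim: "(\<lambda>n. e (real n)) \<longlonglongrightarrow> 0"
    unfolding e_def by (rule tendsto_eq_rhs[OF tendsto_mult[OF tendsto_const]], rule filterlim_compose[OF ln_power_over_self_tendsto_0 filterlim_real_sequentially]) auto
  \<comment> \<open>Since \<open>e\<close> tends to 0, \<open>diff\<close> makes \<open>G\<close>
    Cauchy along the integers. Its limit is the constant \<open>c\<close>, and letting one argument
    of \<open>diff\<close> run to infinity gives the rate.\<close>
  have "Cauchy (\<lambda>n. G (real n))"
  proof (rule metric_CauchyI)
    fix \<delta> :: real assume "\<delta> > 0"
    hence "eventually (\<lambda>n. \<bar>e (real n)\<bar> < \<delta> / 2) sequentially"
      using tendstoD[OF e_lim, of "\<delta> / 2"] by simp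
    moreover have "eventually (\<lambda>n. real n \<ge> exp 1) sequentially"
      using filterlim_real_sequentially by (simp add: filterlim_at_top)
    ultimately have "eventually (\<lambda>n. \<bar>e (real n)\<bar> < \<delta> / 2 \<and> real n \<ge> exp 1) sequentially"
      by eventually_elim auto
    then obtain M where M: "\<And>n. n \<ge> M \<Longrightarrow> \<bar>e (real n)\<bar> < \<delta> / 2 \<and> real n \<ge> exp 1"
      by (auto simp: eventually_sequentially)
    have *: "dist (G (real m)) (G (real n)) < \<delta>" if "m \<ge> M" "n \<ge> m" for m n
      using diff[of "real m" "real n"] M[of m] M[of n] that by (auto simp: dist_real_def abs_minus_commute)
    show "\<exists>M. \<forall>m\<ge>M. \<forall>n\<ge>M. dist (G (real m)) (G (real n)) < \<delta>"
      using * by (metis dist_commute linear)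
  qed
  then obtain c where c: "(\<lambda>n. G (real n)) \<longlonglongrightarrow> c"
    by (auto simp: Cauchy_convergent_iff convergent_def)
  show thesis
  proof (rule that[of c "K * B"])
    fix V :: real assume V: "V \<ge> exp 1"
    have "\<bar>G V - c\<bar> \<le> e V + 0"
    proof (rule tendsto_le[OF sequentially_bot])
      show "(\<lambda>n. \<bar>G V - G (real n)\<bar>) \<longlonglongrightarrow> \<bar>G V - c\<bar>" by (intro tendsto_intros c)
      show "(\<lambda>n. e V + e (real n)) \<longlonglongrightarrow> e V + 0" by (intro tendsto_intros e_lim)
      have "eventually (\<lambda>n. real n \<ge> V) sequentially"
        using filterlim_real_sequentially by (simp add: filterlim_at_top)
      thus "eventually (\<lambda>n. \<bar>G V - G (real n)\<bar> \<le> e V + e (real n)) sequentially"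
        by eventually_elim (use diff V in \<open>simp add: abs_minus_commute\<close>)
    qed
    thus "\<bar>G V - c\<bar> \<le> K * B * (ln V ^ k / V)" by (simp add: e_def)
  qed
qed

text \<open>
  If \<open>T + T' = Q\<close>, then \<open>v T(ln v)\<close> is an antiderivative of \<open>Q(ln v)\<close>; the error bound is \<open>C\<close> times the
  derivative of \<open>(ln v)\<^sup>k\<close>, and therefore vanishes for \<open>k = 0\<close>.
\<close>

lemma asymptotic_step:
  fixes r \<tau> r' I :: "real \<Rightarrow> real" and Q :: "real poly"
  assumes r: "\<And>V. V \<ge> 0 \<Longrightarrow> (r has_integral I V) {0..V}"
  assumes \<tau>: "\<And>V. V \<ge> 0 \<Longrightarrow> \<bar>\<tau> V - I V\<bar> \<le> K * \<bar>r V\<bar>"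
  assumes r': "\<And>V. V \<ge> 1 / 2 \<Longrightarrow> ((\<lambda>v. \<tau> v * (1 / v ^ 2)) has_integral (r' V - \<tau> V / V)) {1/2..V}"
  assumes Q: "degree Q \<le> k"
  assumes approx: "\<And>v. v \<ge> exp 1 \<Longrightarrow> \<bar>r v - poly Q (ln v)\<bar> \<le> C * (real k * ln v ^ (k - 1) / v)"
  shows "\<exists>Q' C'. pderiv Q' = Q \<and> (\<forall>v\<ge>exp 1. \<bar>r' v - poly Q' (ln v)\<bar> \<le> C' * (real (Suc k) * ln v ^ k / v))"
proof -
  have pos: "v > 0" if "v \<ge> exp (1::real)" for v by (rule less_le_trans[OF exp_gt_zero that])
  have ge1: "ln v \<ge> 1" if "v \<ge> exp (1::real)" for v using pos[OF that] that by (simp add: ln_ge_iff)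
  have pow_ge1: "ln v ^ k \<ge> 1" if "v \<ge> exp (1::real)" for v using ge1[OF that] by simp
  obtain T where T: "T + smult 1 (pderiv T) = Q"
    using poly_add_scaled_pderiv_surj by blast
  have polyT: "poly Q x = poly T x + poly (pderiv T) x" for x
    using arg_cong[OF T, of "\<lambda>p. poly p x"] by simp
  obtain S where S: "pderiv S = T" using poly_antiderivative_exists by blast
  \<comment> \<open>The first summand is the discrepancy at the starting point \<open>exp 1\<close>,
    the second comes from integrating the error bound.\<close>
  define K0 where "K0 = \<bar>I (exp 1) - exp 1 * poly T 1\<bar> + \<bar>C\<bar>"
  have I: "\<bar>I V - V * poly T (ln V)\<bar> \<le> K0 * ln V ^ k" if V: "V \<ge> exp 1" for V
  proof -
    have "(r has_integral (I V - I (exp 1))) {exp 1..V}"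
    proof -
      have V0: "V \<ge> 0" using pos[OF V] by simp
      have "r integrable_on {exp 1..V}"
        using V by (intro integrable_subinterval_real[OF has_integral_integrable[OF r[of V]]]) (auto intro: order_trans[of 0 "exp 1"])
      then obtain J where J: "(r has_integral J) {exp 1..V}" by blast
      have "(r has_integral (I (exp 1) + J)) {0..V}"
        by (rule has_integral_combine[OF _ V r J]) auto
      hence "I (exp 1) + J = I V" by (rule has_integral_unique[OF _ r[OF V0]])
      hence "J = I V - I (exp 1)" by simp
      with J show ?thesis by simp
    qed
    moreover have "((\<lambda>v. poly Q (ln v)) has_integral (V * poly T (ln V) - exp 1 * poly T (ln (exp 1)))) {exp 1..V}"
    proof (rule has_integral_of_derivative[OF V])
      fix x assume "exp 1 \<le> x" "x \<le> V"
      hence "x > 0" using pos by auto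
      thus "((\<lambda>v. v * poly T (ln v)) has_real_derivative poly Q (ln x)) (at x)"
        by (auto intro!: derivative_eq_intros has_real_derivative_poly_ln simp: polyT)
    qed
    ultimately have "((\<lambda>v. r v - poly Q (ln v)) has_integral
        (I V - I (exp 1) - (V * poly T (ln V) - exp 1 * poly T (ln (exp 1))))) {exp 1..V}"
      by (rule has_integral_diff)
    moreover have "((\<lambda>v. C * (real k * ln v ^ (k - 1) / v)) has_integral (C * (ln V ^ k - ln (exp 1) ^ k))) {exp 1..V}"
    proof (intro has_integral_mult_right has_integral_of_derivative[OF V])
      fix x assume "exp 1 \<le> x" "x \<le> V"
      hence "x > 0" using pos by auto
      thus "((\<lambda>v. ln v ^ k) has_real_derivative (real k * ln x ^ (k - 1) / x)) (at x)"
        by (auto intro!: derivative_eq_intros simp: field_simps)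
    qed
    ultimately have "\<bar>I V - I (exp 1) - (V * poly T (ln V) - exp 1 * poly T (ln (exp 1)))\<bar> \<le> C * (ln V ^ k - ln (exp 1) ^ k)"
      by (rule has_integral_abs_le) (rule approx, simp)
    also have "\<dots> \<le> \<bar>C\<bar> * (ln V ^ k - 1)"
      unfolding ln_exp power_one using pow_ge1[OF V] by (intro mult_right_mono) auto
    also have "\<dots> \<le> \<bar>C\<bar> * ln V ^ k" by (intro mult_left_mono) auto
    finally have le: "\<bar>I V - I (exp 1) - (V * poly T (ln V) - exp 1 * poly T 1)\<bar> \<le> \<bar>C\<bar> * ln V ^ k"
      unfolding ln_exp .
    have "\<bar>a - b\<bar> \<le> \<bar>c - d\<bar> * 1 + x" if "\<bar>a - c - (b - d)\<bar> \<le> x" for a b c d x :: real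
      using that abs_triangle_ineq[of "a - c - (b - d)" "c - d"] by simp
    from this[OF le]
    have "\<bar>I V - V * poly T (ln V)\<bar> \<le> \<bar>I (exp 1) - exp 1 * poly T 1\<bar> * 1 + \<bar>C\<bar> * ln V ^ k" .
    also have "\<dots> \<le> \<bar>I (exp 1) - exp 1 * poly T 1\<bar> * ln V ^ k + \<bar>C\<bar> * ln V ^ k"
      by (intro add_right_mono mult_left_mono pow_ge1 V) auto
    finally show ?thesis by (simp add: K0_def algebra_simps)
  qed
  obtain B where B: "B \<ge> 0" "\<And>L. L \<ge> 1 \<Longrightarrow> \<bar>poly Q L\<bar> \<le> B * L ^ k" using poly_bound[OF Q] by blast
  \<comment> \<open>A crude bound of order \<open>ln v ^ k\<close> is enough to absorb
    \<open>K * \<bar>r V\<bar>\<close> into the error of \<open>\<tau>\<close>.\<close>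
  have r_bound: "\<bar>r v\<bar> \<le> (\<bar>C\<bar> * real k + B) * ln v ^ k" if v: "v \<ge> exp 1" for v
  proof -
    have v1: "v \<ge> 1" using v exp_ge_add_one_self[of 1] by linarith
    have "real k * ln v ^ (k - 1) / v \<le> real k * ln v ^ (k - 1) / 1"
      using v1 ge1[OF v] by (intro divide_left_mono) auto
    also have "\<dots> \<le> real k * ln v ^ k" using ge1[OF v] by (simp add: mult_left_mono power_increasing)
    finally have "C * (real k * ln v ^ (k - 1) / v) \<le> \<bar>C\<bar> * (real k * ln v ^ k)"
      using ge1[OF v] v1 by (intro mult_mono) auto
    with approx[OF v] B(2)[OF ge1[OF v]] have "\<bar>r v\<bar> \<le> \<bar>C\<bar> * (real k * ln v ^ k) + B * ln v ^ k" by linarith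
    thus ?thesis by (simp add: algebra_simps)
  qed
  define \<epsilon> where "\<epsilon> = (\<lambda>v. \<tau> v - v * poly T (ln v))"
  define K1 where "K1 = \<bar>K\<bar> * (\<bar>C\<bar> * real k + B) + K0"
  have \<epsilon>: "\<bar>\<epsilon> v\<bar> \<le> K1 * ln v ^ k" if v: "v \<ge> exp 1" for v
  proof -
    have "\<bar>\<tau> v - I v\<bar> \<le> K * \<bar>r v\<bar>" using \<tau> pos[OF v] by simp
    also have "\<dots> \<le> \<bar>K\<bar> * ((\<bar>C\<bar> * real k + B) * ln v ^ k)"
      using r_bound[OF v] by (intro mult_mono) auto
    finally show ?thesis using I[OF v] unfolding \<epsilon>_def K1_def by (simp add: algebra_simps)
  qed
  \<comment> \<open>From \<open>r'\<close> everything known in closed form is subtracted. The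
    increments of \<open>G\<close> are then integrals of \<open>\<epsilon> v / v ^ 2\<close>, so
    \<open>G\<close> converges by the preceding tail estimate.\<close>
  define G where "G = (\<lambda>V. r' V - \<tau> V / V - poly S (ln V))"
  have "((\<lambda>v. \<epsilon> v / v ^ 2) has_integral (G V - G a)) {a..V}" if a: "exp 1 \<le> a" "a \<le> V" for a V
  proof -
    have half: "1 / 2 \<le> a" using a exp_ge_add_one_self[of 1] by linarith
    have "((\<lambda>v. \<tau> v * (1 / v ^ 2)) has_integral (r' V - \<tau> V / V - (r' a - \<tau> a / a))) {a..V}"
    proof -
      have "(\<lambda>v. \<tau> v * (1 / v ^ 2)) integrable_on {a..V}"
        using a half by (intro integrable_subinterval_real[OF has_integral_integrable[OF r'[of V]]]) auto
      then obtain J where J: "((\<lambda>v. \<tau> v * (1 / v ^ 2)) has_integral J) {a..V}" by blast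
      have "((\<lambda>v. \<tau> v * (1 / v ^ 2)) has_integral (r' a - \<tau> a / a + J)) {1/2..V}"
        by (rule has_integral_combine[OF half a(2) r' J]) (use half in auto)
      hence "r' a - \<tau> a / a + J = r' V - \<tau> V / V" by (rule has_integral_unique) (use r' half a in auto)
      hence "J = r' V - \<tau> V / V - (r' a - \<tau> a / a)" by simp
      with J show ?thesis by simp
    qed
    moreover have "((\<lambda>v. poly T (ln v) / v) has_integral (poly S (ln V) - poly S (ln a))) {a..V}"
    proof (rule has_integral_of_derivative[OF a(2)])
      fix x assume "a \<le> x" "x \<le> V"
      hence "x > 0" using pos a by auto
      thus "((\<lambda>v. poly S (ln v)) has_real_derivative poly T (ln x) / x) (at x)"
        unfolding S[symmetric] by (rule has_real_derivative_poly_ln)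
    qed
    ultimately have "((\<lambda>v. \<tau> v * (1 / v ^ 2) - poly T (ln v) / v) has_integral
        (r' V - \<tau> V / V - (r' a - \<tau> a / a) - (poly S (ln V) - poly S (ln a)))) {a..V}"
      by (rule has_integral_diff)
    also have "r' V - \<tau> V / V - (r' a - \<tau> a / a) - (poly S (ln V) - poly S (ln a)) = G V - G a"
      by (simp add: G_def)
    finally have hi: "((\<lambda>v. \<tau> v * (1 / v ^ 2) - poly T (ln v) / v) has_integral (G V - G a)) {a..V}" .
    have eq: "\<tau> v * (1 / v ^ 2) - poly T (ln v) / v = \<epsilon> v / v ^ 2" if "v \<in> {a..V}" for v
    proof -
      have "v > 0" using that a pos[of v] by auto
      thus ?thesis by (simp add: \<epsilon>_def field_simps power2_eq_square)
    qed
    show ?thesis by (rule has_integral_eq[OF eq hi])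
  qed
  then obtain c C1 where c: "\<And>V. V \<ge> exp 1 \<Longrightarrow> \<bar>G V - c\<bar> \<le> C1 * (ln V ^ k / V)"
    using integral_inverse_square_tail[of \<epsilon> G K1 k] \<epsilon> by blast
  \<comment> \<open>\<open>T\<close> comes from the boundary term \<open>\<tau> V / V\<close>,
    \<open>S\<close> from integrating \<open>poly T (ln v) / v\<close>, and \<open>c\<close> is the
    limit of \<open>G\<close>.\<close>
  define Q' where "Q' = T + S + [:c:]"
  have "pderiv Q' = Q" using T by (simp add: Q'_def pderiv_add S pderiv_pCons algebra_simps)
  moreover have "\<bar>r' v - poly Q' (ln v)\<bar> \<le> (\<bar>K1\<bar> + \<bar>C1\<bar>) * (real (Suc k) * ln v ^ k / v)" if v: "v \<ge> exp 1" for v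
  proof -
    have v0: "v > 0" using pos v by auto
    have "r' v - poly Q' (ln v) = \<epsilon> v / v + (G v - c)"
      using v0 by (simp add: Q'_def G_def \<epsilon>_def field_simps)
    also have "\<bar>\<dots>\<bar> \<le> \<bar>\<epsilon> v\<bar> / v + \<bar>G v - c\<bar>" using v0 by (intro order_trans[OF abs_triangle_ineq]) simp
    also have "\<dots> \<le> K1 * ln v ^ k / v + C1 * (ln v ^ k / v)"
      by (intro add_mono divide_right_mono \<epsilon> c v) (use v0 in auto)
    also have "\<dots> = (K1 + C1) * (ln v ^ k / v)" by (simp add: algebra_simps add_divide_distrib)
    also have "\<dots> \<le> (\<bar>K1\<bar> + \<bar>C1\<bar>) * (ln v ^ k / v)"
      using v0 pow_ge1[OF v] by (intro mult_right_mono divide_nonneg_pos) linarith+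
    also have "\<dots> \<le> (\<bar>K1\<bar> + \<bar>C1\<bar>) * (real (Suc k) * ln v ^ k / v)"
    proof (intro mult_left_mono divide_right_mono)
      have "1 * ln v ^ k \<le> real (Suc k) * ln v ^ k" using ge1[OF v] by (intro mult_right_mono) auto
      thus "ln v ^ k \<le> real (Suc k) * ln v ^ k" by simp
    qed (use v0 in auto)
    finally show ?thesis .
  qed
  ultimately show ?thesis by blast
qed

text \<open>Iteration of \<open>asymptotic_step\<close> from \<open>Q 0 = 1\<close>. The factor
  \<open>real k\<close> makes the case \<open>k = 0\<close> exact, which settles the truncated
  exponent \<open>k - 1\<close> there, and \<open>v \<ge> exp 1\<close> keeps
  \<open>ln v \<ge> 1\<close>. Each polynomial depends on the previous one and on an integration
  constant, hence the dependent choice.\<close>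

theorem recip_sum_asymptotics:
  obtains Q :: "nat \<Rightarrow> real poly" where "Q 0 = 1" "\<And>k. pderiv (Q (Suc k)) = Q k"
    "\<And>k. \<exists>C. \<forall>v\<ge>exp 1. \<bar>recip_sum k (exp v) - poly (Q k) (ln v)\<bar> \<le> C * (real k * ln v ^ (k - 1) / v)"
proof -
  define P where "P = (\<lambda>k (Q::real poly). (k = 0 \<longrightarrow> Q = 1) \<and> degree Q \<le> k \<and>
    (\<exists>C. \<forall>v\<ge>exp 1. \<bar>recip_sum k (exp v) - poly Q (ln v)\<bar> \<le> C * (real k * ln v ^ (k - 1) / v)))"
  have "\<exists>Q. \<forall>k. P k (Q k) \<and> pderiv (Q (Suc k)) = Q k"
  proof (rule dependent_nat_choice)
    have "recip_sum 0 (exp v) = 1" if "v \<ge> exp 1" for v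
      using that by (intro recip_sum_0) (auto intro: order_trans[of 0 "exp 1"])
    thus "\<exists>Q. P 0 Q" by (intro exI[of _ 1]) (auto simp: P_def)
  next
    fix Q k assume PQ: "P k Q"
    obtain C0 where C0: "\<And>k x. x \<ge> 1 \<Longrightarrow>
      \<bar>log_sum (Suc k) x - (\<Sum>m\<in>almost_primes k x. 1 / real m * ln (x / real m))\<bar>
        \<le> (C0 + real k) * recip_sum k x"
      by (rule log_sum_Suc_approx) blast
    obtain C where C: "\<And>v. v \<ge> exp 1 \<Longrightarrow> \<bar>recip_sum k (exp v) - poly Q (ln v)\<bar> \<le> C * (real k * ln v ^ (k - 1) / v)"
      using PQ by (auto simp: P_def)
    obtain Q' C' where Q': "pderiv Q' = Q"
      "\<And>v. v \<ge> exp 1 \<Longrightarrow> \<bar>recip_sum (Suc k) (exp v) - poly Q' (ln v)\<bar> \<le> C' * (real (Suc k) * ln v ^ k / v)"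
      using asymptotic_step[of "\<lambda>v. recip_sum k (exp v)" "\<lambda>V. \<Sum>m\<in>almost_primes k (exp V). 1 / real m * ln (exp V / real m)"
          "\<lambda>v. log_sum (Suc k) (exp v)" "C0 + real k" "\<lambda>v. recip_sum (Suc k) (exp v)" Q k C]
        has_integral_recip_sum has_integral_log_sum C0 C PQ
      by (auto simp: P_def recip_sum_nonneg)
    have "degree Q' \<le> Suc k" using Q'(1) PQ degree_pderiv[of Q'] by (auto simp: P_def)
    with Q' have "P (Suc k) Q'" unfolding P_def by auto
    with Q' show "\<exists>Q'. P (Suc k) Q' \<and> pderiv Q' = Q" by blast
  qed
  then obtain Q where "\<And>k. P k (Q k)" "\<And>k. pderiv (Q (Suc k)) = Q k" by blast
  thus thesis by (intro that[of Q]) (auto simp: P_def)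
qed

section \<open>The prime zeta function near integers\<close>

lemma summable_on_powr: "\<sigma> > 1 \<Longrightarrow> (\<lambda>n. real n powr -\<sigma>) summable_on A"
  by (rule summable_on_subset_banach[of _ UNIV])
     (auto simp: summable_on_UNIV_nonneg_real_iff summable_real_powr_iff)

lemma summable_on_ln_over_square: "(\<lambda>n. ln (real n) / real n ^ 2) summable_on A"
  by (rule summable_on_subset_banach[of _ UNIV])
     (auto simp: summable_on_UNIV_nonneg_real_iff ln_nat_nonneg summable_ln_over_square)

lemma has_sum_diff_real:
  fixes f g :: "'a \<Rightarrow> real"
  assumes "(f has_sum a) A" "(g has_sum b) A"
  shows "((\<lambda>x. f x - g x) has_sum (a - b)) A"
  using has_sum_add[OF assms(1) has_sum_cmult_right[OF assms(2), of "-1"]] by simp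

section \<open>The zeta function near 1 and its Euler product\<close>

lemma powr_telescope_bounds:
  fixes s x :: real
  assumes "s > 0" "x > 0"
  shows "s * (x + 1) powr (-1-s) \<le> x powr -s - (x + 1) powr -s"
    and "x powr -s - (x + 1) powr -s \<le> s * x powr (-1-s)"
proof -
  have "\<exists>z. z > x \<and> z < x + 1 \<and>
      (x + 1) powr -s - x powr -s = (x + 1 - x) * (-s * z powr (-1-s))"
    by (rule MVT2) (use assms in \<open>auto intro!: derivative_eq_intros simp: powr_diff powr_minus field_simps\<close>)
  then obtain z where z: "z > x" "z < x + 1" "x powr -s - (x + 1) powr -s = s * z powr (-1-s)"
    by (auto simp: algebra_simps)
  show "s * (x + 1) powr (-1-s) \<le> x powr -s - (x + 1) powr -s"
    unfolding z(3) using z assms by (intro mult_left_mono powr_mono2') auto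
  show "x powr -s - (x + 1) powr -s \<le> s * x powr (-1-s)"
    unfolding z(3) using z assms by (intro mult_left_mono powr_mono2') auto
qed

text \<open>The mean value bounds for \<open>x powr -s\<close> on unit intervals, summed from
  \<open>x = 1\<close>, telescope to 1. The upper bound starts with the term for
  \<open>n = 2\<close>, which explains the extra 1; the term for \<open>n = 0\<close> vanishes
  because \<open>0 powr _ = 0\<close>.\<close>

lemma zeta_bounds:
  fixes s :: real
  assumes "s > 0"
  shows "1 / s \<le> (\<Sum>n. real n powr (-1-s))" "(\<Sum>n. real n powr (-1-s)) \<le> 1 / s + 1"
proof -
  let ?g = "\<lambda>n. real (Suc n) powr -s - real (Suc (Suc n)) powr -s"
  have sm: "summable (\<lambda>n. real n powr (-1-s))" using assms by (simp add: summable_real_powr_iff)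
  have "(\<lambda>n. real (Suc n) powr -s) \<longlonglongrightarrow> 0"
    using assms by (intro tendsto_neg_powr filterlim_compose[OF filterlim_real_sequentially filterlim_Suc]) auto
  hence g: "?g sums 1" using telescope_sums'[of "\<lambda>n. real (Suc n) powr -s" 0] by simp
  have sm1: "summable (\<lambda>n. s * real (Suc n) powr (-1-s))"
    using sm by (intro summable_mult) (subst summable_Suc_iff)
  have sm2: "summable (\<lambda>n. s * real (Suc (Suc n)) powr (-1-s))"
    using sm by (intro summable_mult) (subst summable_Suc_iff[of "\<lambda>n. real (Suc n) powr (-1-s)"], subst summable_Suc_iff)
  have eq1: "(\<Sum>n. real (Suc n) powr (-1-s)) = (\<Sum>n. real n powr (-1-s))"
    using suminf_split_head[OF sm] by simp
  have eq2: "(\<Sum>n. real (Suc (Suc n)) powr (-1-s)) = (\<Sum>n. real n powr (-1-s)) - 1"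
    using suminf_split_head[of "\<lambda>n. real (Suc n) powr (-1-s)"] sm summable_Suc_iff[of "\<lambda>n. real n powr (-1-s)"] eq1
    by simp
  have "(\<Sum>n. ?g n) \<le> (\<Sum>n. s * real (Suc n) powr (-1-s))"
  proof (intro suminf_le sums_summable[OF g] sm1)
    show "?g n \<le> s * real (Suc n) powr (-1-s)" for n
      using powr_telescope_bounds(2)[OF assms, of "real (Suc n)"] by (simp add: add.commute)
  qed
  also have "\<dots> = s * (\<Sum>n. real n powr (-1-s))"
    unfolding eq1[symmetric] by (rule suminf_mult) (use sm in \<open>subst summable_Suc_iff\<close>)
  finally show "1 / s \<le> (\<Sum>n. real n powr (-1-s))"
    using assms unfolding sums_unique[OF g, symmetric] by (simp add: field_simps)
  have "(\<Sum>n. s * real (Suc (Suc n)) powr (-1-s)) \<le> (\<Sum>n. ?g n)"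
  proof (intro suminf_le sums_summable[OF g] sm2)
    show "s * real (Suc (Suc n)) powr (-1-s) \<le> ?g n" for n
      using powr_telescope_bounds(1)[OF assms, of "real (Suc n)"] by (simp add: add.commute)
  qed
  moreover have "(\<Sum>n. s * real (Suc (Suc n)) powr (-1-s)) = s * ((\<Sum>n. real n powr (-1-s)) - 1)"
    unfolding eq2[symmetric] using sm
    by (intro suminf_mult) (subst summable_Suc_iff[of "\<lambda>n. real (Suc n) powr (-1-s)"], subst summable_Suc_iff)
  ultimately show "(\<Sum>n. real n powr (-1-s)) \<le> 1 / s + 1"
    using assms unfolding sums_unique[OF g, symmetric] by (simp add: field_simps)
qed

text \<open>Adjoining a prime \<open>p\<close> to \<open>A\<close>: every admissible
  \<open>n\<close> is uniquely \<open>p ^ j * m\<close> with the prime factors of \<open>m\<close>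
  in \<open>A\<close>, so the sum is multiplied by a geometric series in \<open>j\<close>.\<close>

lemma euler_product_finite:
  fixes \<sigma> :: real
  assumes "finite A" "\<And>p. p \<in> A \<Longrightarrow> prime p" "\<sigma> > 0"
  shows "((\<lambda>n. real n powr -\<sigma>) has_sum (\<Prod>p\<in>A. 1 / (1 - real p powr -\<sigma>)))
           {n. n > 0 \<and> prime_factors n \<subseteq> A}"
  using assms(1,2)
proof (induction A rule: finite_induct)
  case empty
  have "{n::nat. n > 0 \<and> prime_factors n \<subseteq> {}} = {1}"
    by (auto simp: prime_factorization_empty_iff)
  thus ?case by (simp add: has_sum_finite_iff)
next
  case (insert p A)
  let ?S = "{n. n > 0 \<and> prime_factors n \<subseteq> A}" and ?S' = "{n. n > 0 \<and> prime_factors n \<subseteq> insert p A}"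
  let ?P = "\<Prod>p\<in>A. 1 / (1 - real p powr -\<sigma>)"
  let ?q = "real p powr -\<sigma>"
  have p: "prime p" using insert by auto
  hence p1: "real p > 1" using prime_gt_1_nat by auto
  have q: "0 \<le> ?q" "?q < 1" using p1 assms(3) by (auto intro: powr_less_one)
  have geom: "((\<lambda>j. ?q ^ j) has_sum (1 / (1 - ?q))) UNIV"
    using geometric_sums[of ?q] q by (intro sums_nonneg_imp_has_sum) auto
  have IH: "((\<lambda>n. real n powr -\<sigma>) has_sum ?P) ?S" using insert by auto
  have "((\<lambda>(j::nat, m). ?q ^ j * real m powr -\<sigma>) has_sum (1 / (1 - ?q) * ?P)) (UNIV \<times> ?S)"
  proof (rule has_sum_SigmaI)
    show "((\<lambda>m. case (j, m) of (j, m) \<Rightarrow> ?q ^ j * real m powr -\<sigma>) has_sum (?q ^ j * ?P)) ?S" for j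
      using has_sum_cmult_right[OF IH, of "?q ^ j"] by simp
    show sum: "((\<lambda>j. ?q ^ j * ?P) has_sum (1 / (1 - ?q) * ?P)) UNIV"
      by (rule has_sum_cmult_left[OF geom])
    show "(\<lambda>(j::nat, m). ?q ^ j * real m powr -\<sigma>) summable_on UNIV \<times> ?S"
      by (rule summable_on_SigmaI[where g = "\<lambda>j. ?q ^ j * ?P"])
         (use has_sum_cmult_right[OF IH] sum in \<open>auto simp: summable_on_def\<close>)
  qed
  also have "?this \<longleftrightarrow> ((\<lambda>n. real n powr -\<sigma>) has_sum (1 / (1 - ?q) * ?P)) ?S'"
  proof (rule has_sum_reindex_bij_witness[where j = "\<lambda>(j, m). p ^ j * m" and i = "\<lambda>n. (multiplicity p n, n div p ^ multiplicity p n)"])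
    fix a assume "a \<in> (UNIV :: nat set) \<times> ?S"
    then obtain j m where a: "a = (j, m)" and m: "m > 0" "prime_factors m \<subseteq> A" by auto
    have ndvd: "\<not> p dvd m" using m insert p by (auto simp: prime_factors_dvd)
    hence "multiplicity p (p ^ j * m) = j"
      using p m by (simp add: prime_elem_multiplicity_mult_distrib multiplicity_same_power not_dvd_imp_multiplicity_0 prime_gt_0_nat)
    thus "(multiplicity p (case a of (j, m) \<Rightarrow> p ^ j * m), (case a of (j, m) \<Rightarrow> p ^ j * m) div p ^ multiplicity p (case a of (j, m) \<Rightarrow> p ^ j * m)) = a"
      using a p by (simp add: prime_gt_0_nat)
    have "prime_factors (p ^ j * m) \<subseteq> insert p A"
    proof
      fix x assume "x \<in> prime_factors (p ^ j * m)"
      hence x: "prime x" "x dvd p ^ j \<or> x dvd m" by (auto simp: in_prime_factors_iff prime_dvd_mult_iff)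
      from x(2) show "x \<in> insert p A"
      proof
        assume "x dvd p ^ j"
        hence "x dvd p" using x(1) prime_dvd_power by blast
        thus ?thesis using x(1) p primes_dvd_imp_eq by blast
      next
        assume "x dvd m"
        hence "x \<in> prime_factors m" using x(1) m by (simp add: in_prime_factors_iff)
        thus ?thesis using m by blast
      qed
    qed
    thus "(case a of (j, m) \<Rightarrow> p ^ j * m) \<in> ?S'"
      using a m p by (auto simp: prime_gt_0_nat)
    show "real (case a of (j, m) \<Rightarrow> p ^ j * m) powr -\<sigma> = (case a of (j, m) \<Rightarrow> ?q ^ j * real m powr -\<sigma>)"
      using a m p1 by (simp add: powr_mult powr_power powr_realpow[symmetric] powr_powr mult.commute)
  next
    fix n assume n: "n \<in> ?S'"
    let ?m = "n div p ^ multiplicity p n"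
    have dvd: "p ^ multiplicity p n dvd n" by (rule multiplicity_dvd)
    have eq: "n = p ^ multiplicity p n * ?m" using dvd by simp
    thus "(case (multiplicity p n, ?m) of (j, m) \<Rightarrow> p ^ j * m) = n" by simp
    have m0: "?m > 0" using n eq by (auto intro: Nat.gr0I)
    have ndvd: "\<not> p dvd ?m" using n p by (intro multiplicity_decompose) (auto simp: prime_nat_iff)
    have "prime_factors ?m \<subseteq> prime_factors n"
      using n eq by (intro dvd_prime_factors) (auto simp: dvd_div_iff_mult intro: dvd_trans dest: arg_cong[of _ _ "\<lambda>x. ?m dvd x"])
    hence "prime_factors ?m \<subseteq> insert p A - {p}"
      using n ndvd by (blast dest: in_prime_factors_imp_dvd)
    thus "(multiplicity p n, ?m) \<in> UNIV \<times> ?S" using m0 by blast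
  qed (rule refl)
  finally show ?case using insert by simp
qed

lemma prime_powr_bounds:
  fixes p :: nat
  assumes "prime p" "\<sigma> \<ge> 1"
  shows "0 < real p powr -\<sigma>" "real p powr -\<sigma> \<le> 1 / real p" "real p powr -\<sigma> \<le> 1 / 2"
proof -
  have p: "real p \<ge> 2" using prime_ge_2_nat[OF assms(1)] by simp
  thus "0 < real p powr -\<sigma>" by simp
  have "real p powr -\<sigma> \<le> real p powr -1" using p assms by (intro powr_mono) auto
  thus le: "real p powr -\<sigma> \<le> 1 / real p" using p by (simp add: powr_minus_divide)
  also have "\<dots> \<le> 1 / 2" using p by (simp add: field_simps)
  finally show "real p powr -\<sigma> \<le> 1 / 2" .
qed

lemma neg_ln_one_minus_bounds:
  fixes y :: real
  assumes "0 \<le> y" "y \<le> 1 / 2"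
  shows "0 \<le> - ln (1 - y)" "- ln (1 - y) \<le> 2 * y"
proof -
  show "0 \<le> - ln (1 - y)" using assms by simp
  have "- ln (1 - y) = ln (1 / (1 - y))" using assms by (simp add: ln_div)
  also have "\<dots> \<le> 1 / (1 - y) - 1" using assms by (intro ln_le_minus_one) auto
  also have "\<dots> = y / (1 - y)" using assms by (simp add: field_simps)
  also have "\<dots> \<le> y / (1 / 2)" using assms by (intro divide_left_mono) auto
  finally show "- ln (1 - y) \<le> 2 * y" by simp
qed

text \<open>The derivative of \<open>y + ln (1 - y)\<close> is \<open>- y / (1 - y)\<close>, of size
  at most \<open>2 * b\<close> on the interval. The factor \<open>b\<close>, later
  \<open>1 / p\<close>, is what makes the sum over primes converge.\<close>

lemma ln_one_minus_plus_diff_le: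
  fixes a b :: real
  assumes "0 \<le> a" "a \<le> b" "b \<le> 1 / 2"
  shows "\<bar>(b + ln (1 - b)) - (a + ln (1 - a))\<bar> \<le> 2 * b * (b - a)"
proof (cases "a = b")
  case False
  have "\<exists>z. z > a \<and> z < b \<and> (b + ln (1 - b)) - (a + ln (1 - a)) = (b - a) * (1 - 1 / (1 - z))"
    by (rule MVT2) (use assms False in \<open>auto intro!: derivative_eq_intros\<close>)
  then obtain z where z: "a < z" "z < b" "(b + ln (1 - b)) - (a + ln (1 - a)) = (b - a) * (1 - 1 / (1 - z))"
    by blast
  have "1 - 1 / (1 - z) = - (z / (1 - z))" using z assms by (simp add: field_simps)
  hence "\<bar>(b + ln (1 - b)) - (a + ln (1 - a))\<bar> = (b - a) * (z / (1 - z))"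
    using z assms by (simp add: abs_mult)
  also have "\<dots> \<le> (b - a) * (b / (1 / 2))"
    using z assms by (intro mult_left_mono frac_le) auto
  finally show ?thesis by (simp add: algebra_simps)
qed auto

text \<open>Two inequalities: a finite Euler product is a sum over a subset of all \<open>n\<close>,
  hence at most the full sum; conversely the terms with \<open>n < N\<close> involve only primes
  below \<open>N\<close>, so each partial sum is at most the full product.\<close>

lemma has_sum_ln_euler_product:
  fixes s :: real
  assumes s: "s > 0"
  shows "((\<lambda>p::nat. - ln (1 - real p powr (-1-s))) has_sum ln (\<Sum>n. real n powr (-1-s))) {p. prime p}"
proof -
  define Z where "Z = (\<Sum>n. real n powr (-1-s))"
  let ?f = "\<lambda>n. real n powr -(1+s)"
  let ?L = "\<lambda>p::nat. - ln (1 - real p powr -(1+s))"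
  have sm: "summable ?f" using s by (simp add: summable_real_powr_iff)
  have Zsum: "(?f has_sum Z) UNIV"
    unfolding Z_def using sm by (intro sums_nonneg_imp_has_sum) (auto simp: summable_sums)
  have "1 / s > 0" using s by simp
  hence Zpos: "Z > 0" using zeta_bounds(1)[OF s] unfolding Z_def by linarith
  have bounds: "0 \<le> ?L p" "?L p \<le> 2 * ?f p" if "prime p" for p
    using neg_ln_one_minus_bounds[of "?f p"] prime_powr_bounds[OF that, of "1+s"] s by auto
  have summ: "?L summable_on {p. prime p}"
  proof (rule summable_on_comparison_test)
    show "(\<lambda>p. 2 * ?f p) summable_on {p. prime p}"
      by (intro summable_on_cmult_right summable_on_powr) (use s in simp)
  qed (simp_all only: mem_Collect_eq bounds)
  have prod: "(\<Prod>p\<in>A. 1 / (1 - ?f p)) = exp (\<Sum>p\<in>A. ?L p)" if "finite A" "A \<subseteq> {p. prime p}" for A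
    unfolding exp_sum[OF that(1)]
  proof (intro prod.cong refl)
    fix p assume "p \<in> A"
    hence "prime p" using that(2) by auto
    from prime_powr_bounds(3)[OF this, of "1+s"] have "1 - ?f p > 0" using s by linarith
    thus "1 / (1 - ?f p) = exp (?L p)" by (simp add: exp_minus inverse_eq_divide)
  qed
  have euler: "(?f has_sum exp (\<Sum>p\<in>A. ?L p)) {n. n > 0 \<and> prime_factors n \<subseteq> A}"
    if "finite A" "A \<subseteq> {p. prime p}" for A
    using euler_product_finite[of A "1+s"] prod[OF that] that s by auto
  have "infsum ?L {p. prime p} \<le> ln Z"
  proof (rule infsum_le_finite_sums[OF summ])
    fix A :: "nat set" assume A: "finite A" "A \<subseteq> {p. prime p}"
    have "exp (\<Sum>p\<in>A. ?L p) \<le> Z"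
      by (rule has_sum_mono'[OF euler[OF A] Zsum]) auto
    hence "ln (exp (\<Sum>p\<in>A. ?L p)) \<le> ln Z" using Zpos by (subst ln_le_cancel_iff) auto
    thus "(\<Sum>p\<in>A. ?L p) \<le> ln Z" by simp
  qed
  moreover have "Z \<le> exp (infsum ?L {p. prime p})"
    unfolding Z_def
  proof (rule suminf_le_const)
    show "summable (\<lambda>n. real n powr (-1-s))" using sm by simp
    fix N :: nat
    let ?A = "{p. prime p \<and> p < N}"
    have A: "finite ?A" "?A \<subseteq> {p. prime p}" by (rule finite_subset[of _ "{..<N}"]) auto
    have "(\<Sum>n<N. real n powr (-1-s)) = (\<Sum>n\<in>{1..<N}. ?f n)"
      by (intro sum.mono_neutral_cong_right) auto
    also have "\<dots> \<le> exp (\<Sum>p\<in>?A. ?L p)"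
      by (rule finite_sum_le_has_sum[OF euler[OF A]]) (auto simp: in_prime_factors_iff dest!: dvd_imp_le)
    also have "\<dots> \<le> exp (infsum ?L {p. prime p})"
      unfolding exp_le_cancel_iff
      by (intro finite_sum_le_infsum summ A) (simp_all only: mem_Collect_eq bounds Diff_iff)
    finally show "(\<Sum>n<N. real n powr (-1-s)) \<le> exp (infsum ?L {p. prime p})" .
  qed
  hence "ln Z \<le> ln (exp (infsum ?L {p. prime p}))" using Zpos by (subst ln_le_cancel_iff) auto
  hence "ln Z \<le> infsum ?L {p. prime p}" by simp
  ultimately have "infsum ?L {p. prime p} = ln Z" by simp
  thus ?thesis using has_sum_infsum[OF summ] by (simp add: Z_def)
qed

section \<open>Behaviour of the prime zeta function at 1 and at larger integers\<close>

lemma prime_powr_diff_le: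
  fixes p :: nat
  assumes p: "prime p" and "j \<ge> 1" "s \<ge> 0"
  shows "real p powr -j - real p powr -(j * (1 + s)) \<le> j * s * (ln (real p) / real p)"
    "real p powr -(j * (1 + s)) \<le> real p powr -j"
proof -
  have p1: "real p > 1" using prime_gt_1_nat[OF p] by simp
  show "real p powr -(j * (1 + s)) \<le> real p powr -j" using p1 assms by (intro powr_mono) (auto simp: algebra_simps)
  have "real p powr -(j * (1 + s)) = real p powr -j * exp (- (j * s * ln (real p)))"
    using p1 by (simp add: powr_def exp_add[symmetric] algebra_simps)
  hence "real p powr -j - real p powr -(j * (1 + s)) = real p powr -j * (1 - exp (- (j * s * ln (real p))))"
    by (simp add: algebra_simps)
  also have "\<dots> \<le> (1 / real p) * (j * s * ln (real p))"
    using exp_ge_add_one_self[of "- (j * s * ln (real p))"] prime_powr_bounds[OF p, of j] p1 assms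
    by (intro mult_mono) auto
  finally show "real p powr -j - real p powr -(j * (1 + s)) \<le> j * s * (ln (real p) / real p)" by (simp add: mult_ac)
qed

lemma mertens_const_diff:
  "mertens_const - euler_mascheroni = (\<Sum>\<^sub>\<infinity>p | prime (p::nat). 1 / real p + ln (1 - 1 / real p))"
  by (simp add: mertens_const_def)

text \<open>Write \<open>y\<close> for \<open>p powr (-1-s)\<close>. Then the sum of the
  \<open>y\<close> is the logarithm of zeta at \<open>1 + s\<close> plus the sum of
  \<open>y + ln (1 - y)\<close>. The first part is \<open>ln (1 / s) + O(s)\<close> by
  \<open>zeta_bounds\<close>; the second is within \<open>O(s)\<close> of the same series at
  \<open>s = 0\<close>, which is the Mertens constant without its Euler-Mascheroni part.\<close>

lemma prime_zeta_near_1: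
  obtains C where "C \<ge> 0" "\<And>s. s > 0 \<Longrightarrow> \<bar>prime_zeta (1 + s) - (ln (1 / s) + (mertens_const - euler_mascheroni))\<bar> \<le> C * s"
proof
  let ?K = "\<Sum>\<^sub>\<infinity>p | prime (p::nat). ln (real p) / real p ^ 2"
  have K: "?K \<ge> 0" by (intro infsum_nonneg) (auto simp: ln_nat_nonneg)
  show "1 + 2 * ?K \<ge> 0" using K by simp
  fix s :: real assume s: "s > 0"
  let ?Z = "\<Sum>n. real n powr (-1-s)"
  let ?y = "\<lambda>p::nat. real p powr (-1-s)"
  let ?\<phi> = "\<lambda>y::real. y + ln (1 - y)"
  have sum_y: "(?y has_sum prime_zeta (1 + s)) {p. prime p}"
    using summable_on_powr[of "1+s" "{p. prime p}"] s by (simp add: prime_zeta_def has_sum_infsum)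
  have sum_\<phi>: "((\<lambda>p. ?\<phi> (?y p)) has_sum (prime_zeta (1 + s) - ln ?Z)) {p. prime p}"
    using has_sum_diff_real[OF sum_y has_sum_ln_euler_product[OF s]] by simp
  have sum_\<phi>1: "((\<lambda>p::nat. ?\<phi> (1 / real p)) has_sum (mertens_const - euler_mascheroni)) {p. prime p}"
    unfolding mertens_const_diff
  proof (rule has_sum_infsum)
    have "(\<lambda>p::nat. norm (?\<phi> (1 / real p))) summable_on {p. prime p}"
    proof (rule Infinite_Sum.abs_summable_on_comparison_test')
      show "(\<lambda>p. 2 * real p powr -2) summable_on {p. prime p}"
        by (intro summable_on_cmult_right summable_on_powr) auto
      fix p :: nat assume "p \<in> {p. prime p}"
      hence "real p \<ge> 2" using prime_ge_2_nat by auto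
      thus "norm (?\<phi> (1 / real p)) \<le> 2 * real p powr -2"
        using ln_one_minus_plus_diff_le[of 0 "1 / real p"] by (simp add: powr_minus_divide power2_eq_square)
    qed
    thus "(\<lambda>p::nat. ?\<phi> (1 / real p)) summable_on {p. prime p}" by (rule abs_summable_summable)
  qed
  have "norm ((mertens_const - euler_mascheroni) - (prime_zeta (1 + s) - ln ?Z)) \<le> 2 * s * ?K"
  proof (rule norm_infsum_le[OF has_sum_diff_real[OF sum_\<phi>1 sum_\<phi>]])
    show "((\<lambda>p. 2 * s * (ln (real p) / real p ^ 2)) has_sum (2 * s * ?K)) {p. prime p}"
      by (intro has_sum_cmult_right has_sum_infsum summable_on_ln_over_square)
    fix p :: nat assume "p \<in> {p. prime p}"
    hence p: "prime p" by simp
    have p2: "real p \<ge> 2" using prime_ge_2_nat[OF p] by simp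
    have "norm (?\<phi> (1 / real p) - ?\<phi> (?y p)) \<le> 2 * (1 / real p) * (1 / real p - ?y p)"
      unfolding real_norm_def using prime_powr_bounds[OF p, of "1+s"] s p2
      by (intro ln_one_minus_plus_diff_le) auto
    also have "\<dots> \<le> 2 * (1 / real p) * (s * (ln (real p) / real p))"
      using prime_powr_diff_le(1)[OF p, of 1 s] s p2
      by (intro mult_left_mono) (auto simp: powr_minus_divide)
    finally show "norm (?\<phi> (1 / real p) - ?\<phi> (?y p)) \<le> 2 * s * (ln (real p) / real p ^ 2)"
      by (simp add: power2_eq_square mult_ac)
  qed
  moreover have "ln ?Z - ln (1 / s) \<ge> 0"
    using zeta_bounds(1)[OF s] s by (simp add: ln_le_cancel_iff[of "1 / s"] less_le_trans[of 0 "1 / s"])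
  moreover have "ln ?Z - ln (1 / s) \<le> s"
  proof -
    have "0 < 1 / s" using s by simp
    hence Zpos: "?Z > 0" using zeta_bounds(1)[OF s] by linarith
    have "ln ?Z \<le> ln (1 / s + 1)" using zeta_bounds(2)[OF s] Zpos by (subst ln_le_cancel_iff) auto
    also have "1 / s + 1 = (1 / s) * (1 + s)" using s by (simp add: field_simps)
    also have "ln \<dots> = ln (1 / s) + ln (1 + s)" using s by (intro ln_mult_pos) auto
    also have "ln (1 + s) \<le> s" using s by (intro ln_add_one_self_le_self) auto
    finally show ?thesis by simp
  qed
  ultimately show "\<bar>prime_zeta (1 + s) - (ln (1 / s) + (mertens_const - euler_mascheroni))\<bar> \<le> (1 + 2 * ?K) * s"
    unfolding real_norm_def by (simp add: abs_le_iff algebra_simps)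
qed

text \<open>The bound \<open>1 - exp (-t) \<le> t\<close> with \<open>t = j * s * ln p\<close>,
  together with \<open>p powr -j \<le> 1 / p ^ 2\<close>, gives a convergent majorant proportional
  to \<open>s\<close>.\<close>

lemma prime_zeta_near_ge_2:
  assumes "j \<ge> 2"
  obtains C where "C \<ge> 0" "\<And>s. s > 0 \<Longrightarrow> \<bar>prime_zeta (real j * (1 + s)) - prime_zeta (real j)\<bar> \<le> C * s"
proof
  let ?K = "\<Sum>\<^sub>\<infinity>p | prime (p::nat). ln (real p) / real p ^ 2"
  have K: "?K \<ge> 0" by (intro infsum_nonneg) (auto simp: ln_nat_nonneg)
  thus "real j * ?K \<ge> 0" by simp
  fix s :: real assume s: "s > 0"
  have j1: "real j * (1 + s) > 1"
  proof -
    have "1 * 1 < real j * (1 + s)" using s assms by (intro mult_strict_mono) auto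
    thus ?thesis by simp
  qed
  have "norm (prime_zeta (real j * (1 + s)) - prime_zeta (real j)) \<le> (real j * s) * ?K"
    unfolding prime_zeta_def
  proof (rule norm_infsum_le[OF has_sum_diff_real[OF has_sum_infsum has_sum_infsum]])
    show "((\<lambda>p. real j * s * (ln (real p) / real p ^ 2)) has_sum (real j * s * ?K)) {p. prime p}"
      by (intro has_sum_cmult_right has_sum_infsum summable_on_ln_over_square)
    fix p :: nat assume "p \<in> {p. prime p}"
    hence p: "prime p" by simp
    have p1: "real p > 1" using prime_gt_1_nat[OF p] by simp
    have "real p powr -real j - real p powr -(real j * (1 + s))
        = real p powr -real j * (1 - real p powr -(real j * s))"
      using p1 by (simp add: algebra_simps powr_add[symmetric])
    also have "\<dots> \<le> (1 / real p ^ 2) * (real j * s * ln (real p))"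
    proof (intro mult_mono)
      have "real p powr -real j \<le> real p powr -2" using p1 assms by (intro powr_mono) auto
      thus "real p powr -real j \<le> 1 / real p ^ 2" using p1 by (simp add: powr_minus_divide)
      show "1 - real p powr -(real j * s) \<le> real j * s * ln (real p)"
        using exp_ge_add_one_self[of "- (real j * s * ln (real p))"] p1 by (simp add: powr_def)
      have "real p powr -(real j * s) \<le> real p powr 0" using p1 s by (intro powr_mono) auto
      thus "0 \<le> 1 - real p powr -(real j * s)" using p1 by simp
    qed auto
    finally have "real p powr -real j - real p powr -(real j * (1 + s)) \<le> real j * s * (ln (real p) / real p ^ 2)"
      by simp
    moreover have "real p powr -(real j * (1 + s)) \<le> real p powr -real j"
      using prime_powr_diff_le(2)[OF p, of "real j" s] assms s by simp
    ultimately show "norm (real p powr -(real j * (1 + s)) - real p powr -real j) \<le> real j * s * (ln (real p) / real p ^ 2)"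
      by simp
  qed (use j1 assms in \<open>auto intro!: summable_on_powr\<close>)
  thus "\<bar>prime_zeta (real j * (1 + s)) - prime_zeta (real j)\<bar> \<le> real j * ?K * s"
    by (simp add: mult_ac)
qed

section \<open>Dirichlet series and Newton identities\<close>

definition omega_fiber :: "nat \<Rightarrow> nat set" where
  "omega_fiber k = {n. n > 0 \<and> prime_Omega n = k}"

lemma in_omega_fiber_iff [simp]: "n \<in> omega_fiber k \<longleftrightarrow> n > 0 \<and> prime_Omega n = k"
  by (simp add: omega_fiber_def)

definition omega_dirichlet :: "nat \<Rightarrow> real \<Rightarrow> real" where
  "omega_dirichlet k \<sigma> = (\<Sum>\<^sub>\<infinity>n\<in>omega_fiber k. real n powr -\<sigma>)"

lemma has_sum_omega_dirichlet:
  "\<sigma> > 1 \<Longrightarrow> ((\<lambda>n. real n powr -\<sigma>) has_sum omega_dirichlet k \<sigma>) (omega_fiber k)"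
  unfolding omega_dirichlet_def by (intro has_sum_infsum summable_on_powr)

lemma omega_dirichlet_0: "omega_dirichlet 0 \<sigma> = 1"
proof -
  have "omega_fiber 0 = {1}" by (auto simp: omega_fiber_def prime_Omega_eq_0_iff)
  thus ?thesis by (simp add: omega_dirichlet_def)
qed

lemma has_sum_product_real:
  fixes f :: "'a \<Rightarrow> real" and g :: "'b \<Rightarrow> real"
  assumes "(f has_sum a) A" "(g has_sum b) B" "\<And>x. x \<in> A \<Longrightarrow> f x \<ge> 0" "\<And>y. y \<in> B \<Longrightarrow> g y \<ge> 0"
  shows "((\<lambda>(x, y). f x * g y) has_sum (a * b)) (A \<times> B)"
proof (rule has_sum_SigmaI)
  show inner: "((\<lambda>y. case (x, y) of (x, y) \<Rightarrow> f x * g y) has_sum (f x * b)) B" for x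
    using has_sum_cmult_right[OF assms(2)] by simp
  show outer: "((\<lambda>x. f x * b) has_sum (a * b)) A"
    by (rule has_sum_cmult_left[OF assms(1)])
  show "(\<lambda>(x, y). f x * g y) summable_on A \<times> B"
    by (rule summable_on_SigmaI[OF inner]) (use outer assms(3,4) in \<open>auto simp: summable_on_def\<close>)
qed

text \<open>Count the pairs \<open>(p, j)\<close> with \<open>p\<^sup>j\<close> dividing \<open>n\<close>: there are \<open>\<Omega>(n)\<close> of them.\<close>

lemma omega_dirichlet_rec:
  assumes \<sigma>: "\<sigma> > 1"
  shows "real k * omega_dirichlet k \<sigma> = (\<Sum>j=1..k. prime_zeta (real j * \<sigma>) * omega_dirichlet (k - j) \<sigma>)"
proof -
  let ?P = "{p::nat. prime p}"
  let ?T = "\<lambda>n. Sigma (prime_factors n) (\<lambda>p. {1..multiplicity p n})"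
  let ?S = "\<Sum>j=1..k. prime_zeta (real j * \<sigma>) * omega_dirichlet (k - j) \<sigma>"
  let ?f = "\<lambda>(j::nat, p::nat, m::nat). real p powr -(real j * \<sigma>) * real m powr -\<sigma>"
  have inner: "((\<lambda>y. ?f (j, y)) has_sum (prime_zeta (real j * \<sigma>) * omega_dirichlet (k - j) \<sigma>)) (?P \<times> omega_fiber (k - j))"
    if "j \<in> {1..k}" for j
  proof -
    have "1 * \<sigma> \<le> real j * \<sigma>" using that \<sigma> by (intro mult_right_mono) auto
    hence j: "real j * \<sigma> > 1" using \<sigma> by linarith
    have "((\<lambda>p::nat. real p powr -(real j * \<sigma>)) has_sum prime_zeta (real j * \<sigma>)) ?P"
      unfolding prime_zeta_def by (intro has_sum_infsum summable_on_powr j)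
    from has_sum_product_real[OF this has_sum_omega_dirichlet[OF \<sigma>]] show ?thesis
      by (simp add: case_prod_unfold)
  qed
  have outer: "((\<lambda>j. prime_zeta (real j * \<sigma>) * omega_dirichlet (k - j) \<sigma>) has_sum ?S) {1..k}"
    by (rule has_sum_finite) auto
  have "(\<lambda>j. prime_zeta (real j * \<sigma>) * omega_dirichlet (k - j) \<sigma>) summable_on {1..k}"
    using outer by (rule has_sum_imp_summable)
  from summable_on_SigmaI[OF inner this]
  have "?f summable_on (Sigma {1..k} (\<lambda>j. ?P \<times> omega_fiber (k - j)))" by auto
  from has_sum_SigmaI[OF inner outer this]
  have "(?f has_sum ?S) (Sigma {1..k} (\<lambda>j. ?P \<times> omega_fiber (k - j)))" .
  \<comment> \<open>The cofactor \<open>m\<close> in \<open>n = p ^ j * m\<close> may still be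
    divisible by \<open>p\<close>; therefore \<open>j\<close> ranges over all of
    \<open>{1..multiplicity p n}\<close>, and there is one triple for each such
    \<open>j\<close>.\<close>
  also have "?this \<longleftrightarrow> ((\<lambda>(n, p, j). real n powr -\<sigma>) has_sum ?S) (Sigma (omega_fiber k) ?T)"
  proof (rule has_sum_reindex_bij_witness[where j = "\<lambda>(j, p, m). (p ^ j * m, p, j)" and i = "\<lambda>(n, p, j). (j, p, n div p ^ j)"])
    fix a assume "a \<in> Sigma {1..k} (\<lambda>j. ?P \<times> omega_fiber (k - j))"
    then obtain j p m where a: "a = (j, p, m)" and j: "1 \<le> j" "j \<le> k" and p: "prime p"
      and m: "m > 0" "prime_Omega m = k - j" by auto
    have p0: "p > 0" using p by (rule prime_gt_0_nat)
    show "(case case a of (j, p, m) \<Rightarrow> (p ^ j * m, p, j) of (n, p, j) \<Rightarrow> (j, p, n div p ^ j)) = a"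
      using a p0 by simp
    have "multiplicity p (p ^ j * m) \<ge> j"
      using p m p0 by (intro multiplicity_geI) (auto simp: prime_nat_iff)
    moreover have "prime_Omega (p ^ j * m) = k" using p m j by (simp add: prime_Omega_prime_power_mult)
    moreover have "p dvd p ^ j * m" using j by (intro dvd_mult2 dvd_power) auto
    ultimately show "(case a of (j, p, m) \<Rightarrow> (p ^ j * m, p, j)) \<in> Sigma (omega_fiber k) ?T"
      using a p m j p0 by (simp add: in_prime_factors_iff)
    show "(case case a of (j, p, m) \<Rightarrow> (p ^ j * m, p, j) of (n, p, j) \<Rightarrow> real n powr -\<sigma>) = ?f a"
    proof -
      have "real (p ^ j) = real p powr real j" using p0 by (simp add: powr_realpow)
      hence "real (p ^ j * m) powr -\<sigma> = real p powr -(real j * \<sigma>) * real m powr -\<sigma>"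
        unfolding of_nat_mult by (simp add: powr_mult powr_powr del: of_nat_power)
      thus ?thesis unfolding a prod.case .
    qed
  next
    fix b assume "b \<in> Sigma (omega_fiber k) ?T"
    then obtain n p j where b: "b = (n, p, j)" and n: "n > 0" "prime_Omega n = k" and p: "prime p"
      and j: "1 \<le> j" "j \<le> multiplicity p n" by (auto simp: in_prime_factors_iff)
    have p0: "p > 0" using p by (rule prime_gt_0_nat)
    have "p ^ j dvd n" using j by (intro multiplicity_dvd') auto
    then obtain m where m: "n = p ^ j * m" by auto
    have m0: "m > 0" using m n by (auto intro: Nat.gr0I)
    have "j + prime_Omega m = k" using m n m0 p by (simp add: prime_Omega_prime_power_mult)
    thus "(case b of (n, p, j) \<Rightarrow> (j, p, n div p ^ j)) \<in> Sigma {1..k} (\<lambda>j. ?P \<times> omega_fiber (k - j))"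
      using b m m0 p p0 j by auto
    show "(case case b of (n, p, j) \<Rightarrow> (j, p, n div p ^ j) of (j, p, m) \<Rightarrow> (p ^ j * m, p, j)) = b"
      using b m p0 by simp
  qed (rule refl)
  finally have "((\<lambda>n. real k * real n powr -\<sigma>) has_sum ?S) (omega_fiber k)"
  proof (rule has_sum_SigmaD)
    fix n assume n: "n \<in> omega_fiber k"
    have "(\<Sum>y\<in>?T n. case (n, y) of (n, p, j) \<Rightarrow> real n powr -\<sigma>) = real (card (?T n)) * real n powr -\<sigma>"
      by (simp add: case_prod_unfold del: card_SigmaI)
    also have "card (?T n) = k" using n by (simp add: prime_Omega_eq_sum[symmetric])
    finally have eq: "(\<Sum>y\<in>?T n. case (n, y) of (n, p, j) \<Rightarrow> real n powr -\<sigma>) = real k * real n powr -\<sigma>" .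
    have fin: "finite (?T n)" by (intro finite_SigmaI) auto
    from has_sum_finite[OF fin, of "\<lambda>y. case (n, y) of (n, p, j) \<Rightarrow> real n powr -\<sigma>"]
    show "((\<lambda>y. case (n, y) of (n, p, j) \<Rightarrow> real n powr -\<sigma>) has_sum (real k * real n powr -\<sigma>)) (?T n)"
      unfolding eq .
  qed
  thus ?thesis
    using has_sum_cmult_right[OF has_sum_omega_dirichlet[OF \<sigma>, of k], of "real k"] has_sum_unique by blast
qed

section \<open>Newton's identities for formal power series\<close>

definition dilated_fps :: "nat \<Rightarrow> (nat \<Rightarrow> real) \<Rightarrow> real fps" where
  "dilated_fps j c = Abs_fps (\<lambda>m. if j dvd m then c (m div j) else 0)"

text \<open>The series \<open>exp (c * z ^ j)\<close>; in general \<open>dilated_fps j c\<close> is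
  the series with coefficients \<open>c\<close> evaluated at \<open>z ^ j\<close>.\<close>

abbreviation dilated_exp :: "nat \<Rightarrow> real \<Rightarrow> real fps" where
  "dilated_exp j c \<equiv> dilated_fps j (\<lambda>n. c ^ n / fact n)"

lemma dilated_fps_1: "dilated_fps 1 c = Abs_fps c" "dilated_fps (Suc 0) c = Abs_fps c"
  by (simp_all add: dilated_fps_def)

lemma dilated_exp_1: "dilated_exp (Suc 0) c = fps_exp c"
  by (simp add: dilated_fps_1 fps_exp_def)

text \<open>The operator \<open>z d/dz\<close> multiplies the coefficient of \<open>z ^ m\<close> by
  \<open>m\<close>; at \<open>m = j * Suc q\<close> the claim becomes
  \<open>Suc q * (c ^ Suc q / fact (Suc q)) = c * (c ^ q / fact q)\<close>.\<close>

lemma dilated_exp_deriv: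
  assumes "j > 0"
  shows "fps_X * fps_deriv (dilated_exp j c) = fps_const (real j * c) * fps_X ^ j * dilated_exp j c"
proof (rule fps_ext)
  fix m
  have l: "fps_nth (fps_X * fps_deriv (dilated_exp j c)) m = real m * fps_nth (dilated_exp j c) m"
    by (cases m) auto
  have "fps_nth (fps_const (real j * c) * fps_X ^ j * dilated_exp j c) m
      = real j * c * (if m < j then 0 else fps_nth (dilated_exp j c) (m - j))"
    by (simp add: mult.assoc fps_X_power_mult_nth)
  also have "\<dots> = real m * fps_nth (dilated_exp j c) m"
  proof (cases "j dvd m \<and> m > 0")
    case True
    then obtain q where q: "m = j * Suc q" by (metis dvdE mult_0_right not0_implies_Suc not_gr0)
    have "m - j = j * q" using q by simp
    hence "fps_nth (dilated_exp j c) (m - j) = c ^ q / fact q"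
      using assms by (simp add: dilated_fps_def)
    moreover have "real (Suc q) * (c ^ Suc q / fact (Suc q)) = c * (c ^ q / fact q)"
      by (simp del: of_nat_Suc)
    hence "real j * c * (c ^ q / fact q) = real (j * Suc q) * (c ^ Suc q / fact (Suc q))"
      by (simp only: of_nat_mult mult.assoc)
    moreover have "fps_nth (dilated_exp j c) m = c ^ Suc q / fact (Suc q)"
      using assms unfolding q dilated_fps_def by (simp del: fact_Suc power_Suc mult_Suc_right)
    moreover have "\<not> m < j" using q by simp
    ultimately show ?thesis unfolding q by (simp only: if_False)
  next
    case False
    have "m < j \<or> \<not> j dvd m - j"
      using False assms by (cases "m < j") (auto simp: dvd_minus_self)
    thus ?thesis using False by (auto simp: dilated_fps_def)
  qed
  finally show "fps_nth (fps_X * fps_deriv (dilated_exp j c)) m = fps_nth (fps_const (real j * c) * fps_X ^ j * dilated_exp j c) m"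
    using l by simp
qed

text \<open>The truncation at \<open>N\<close> of \<open>exp (\<Sum>j. a j * z ^ j / j)\<close>, the
  generating function of the complete homogeneous symmetric functions whose power sums are
  \<open>a j\<close>. Coefficients up to \<open>N\<close> do not depend on the truncation.\<close>

definition newton_fps :: "(nat \<Rightarrow> real) \<Rightarrow> nat \<Rightarrow> real fps" where
  "newton_fps a N = (\<Prod>j=1..N. dilated_exp j (a j / real j))"

lemma newton_fps_deriv:
  "fps_X * fps_deriv (newton_fps a N) = (\<Sum>j=1..N. fps_const (a j) * fps_X ^ j) * newton_fps a N"
proof (induction N)
  case (Suc N)
  have "fps_X * fps_deriv (newton_fps a (Suc N)) =
      (fps_X * fps_deriv (newton_fps a N)) * dilated_exp (Suc N) (a (Suc N) / real (Suc N)) +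
      newton_fps a N * (fps_X * fps_deriv (dilated_exp (Suc N) (a (Suc N) / real (Suc N))))"
    by (simp add: newton_fps_def algebra_simps del: of_nat_Suc)
  also have "\<dots> = (\<Sum>j=1..Suc N. fps_const (a j) * fps_X ^ j) * newton_fps a (Suc N)"
    unfolding Suc.IH dilated_exp_deriv[OF zero_less_Suc]
    by (simp add: newton_fps_def algebra_simps del: of_nat_Suc)
  finally show ?case .
qed (simp add: newton_fps_def)

lemma newton_fps_0: "fps_nth (newton_fps a N) 0 = 1"
  by (induction N) (auto simp: newton_fps_def dilated_fps_def)

text \<open>Coefficient comparison in the logarithmic derivative; for \<open>k \<le> N\<close> the
  truncation does not interfere.\<close>

lemma newton_fps_rec:
  assumes "k \<le> N"
  shows "real k * fps_nth (newton_fps a N) k = (\<Sum>j=1..k. a j * fps_nth (newton_fps a N) (k - j))"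
proof -
  have "real k * fps_nth (newton_fps a N) k = fps_nth (fps_X * fps_deriv (newton_fps a N)) k"
    by (cases k) auto
  also have "\<dots> = (\<Sum>j=1..N. a j * (if k < j then 0 else fps_nth (newton_fps a N) (k - j)))"
    unfolding newton_fps_deriv by (simp add: sum_distrib_right fps_sum_nth mult.assoc fps_X_power_mult_nth)
  also have "\<dots> = (\<Sum>j=1..k. a j * fps_nth (newton_fps a N) (k - j))"
    using assms by (intro sum.mono_neutral_cong_right) auto
  finally show ?thesis .
qed

lemma newton_fps_unique:
  assumes "f 0 = 1" "\<And>k. 1 \<le> k \<Longrightarrow> k \<le> N \<Longrightarrow> real k * f k = (\<Sum>j=1..k. a j * f (k - j))" "k \<le> N"
  shows "f k = fps_nth (newton_fps a N) k"
  using assms(3)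
proof (induction k rule: less_induct)
  case (less k)
  show ?case
  proof (cases "k = 0")
    case False
    hence "real k * f k = (\<Sum>j=1..k. a j * f (k - j))" using less by (intro assms(2)) auto
    also have "\<dots> = (\<Sum>j=1..k. a j * fps_nth (newton_fps a N) (k - j))"
      using less by (intro sum.cong refl) auto
    also have "\<dots> = real k * fps_nth (newton_fps a N) k" using newton_fps_rec[OF less.prems] by simp
    finally show ?thesis using False by simp
  qed (simp add: assms newton_fps_0)
qed

text \<open>Both sequences start with 1 and satisfy Newton's recursion, the power sums being those
  of the family \<open>p powr -\<sigma>\<close>.\<close>

lemma omega_dirichlet_eq_newton:
  assumes "\<sigma> > 1" "k \<le> N"
  shows "omega_dirichlet k \<sigma> = fps_nth (newton_fps (\<lambda>j. prime_zeta (real j * \<sigma>)) N) k"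
  using assms by (intro newton_fps_unique[of "\<lambda>k. omega_dirichlet k \<sigma>"] omega_dirichlet_0 omega_dirichlet_rec) auto

section \<open>Coefficients of products as sums over weighted tuples\<close>

definition tuples_of_weight :: "nat set \<Rightarrow> nat \<Rightarrow> (nat \<Rightarrow> nat) set" where
  "tuples_of_weight A m = {n \<in> A \<rightarrow>\<^sub>E UNIV. (\<Sum>j\<in>A. j * n j) = m}"

lemma finite_tuples_of_weight:
  assumes "finite A" "0 \<notin> A"
  shows "finite (tuples_of_weight A m)"
proof (rule finite_subset)
  show "tuples_of_weight A m \<subseteq> A \<rightarrow>\<^sub>E {..m}"
  proof
    fix n assume n: "n \<in> tuples_of_weight A m"
    have "n j \<le> m" if j: "j \<in> A" for j
    proof -
      have "j > 0" using j assms by (auto intro: Nat.gr0I)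
      hence "n j \<le> j * n j" by simp
      also have "\<dots> \<le> (\<Sum>j\<in>A. j * n j)"
        using j assms by (intro member_le_sum) auto
      finally show ?thesis using n by (simp add: tuples_of_weight_def)
    qed
    thus "n \<in> A \<rightarrow>\<^sub>E {..m}" using n by (auto simp: tuples_of_weight_def PiE_iff)
  qed
qed (use assms in \<open>simp add: finite_PiE\<close>)

text \<open>Arbitrary finite index sets allow induction: the factor for \<open>a\<close> supplies an
  exponent \<open>a * n a\<close>, and the remaining weight is distributed over
  \<open>A\<close>.\<close>

lemma prod_dilated_fps_nth:
  assumes "finite A" "0 \<notin> A"
  shows "fps_nth (\<Prod>j\<in>A. dilated_fps j (c j)) m = (\<Sum>n\<in>tuples_of_weight A m. \<Prod>j\<in>A. c j (n j))"
  using assms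
proof (induction A arbitrary: m rule: finite_induct)
  case empty
  have "tuples_of_weight {} m = (if m = 0 then {\<lambda>_. undefined} else {})"
    by (auto simp: tuples_of_weight_def)
  thus ?case by simp
next
  case (insert a A)
  let ?I = "{i \<in> {0..m}. a dvd i}"
  have a: "a > 0" "0 \<notin> A" using insert by auto
  have "fps_nth (\<Prod>j\<in>insert a A. dilated_fps j (c j)) m
      = (\<Sum>i=0..m. (if a dvd i then c a (i div a) else 0) * (\<Sum>n\<in>tuples_of_weight A (m - i). \<Prod>j\<in>A. c j (n j)))"
    using insert by (simp add: fps_mult_nth dilated_fps_def)
  also have "\<dots> = (\<Sum>i\<in>?I. \<Sum>n\<in>tuples_of_weight A (m - i). c a (i div a) * (\<Prod>j\<in>A. c j (n j)))"
    by (intro sum.mono_neutral_cong_right) (auto simp: sum_distrib_left)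
  also have "\<dots> = (\<Sum>(i, n)\<in>Sigma ?I (\<lambda>i. tuples_of_weight A (m - i)). c a (i div a) * (\<Prod>j\<in>A. c j (n j)))"
    by (intro sum.Sigma) (auto intro!: finite_tuples_of_weight insert a)
  also have "\<dots> = (\<Sum>n\<in>tuples_of_weight (insert a A) m. \<Prod>j\<in>insert a A. c j (n j))"
  \<comment> \<open>Removing \<open>a\<close> from the domain resets its value to
    \<open>undefined\<close>, as extensionality on \<open>A\<close> demands.\<close>
  proof (rule sum.reindex_bij_witness[where j = "\<lambda>(i, n). n(a := i div a)" and i = "\<lambda>n. (a * n a, n(a := undefined))"])
    fix z assume "z \<in> Sigma ?I (\<lambda>i. tuples_of_weight A (m - i))"
    then obtain i n where z: "z = (i, n)" and i: "i \<le> m" "a dvd i" and n: "n \<in> tuples_of_weight A (m - i)" by auto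
    have na: "n a = undefined" using n insert by (auto simp: tuples_of_weight_def PiE_iff extensional_def)
    show "(\<lambda>n. (a * n a, n(a := undefined))) (case z of (i, n) \<Rightarrow> n(a := i div a)) = z"
      using z i na by (auto simp: fun_eq_iff)
    have s: "(\<Sum>j\<in>A. j * (n(a := i div a)) j) = (\<Sum>j\<in>A. j * n j)"
      using insert by (intro sum.cong) auto
    show "(case z of (i, n) \<Rightarrow> n(a := i div a)) \<in> tuples_of_weight (insert a A) m"
      using z i n insert s by (auto simp: tuples_of_weight_def PiE_iff extensional_def)
    have "(\<Prod>j\<in>A. c j ((n(a := i div a)) j)) = (\<Prod>j\<in>A. c j (n j))"
      using insert by (intro prod.cong) auto
    thus "(\<Prod>j\<in>insert a A. c j ((case z of (i, n) \<Rightarrow> n(a := i div a)) j)) =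
        (case z of (i, n) \<Rightarrow> c a (i div a) * (\<Prod>j\<in>A. c j (n j)))"
      using z insert by simp
  next
    fix n assume n: "n \<in> tuples_of_weight (insert a A) m"
    show "(case (a * n a, n(a := undefined)) of (i, n) \<Rightarrow> n(a := i div a)) = n"
      using a by (auto simp: fun_eq_iff)
    have s: "(\<Sum>j\<in>A. j * (n(a := undefined)) j) = (\<Sum>j\<in>A. j * n j)"
      using insert by (intro sum.cong) auto
    show "(a * n a, n(a := undefined)) \<in> Sigma ?I (\<lambda>i. tuples_of_weight A (m - i))"
      using n insert s by (auto simp: tuples_of_weight_def PiE_iff extensional_def)
  qed
  finally show ?case .
qed

lemma weighted_tuples_eq: "weighted_tuples k = tuples_of_weight {1..k} k"
  by (simp add: weighted_tuples_def tuples_of_weight_def)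

section \<open>The power series of the Gamma function at 1\<close>

lemma borel_imp_lebesgue_on:
  "f \<in> borel_measurable borel \<Longrightarrow> f \<in> borel_measurable (lebesgue_on S)"
  by (intro measurable_restrict_space1 measurable_completion) simp

lemma has_integral_nonneg_iff_pos:
  fixes f :: "real \<Rightarrow> real"
  shows "(f has_integral I) {0..} \<longleftrightarrow> (f has_integral I) {0<..}"
proof (rule has_integral_spike_set_eq)
  show "negligible {x \<in> {0..} - {0<..}. f x \<noteq> 0}"
    by (rule negligible_subset[of "{0}"]) auto
qed (auto intro: negligible_subset[of "{}"])

lemma Gamma_integral_pos:
  fixes x :: real
  assumes "x > 0"
  shows "((\<lambda>t. exp (-t) * t powr (x - 1)) has_integral Gamma x) {0<..}"
  using Gamma_integral_real[OF assms]
  by (simp add: has_integral_nonneg_iff_pos exp_minus field_simps)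

text \<open>The \<open>i\<close>-th derivative of Gamma at 1, as \<open>Gamma_power_series\<close>
  shows.\<close>

definition log_moment :: "nat \<Rightarrow> real" where
  "log_moment i = integral {0<..} (\<lambda>t. exp (-t) * ln t ^ i)"

lemma exp_abs_ln_le:
  fixes t a :: real
  assumes "t > 0" "a \<ge> 0"
  shows "exp (a * \<bar>ln t\<bar>) \<le> t powr a + t powr -a"
  using assms by (auto simp: powr_def abs_if)

text \<open>The common majorant for all later integrals. The restriction \<open>a < 1\<close>
  secures integrability at 0; the applications to logarithms use \<open>a = 1/2\<close>.\<close>

lemma integrable_exp_abs_ln:
  fixes a :: real
  assumes "0 \<le> a" "a < 1"
  shows "(\<lambda>t. exp (-t) * (t powr a + t powr -a)) integrable_on {0<..}"
proof -
  have "((\<lambda>t. exp (-t) * t powr ((1 + a) - 1) + exp (-t) * t powr ((1 - a) - 1)) has_integral (Gamma (1 + a) + Gamma (1 - a))) {0<..}"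
    using assms by (intro has_integral_add Gamma_integral_pos) auto
  from has_integral_integrable[OF this] show ?thesis by (simp add: distrib_left)
qed

lemma has_integral_log_moment:
  "((\<lambda>t. exp (-t) * ln t ^ i) has_integral log_moment i) {0<..}"
  unfolding log_moment_def
proof (rule integrable_integral, rule measurable_bounded_by_integrable_imp_integrable_real)
  show "(\<lambda>t::real. exp (-t) * ln t ^ i) \<in> borel_measurable (lebesgue_on {0<..})"
    by (rule borel_imp_lebesgue_on) measurable
  show "(\<lambda>t::real. (fact i * 2 ^ i) * (exp (-t) * (t powr (1/2) + t powr -(1/2)))) integrable_on {0<..}"
    by (intro integrable_on_mult_right integrable_exp_abs_ln) auto
  fix t :: real assume "t \<in> {0<..}"
  hence t: "t > 0" by simp
  have "\<bar>ln t\<bar> ^ i = (fact i * 2 ^ i) * ((1/2 * \<bar>ln t\<bar>) ^ i / fact i)"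
    by (simp add: power_divide)
  also have "\<dots> \<le> (fact i * 2 ^ i) * exp (1/2 * \<bar>ln t\<bar>)"
    by (intro mult_left_mono power_le_exp) auto
  also have "\<dots> \<le> (fact i * 2 ^ i) * (t powr (1/2) + t powr -(1/2))"
    by (intro mult_left_mono exp_abs_ln_le t) auto
  finally have "exp (-t) * \<bar>ln t\<bar> ^ i \<le> exp (-t) * ((fact i * 2 ^ i) * (t powr (1/2) + t powr -(1/2)))"
    by (intro mult_left_mono) auto
  thus "\<bar>exp (-t) * ln t ^ i\<bar> \<le> (fact i * 2 ^ i) * (exp (-t) * (t powr (1/2) + t powr -(1/2)))"
    by (simp add: abs_mult power_abs mult_ac)
qed auto

lemma log_moment_0: "log_moment 0 = 1"
proof -
  have "((\<lambda>t::real. exp (-t) * ln t ^ 0) has_integral Gamma 1) {0<..}"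
    by (rule has_integral_eq[OF _ Gamma_integral_pos[of 1]]) auto
  from has_integral_unique[OF has_integral_log_moment this] show ?thesis by simp
qed

text \<open>Expand \<open>t powr z = exp (z * ln t)\<close> under the Gamma integral. All partial
  sums are dominated by \<open>exp \<bar>z * ln t\<bar>\<close>, so dominated convergence permits
  termwise integration.\<close>

lemma Gamma_power_series:
  fixes z :: real
  assumes "\<bar>z\<bar> < 1"
  shows "(\<lambda>i. log_moment i / fact i * z ^ i) sums Gamma (1 + z)"
proof -
  let ?f = "\<lambda>K t. \<Sum>i<K. (z ^ i / fact i) * (exp (-t) * ln t ^ i)"
  have f: "(?f K has_integral (\<Sum>i<K. (z ^ i / fact i) * log_moment i)) {0<..}" for K
    by (intro has_integral_sum has_integral_mult_right has_integral_log_moment) auto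
  have f_eq: "?f K t = exp (-t) * (\<Sum>i<K. (z * ln t) ^ i / fact i)" for K t
    by (simp add: sum_distrib_left power_mult_distrib mult_ac)
  have dom: "norm (?f K t) \<le> exp (-t) * (t powr \<bar>z\<bar> + t powr -\<bar>z\<bar>)" if "t \<in> {0<..}" for K t
  proof -
    have t: "t > 0" using that by simp
    have "\<bar>\<Sum>i<K. (z * ln t) ^ i / fact i\<bar> \<le> (\<Sum>i<K. \<bar>z * ln t\<bar> ^ i / fact i)"
      by (rule order_trans[OF sum_abs]) (simp add: power_abs)
    also have "\<dots> \<le> (\<Sum>i. \<bar>z * ln t\<bar> ^ i / fact i)"
      using exp_converges[of "\<bar>z * ln t\<bar>"]
      by (intro sum_le_suminf) (auto simp: sums_iff divide_inverse mult.commute)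
    also have "\<dots> = exp \<bar>z * ln t\<bar>"
      using exp_converges[of "\<bar>z * ln t\<bar>"] by (simp add: sums_iff divide_inverse mult.commute)
    also have "\<dots> \<le> t powr \<bar>z\<bar> + t powr -\<bar>z\<bar>"
      unfolding abs_mult by (intro exp_abs_ln_le t) auto
    finally show ?thesis unfolding f_eq real_norm_def abs_mult by (simp add: mult_left_mono)
  qed
  have conv: "(\<lambda>K. ?f K t) \<longlonglongrightarrow> exp (-t) * t powr z" if "t \<in> {0<..}" for t
  proof -
    have "(\<lambda>i. (z * ln t) ^ i / fact i) sums exp (z * ln t)"
      using exp_converges[of "z * ln t"] by (simp add: divide_inverse mult.commute)
    hence "(\<lambda>K. exp (-t) * (\<Sum>i<K. (z * ln t) ^ i / fact i)) \<longlonglongrightarrow> exp (-t) * exp (z * ln t)"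
      unfolding sums_def by (intro tendsto_intros)
    thus ?thesis using that unfolding f_eq by (simp add: powr_def)
  qed
  have "(\<lambda>K. integral {0<..} (?f K)) \<longlonglongrightarrow> integral {0<..} (\<lambda>t. exp (-t) * t powr z)"
    by (rule dominated_convergence(2)[OF has_integral_integrable[OF f] integrable_exp_abs_ln[of "\<bar>z\<bar>"] dom conv])
       (use assms in auto)
  also have "(\<lambda>K. integral {0<..} (?f K)) = (\<lambda>K. \<Sum>i<K. (z ^ i / fact i) * log_moment i)"
    by (intro ext integral_unique f)
  also have "integral {0<..} (\<lambda>t. exp (-t) * t powr z) = Gamma (1 + z)"
    using Gamma_integral_pos[of "1 + z"] assms by (intro integral_unique) auto
  finally show ?thesis by (simp add: sums_def mult_ac)
qed

definition Gamma_fps :: "real fps" where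
  "Gamma_fps = Abs_fps (\<lambda>i. log_moment i / fact i)"

lemma has_fps_expansion_Gamma: "(\<lambda>z::real. Gamma (1 + z)) has_fps_expansion Gamma_fps"
  unfolding has_fps_expansion_def
proof
  have "summable (\<lambda>i. log_moment i / fact i * (1/2) ^ i)"
    using Gamma_power_series[of "1/2"] by (auto simp: sums_iff)
  from conv_radius_geI[OF this] have "conv_radius (\<lambda>i. log_moment i / fact i) \<ge> ereal (1/2)" by simp
  thus "fps_conv_radius Gamma_fps > 0"
    by (auto simp: fps_conv_radius_def Gamma_fps_def zero_ereal_def intro: less_le_trans[of _ "ereal (1/2)"])
  have "eventually (\<lambda>z::real. z \<in> {-1<..<1}) (nhds 0)"
    by (intro eventually_nhds_in_open) auto
  thus "\<forall>\<^sub>F z in nhds 0. eval_fps Gamma_fps z = Gamma (1 + z)"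
    by eventually_elim (use Gamma_power_series in \<open>auto simp: eval_fps_def Gamma_fps_def sums_iff abs_less_iff\<close>)
qed

lemma has_fps_expansion_imp_fps_nth:
  fixes f :: "'a :: {banach, real_normed_field} \<Rightarrow> 'a"
  assumes "f has_fps_expansion F"
  shows "fps_nth F n = (deriv ^^ n) f 0 / fact n"
  using assms
proof (induction n arbitrary: f F)
  case 0
  hence "eventually (\<lambda>z. eval_fps F z = f z) (nhds 0)" by (simp add: has_fps_expansion_def)
  hence "eval_fps F 0 = f 0" by (rule eventually_nhds_x_imp_x)
  thus ?case by (simp add: eval_fps_at_0)
next
  case (Suc n)
  have "fps_nth (fps_deriv F) n = (deriv ^^ n) (deriv f) 0 / fact n"
    by (intro Suc.IH has_fps_expansion_deriv Suc.prems)
  hence "of_nat (Suc n) * fps_nth F (Suc n) = (deriv ^^ Suc n) f 0 / fact n"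
    by (simp add: funpow_Suc_right del: funpow.simps of_nat_Suc)
  thus ?case by (simp add: field_simps del: of_nat_Suc funpow.simps)
qed

lemma higher_deriv_shift:
  fixes f :: "real \<Rightarrow> real"
  shows "(deriv ^^ n) (\<lambda>z. f (1 + z)) = (\<lambda>z. (deriv ^^ n) f (1 + z))"
proof (induction n)
  case (Suc n)
  have "deriv (\<lambda>z. g (1 + z)) = (\<lambda>z. deriv g (1 + z))" for g :: "real \<Rightarrow> real"
    using DERIV_shift[of g _ _ 1] by (auto simp: deriv_def add.commute fun_eq_iff)
  thus ?case using Suc by simp
qed simp

text \<open>Connects the derivatives at 1 that occur in \<open>a_coeff\<close> with the formal
  inverse of \<open>Gamma_fps\<close>.\<close>

lemma inverse_Gamma_fps_nth:
  "fps_nth (inverse Gamma_fps) n = (deriv ^^ n) (\<lambda>s::real. 1 / Gamma s) 1 / fact n"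
proof -
  have "(\<lambda>z::real. inverse (Gamma (1 + z))) has_fps_expansion inverse Gamma_fps"
    by (intro has_fps_expansion_inverse has_fps_expansion_Gamma) (simp add: Gamma_fps_def log_moment_0)
  from has_fps_expansion_imp_fps_nth[OF this, of n] show ?thesis
    using higher_deriv_shift[of n "\<lambda>s. 1 / Gamma s"] by (simp add: inverse_eq_divide)
qed

lemma Gamma_fps_inverse: "Gamma_fps * inverse Gamma_fps = 1"
  by (intro inverse_mult_eq_1') (simp add: Gamma_fps_def log_moment_0)

section \<open>Laplace transform\<close>

text \<open>Each \<open>n\<close> contributes \<open>1 / n\<close> times the integral of
  \<open>exp (-w)\<close> over \<open>w \<ge> s * ln n\<close>, which is
  \<open>n powr -(1 + s)\<close>. The sum over \<open>n\<close> is taken by monotone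
  convergence.\<close>

lemma has_integral_recip_sum_laplace:
  fixes s :: real
  assumes s: "s > 0"
  shows "((\<lambda>w. exp (-w) * recip_sum k (exp (w / s))) has_integral omega_dirichlet k (1 + s)) {0<..}"
proof -
  let ?A = "\<lambda>M. {n \<in> {..<M}. n \<in> omega_fiber k}"
  let ?f = "\<lambda>M w. \<Sum>n\<in>?A M. 1 / real n * (if w \<in> {s * ln (real n)..} then exp (-w) else 0)"
  have "((\<lambda>w. exp (-w) * recip_sum k (exp (w / s))) has_integral omega_dirichlet k (1 + s)) {0..}"
  proof (rule has_integral_monotone_convergence_increasing)
    show "(?f M has_integral (\<Sum>n\<in>?A M. real n powr -(1 + s))) {0..}" for M
    proof (intro has_integral_sum)
      fix n assume "n \<in> ?A M"
      hence n: "n > 0" by simp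
      have "((\<lambda>w. exp (-w)) has_integral exp (- (s * ln (real n)))) {s * ln (real n)..}"
        using has_integral_exp_minus_to_infinity[of 1 "s * ln (real n)"] by simp
      moreover have "{s * ln (real n)..} \<subseteq> {0..}"
        using s n mult_nonneg_nonneg[OF less_imp_le[OF s] ln_nat_nonneg[of n]] by auto
      ultimately have "((\<lambda>w. if w \<in> {s * ln (real n)..} then exp (-w) else 0) has_integral exp (- (s * ln (real n)))) {0..}"
        by (subst has_integral_restrict)
      from has_integral_mult_right[OF this, of "1 / real n"]
      show "((\<lambda>w. 1 / real n * (if w \<in> {s * ln (real n)..} then exp (-w) else 0)) has_integral real n powr -(1 + s)) {0..}"
        using n by (simp add: powr_def exp_add[symmetric] exp_diff exp_minus algebra_simps divide_inverse)
    qed simp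
    show "?f M w \<le> ?f (Suc M) w" for M w
      by (intro sum_mono2) auto
    have "((\<lambda>n. if n \<in> omega_fiber k then real n powr -(1 + s) else 0) has_sum omega_dirichlet k (1 + s)) UNIV"
      by (rule iffD1[OF has_sum_cong_neutral has_sum_omega_dirichlet[of "1 + s" k]]) (use s in auto)
    from has_sum_imp_sums[OF this]
    show "(\<lambda>M. \<Sum>n\<in>?A M. real n powr -(1 + s)) \<longlonglongrightarrow> omega_dirichlet k (1 + s)"
      by (simp only: sums_def sum.inter_filter[OF finite_lessThan])
    fix w :: real assume "w \<in> {0..}"
    \<comment> \<open>For fixed \<open>w\<close> only \<open>n \<le> exp (w / s)\<close> contribute,
      so the sequence is eventually constant.\<close>
    have "eventually (\<lambda>M. ?f M w = exp (-w) * recip_sum k (exp (w / s))) sequentially"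
      using eventually_gt_at_top[of "nat \<lceil>exp (w / s)\<rceil>"]
    proof eventually_elim
      case (elim M)
      have "?f M w = (\<Sum>n\<in>?A M. if w \<in> {s * ln (real n)..} then exp (-w) * (1 / real n) else 0)"
        by (intro sum.cong refl) auto
      also have "\<dots> = (\<Sum>n\<in>{n \<in> ?A M. w \<in> {s * ln (real n)..}}. exp (-w) * (1 / real n))"
        by (rule sum.inter_filter[symmetric]) simp
      also have "{n \<in> ?A M. w \<in> {s * ln (real n)..}} = almost_primes k (exp (w / s))"
      proof -
        have "s * ln (real n) \<le> w \<longleftrightarrow> real n \<le> exp (w / s)" if "n > 0" for n
        proof -
          have "s * ln (real n) \<le> w \<longleftrightarrow> ln (real n) \<le> w / s" using s by (simp add: field_simps)
          also have "\<dots> \<longleftrightarrow> real n \<le> exp (w / s)" using that by (metis exp_le_cancel_iff exp_ln of_nat_0_less_iff)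
          finally show ?thesis .
        qed
        moreover have "n < M" if "real n \<le> exp (w / s)" for n
          using that elim by linarith
        ultimately show ?thesis by (auto simp: Suc_le_eq)
      qed
      finally show ?case by (simp only: recip_sum_eq sum_distrib_left)
    qed
    thus "(\<lambda>M. ?f M w) \<longlonglongrightarrow> exp (-w) * recip_sum k (exp (w / s))"
      by (rule tendsto_eventually)
  qed
  thus ?thesis by (simp only: has_integral_nonneg_iff_pos)
qed

lemma ln_poly_bound:
  fixes p :: "real poly"
  obtains B where "B \<ge> 0" "\<And>x. \<bar>poly p x\<bar> \<le> B * exp (1/2 * \<bar>x\<bar>)"
proof (rule that)
  fix x :: real
  have "\<bar>poly p x\<bar> \<le> (\<Sum>i\<le>degree p. \<bar>coeff p i\<bar> * \<bar>x\<bar> ^ i)"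
    unfolding poly_altdef by (rule order_trans[OF sum_abs]) (simp add: abs_mult power_abs)
  also have "\<dots> \<le> (\<Sum>i\<le>degree p. \<bar>coeff p i\<bar> * (fact i * 2 ^ i * exp (1/2 * \<bar>x\<bar>)))"
  proof (intro sum_mono mult_left_mono)
    fix i
    have "\<bar>x\<bar> ^ i = (fact i * 2 ^ i) * ((1/2 * \<bar>x\<bar>) ^ i / fact i)"
      by (simp add: power_divide)
    also have "\<dots> \<le> (fact i * 2 ^ i) * exp (1/2 * \<bar>x\<bar>)"
      by (intro mult_left_mono power_le_exp) auto
    finally show "\<bar>x\<bar> ^ i \<le> fact i * 2 ^ i * exp (1/2 * \<bar>x\<bar>)" .
  qed auto
  finally show "\<bar>poly p x\<bar> \<le> (\<Sum>i\<le>degree p. \<bar>coeff p i\<bar> * (fact i * 2 ^ i)) * exp (1/2 * \<bar>x\<bar>)"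
    by (simp add: sum_distrib_right mult.assoc)
qed (auto intro!: sum_nonneg)

text \<open>Taylor's formula for a chain of antiderivatives: by induction both sides have the same
  derivative in \<open>x\<close>, and they agree at \<open>x = 0\<close>.\<close>

lemma pderiv_chain_taylor:
  fixes Q :: "nat \<Rightarrow> real poly"
  assumes "Q 0 = 1" "\<And>k. pderiv (Q (Suc k)) = Q k"
  shows "poly (Q k) (x + y) = (\<Sum>i\<le>k. poly (Q (k - i)) y * (x ^ i / fact i))"
proof (induction k arbitrary: x)
  case (Suc k)
  let ?D = "\<lambda>x. poly (Q (Suc k)) (x + y) - (\<Sum>i\<le>Suc k. poly (Q (Suc k - i)) y * (x ^ i / fact i))"
  have "(?D has_real_derivative 0) (at x)" for x
  proof -
    have "((\<lambda>x. \<Sum>i\<le>Suc k. poly (Q (Suc k - i)) y * (x ^ i / fact i)) has_real_derivative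
        (\<Sum>i\<le>Suc k. poly (Q (Suc k - i)) y * (real i * x ^ (i - 1) / fact i))) (at x)"
      by (intro DERIV_sum) (auto intro!: derivative_eq_intros)
    also have "(\<Sum>i\<le>Suc k. poly (Q (Suc k - i)) y * (real i * x ^ (i - 1) / fact i))
        = (\<Sum>i\<le>k. poly (Q (k - i)) y * (x ^ i / fact i))"
      by (subst sum.atMost_Suc_shift) (simp del: of_nat_Suc)
    also have "\<dots> = poly (Q k) (x + y)" by (rule Suc[symmetric])
    finally have "((\<lambda>x. \<Sum>i\<le>Suc k. poly (Q (Suc k - i)) y * (x ^ i / fact i)) has_real_derivative poly (Q k) (x + y)) (at x)" .
    moreover have "((\<lambda>x. poly (Q (Suc k)) (x + y)) has_real_derivative poly (Q k) (x + y)) (at x)"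
      using DERIV_shift[of "poly (Q (Suc k))" _ x y] poly_DERIV[of "Q (Suc k)" "x + y"] by (simp add: assms)
    ultimately show ?thesis using DERIV_diff by fastforce
  qed
  hence "?D x = ?D 0" by (intro DERIV_isconst_all) blast
  also have "(\<Sum>i\<le>Suc k. poly (Q (Suc k - i)) y * (0 ^ i / fact i)) = poly (Q (Suc k)) y"
    by (subst sum.atMost_Suc_shift) simp
  hence "?D 0 = 0" by simp
  finally show ?case by simp
qed (simp add: assms)

text \<open>Dominated convergence: for fixed \<open>w > 0\<close> the error at
  \<open>w * Suc N\<close> tends to 0. The majorant must be uniform in \<open>N\<close> and also
  cover small arguments, where the asymptotic formula says nothing.\<close>

lemma laplace_error_tendsto_0:
  fixes Q :: "real poly"
  assumes approx: "\<And>v. v \<ge> exp 1 \<Longrightarrow> \<bar>recip_sum k (exp v) - poly Q (ln v)\<bar> \<le> C * (real k * ln v ^ (k - 1) / v)"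
  assumes int: "\<And>N. ((\<lambda>w. exp (-w) * poly Q (ln (w * real (Suc N)))) has_integral J N) {0<..}"
  shows "(\<lambda>N. omega_dirichlet k (1 + 1 / real (Suc N)) - J N) \<longlonglongrightarrow> 0"
proof -
  define \<delta> where "\<delta> = (\<lambda>v. recip_sum k (exp v) - poly Q (ln v))"
  have \<delta>_lim: "(\<delta> \<longlongrightarrow> 0) at_top"
  proof (rule Lim_null_comparison)
    show "eventually (\<lambda>v. norm (\<delta> v) \<le> C * real k * (ln v ^ (k - 1) / v)) at_top"
      using eventually_ge_at_top[of "exp 1"]
      by eventually_elim (use approx in \<open>simp add: \<delta>_def mult.assoc\<close>)
    show "((\<lambda>v. C * real k * (ln v ^ (k - 1) / v)) \<longlongrightarrow> 0) at_top"
      using tendsto_mult[OF tendsto_const ln_power_over_self_tendsto_0] by force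
  qed
  have "eventually (\<lambda>v. \<bar>\<delta> v\<bar> < 1) at_top" using tendstoD[OF \<delta>_lim, of 1] by simp
  then obtain v0 where v0: "\<And>v. v \<ge> v0 \<Longrightarrow> \<bar>\<delta> v\<bar> < 1" by (auto simp: eventually_at_top_linorder)
  define v1 where "v1 = max v0 1"
  have v1: "v1 \<ge> 1" "\<And>v. v \<ge> v1 \<Longrightarrow> \<bar>\<delta> v\<bar> < 1" using v0 by (auto simp: v1_def)
  obtain B where B: "B \<ge> 0" "\<And>x. \<bar>poly Q x\<bar> \<le> B * exp (1/2 * \<bar>x\<bar>)" by (rule ln_poly_bound) blast
  \<comment> \<open>The summands cover, in order, the range from \<open>v1\<close> on, where the
    error is below 1, and below \<open>v1\<close> the sum and the polynomial.\<close>
  define K where "K = 1 + recip_sum k (exp v1) + B * exp (1/2 * ln v1)"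
  have K: "K \<ge> 0" using B(1) by (auto simp: K_def recip_sum_nonneg intro!: add_nonneg_nonneg)
  have bound: "\<bar>\<delta> (w * real (Suc N))\<bar> \<le> K * exp (1/2 * \<bar>ln w\<bar>)" if w: "w > 0" for w N
  proof -
    let ?v = "w * real (Suc N)"
    have v: "?v > 0" "w \<le> ?v" using w by auto
    have e1: "exp (1/2 * \<bar>ln w\<bar>) \<ge> 1" by simp
    show ?thesis
    proof (cases "?v \<ge> v1")
      case True
      have "\<bar>\<delta> ?v\<bar> \<le> 1 * 1" using v1(2)[OF True] by simp
      also have "\<dots> \<le> K * exp (1/2 * \<bar>ln w\<bar>)"
        using e1 B(1) recip_sum_nonneg[of k "exp v1"] by (intro mult_mono) (auto simp: K_def)
      finally show ?thesis .
    next
      case False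
      \<comment> \<open>If \<open>?v \<ge> 1\<close>, its logarithm is at most \<open>ln v1\<close>;
        otherwise \<open>w \<le> ?v < 1\<close> puts \<open>ln ?v\<close> between
        \<open>ln w\<close> and 0. Either way the bound is free of \<open>N\<close>.\<close>
      have "\<bar>ln ?v\<bar> \<le> ln v1 + \<bar>ln w\<bar>"
      proof (cases "?v \<ge> 1")
        case True
        have "ln ?v \<le> ln v1" using False v v1(1) by (subst ln_le_cancel_iff) auto
        thus ?thesis using True by simp
      next
        case v_less: False
        have "ln w \<le> ln ?v" using v w by (subst ln_le_cancel_iff) auto
        moreover have "ln ?v < 0" using v_less v by (intro ln_less_zero) auto
        moreover have "ln v1 \<ge> 0" using v1(1) by simp
        ultimately show ?thesis by linarith
      qed
      hence "exp (1/2 * \<bar>ln ?v\<bar>) \<le> exp (1/2 * ln v1 + 1/2 * \<bar>ln w\<bar>)" by simp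
      hence "exp (1/2 * \<bar>ln ?v\<bar>) \<le> exp (1/2 * ln v1) * exp (1/2 * \<bar>ln w\<bar>)" by (simp only: exp_add)
      hence "B * exp (1/2 * \<bar>ln ?v\<bar>) \<le> B * (exp (1/2 * ln v1) * exp (1/2 * \<bar>ln w\<bar>))"
        using B(1) by (rule mult_left_mono)
      hence Qb: "\<bar>poly Q (ln ?v)\<bar> \<le> B * exp (1/2 * ln v1) * exp (1/2 * \<bar>ln w\<bar>)"
        using B(2)[of "ln ?v"] by (simp only: mult.assoc)
      have "recip_sum k (exp ?v) \<le> recip_sum k (exp v1)" using False by (intro recip_sum_mono) simp
      also have "\<dots> \<le> (1 + recip_sum k (exp v1)) * exp (1/2 * \<bar>ln w\<bar>)"
        using e1 recip_sum_nonneg[of k "exp v1"] mult_mono[of "recip_sum k (exp v1)" "1 + recip_sum k (exp v1)" 1 "exp (1/2 * \<bar>ln w\<bar>)"] by simp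
      finally have rb: "recip_sum k (exp ?v) \<le> (1 + recip_sum k (exp v1)) * exp (1/2 * \<bar>ln w\<bar>)" .
      have "\<bar>\<delta> ?v\<bar> \<le> recip_sum k (exp ?v) + \<bar>poly Q (ln ?v)\<bar>"
        unfolding \<delta>_def using recip_sum_nonneg[of k "exp ?v"] by linarith
      also have "\<dots> \<le> (1 + recip_sum k (exp v1)) * exp (1/2 * \<bar>ln w\<bar>) + B * exp (1/2 * ln v1) * exp (1/2 * \<bar>ln w\<bar>)"
        by (rule add_mono[OF rb Qb])
      also have "\<dots> = K * exp (1/2 * \<bar>ln w\<bar>)" by (simp only: K_def distrib_right)
      finally show ?thesis .
    qed
  qed
  let ?g = "\<lambda>N w. exp (-w) * \<delta> (w * real (Suc N))"
  have g: "(?g N has_integral (omega_dirichlet k (1 + 1 / real (Suc N)) - J N)) {0<..}" for N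
    using has_integral_diff[OF has_integral_recip_sum_laplace[of "1 / real (Suc N)" k] int[of N]]
    by (simp add: \<delta>_def right_diff_distrib)
  have "(\<lambda>N. integral {0<..} (?g N)) \<longlonglongrightarrow> integral {0<..} (\<lambda>w::real. 0)"
  proof (rule dominated_convergence(2))
    show "?g N integrable_on {0<..}" for N by (rule has_integral_integrable[OF g])
    show "(\<lambda>w::real. K * (exp (-w) * (w powr (1/2) + w powr -(1/2)))) integrable_on {0<..}"
      by (intro integrable_on_mult_right integrable_exp_abs_ln) auto
    fix w :: real assume "w \<in> {0<..}"
    hence w: "w > 0" by simp
    show "norm (?g N w) \<le> K * (exp (-w) * (w powr (1/2) + w powr -(1/2)))" for N
    proof -
      have "norm (?g N w) = exp (-w) * \<bar>\<delta> (w * real (Suc N))\<bar>" by (simp add: abs_mult)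
      also have "\<dots> \<le> exp (-w) * (K * exp (1/2 * \<bar>ln w\<bar>))" by (intro mult_left_mono bound w) auto
      also have "\<dots> \<le> exp (-w) * (K * (w powr (1/2) + w powr -(1/2)))"
        by (intro mult_left_mono exp_abs_ln_le w K) auto
      finally show ?thesis by (simp only: mult_ac)
    qed
    have "filterlim (\<lambda>N. w * real (Suc N)) at_top sequentially"
      by (intro filterlim_tendsto_pos_mult_at_top[OF tendsto_const w] filterlim_compose[OF filterlim_real_sequentially filterlim_Suc])
    from filterlim_compose[OF \<delta>_lim this] show "(\<lambda>N. ?g N w) \<longlonglongrightarrow> 0"
      by (intro tendsto_mult_right_zero)
  qed
  thus ?thesis by (simp only: integral_unique[OF g] integral_0)
qed

section \<open>Identification of the polynomials\<close>

text \<open>Growth at most polylogarithmic; an error term \<open>d\<close> is \<open>O((ln N)\<^sup>m / N)\<close> iff \<open>N * d(N)\<close> is of this kind.\<close>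

definition polylog :: "(nat \<Rightarrow> real) \<Rightarrow> bool" where
  "polylog f \<longleftrightarrow> (\<exists>C m. \<forall>N\<ge>1. \<bar>f N\<bar> \<le> C * (1 + ln (real N)) ^ m)"

lemma polylogI: "(\<And>N. N \<ge> 1 \<Longrightarrow> \<bar>f N\<bar> \<le> C * (1 + ln (real N)) ^ m) \<Longrightarrow> polylog f"
  unfolding polylog_def by blast

lemma polylog_const [simp]: "polylog (\<lambda>_. c)"
  by (rule polylogI[of _ "\<bar>c\<bar>" 0]) simp

lemma polylog_add [intro]:
  assumes "polylog f" "polylog g"
  shows "polylog (\<lambda>N. f N + g N)"
proof -
  obtain C m where C: "\<And>N. N \<ge> 1 \<Longrightarrow> \<bar>f N\<bar> \<le> C * (1 + ln (real N)) ^ m"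
    using assms(1) by (auto simp: polylog_def)
  obtain D n where D: "\<And>N. N \<ge> 1 \<Longrightarrow> \<bar>g N\<bar> \<le> D * (1 + ln (real N)) ^ n"
    using assms(2) by (auto simp: polylog_def)
  have "C \<ge> 0" "D \<ge> 0" using C[of 1] D[of 1] by auto
  show ?thesis
  proof (rule polylogI)
    fix N :: nat assume N: "N \<ge> 1"
    let ?l = "1 + ln (real N)"
    have l: "?l \<ge> 1" using N by simp
    have "\<bar>f N + g N\<bar> \<le> C * ?l ^ m + D * ?l ^ n" using C[OF N] D[OF N] by linarith
    also have "\<dots> \<le> C * ?l ^ (max m n) + D * ?l ^ (max m n)"
      using l \<open>C \<ge> 0\<close> \<open>D \<ge> 0\<close> by (intro add_mono mult_left_mono power_increasing) auto
    also have "\<dots> = (C + D) * ?l ^ (max m n)" by (simp only: distrib_right)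
    finally show "\<bar>f N + g N\<bar> \<le> (C + D) * ?l ^ (max m n)" .
  qed
qed

lemma polylog_mult [intro]:
  assumes "polylog f" "polylog g"
  shows "polylog (\<lambda>N. f N * g N)"
proof -
  obtain C m where C: "\<And>N. N \<ge> 1 \<Longrightarrow> \<bar>f N\<bar> \<le> C * (1 + ln (real N)) ^ m"
    using assms(1) by (auto simp: polylog_def)
  obtain D n where D: "\<And>N. N \<ge> 1 \<Longrightarrow> \<bar>g N\<bar> \<le> D * (1 + ln (real N)) ^ n"
    using assms(2) by (auto simp: polylog_def)
  show ?thesis
  proof (rule polylogI)
    fix N :: nat assume N: "N \<ge> 1"
    let ?l = "1 + ln (real N)"
    have "\<bar>f N * g N\<bar> \<le> (C * ?l ^ m) * (D * ?l ^ n)"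
      unfolding abs_mult using C[OF N] D[OF N] by (intro mult_mono) (auto intro: order_trans[OF abs_ge_zero])
    also have "\<dots> = (C * D) * ?l ^ (m + n)" by (simp only: power_add mult_ac)
    finally show "\<bar>f N * g N\<bar> \<le> (C * D) * ?l ^ (m + n)" .
  qed
qed

lemma polylog_sum:
  "(\<And>i. i \<in> A \<Longrightarrow> polylog (f i)) \<Longrightarrow> polylog (\<lambda>N. \<Sum>i\<in>A. f i N)"
  by (induction A rule: infinite_finite_induct) auto

lemma polylog_ln: "polylog (\<lambda>N. ln (real N))"
  by (rule polylogI[of _ 1 1]) simp

text \<open>Writing \<open>1 + ln N\<close> as \<open>ln (exp 1 * N)\<close> reduces the claim to
  \<open>ln_power_over_self_tendsto_0\<close>.\<close>

lemma polylog_over_self_tendsto_0: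
  assumes "polylog (\<lambda>N. real N * d N)"
  shows "d \<longlonglongrightarrow> 0"
proof -
  obtain C m where C: "\<And>N. N \<ge> 1 \<Longrightarrow> \<bar>real N * d N\<bar> \<le> C * (1 + ln (real N)) ^ m"
    using assms by (auto simp: polylog_def)
  show ?thesis
  proof (rule Lim_null_comparison)
    show "eventually (\<lambda>N. norm (d N) \<le> C * exp 1 * (ln (exp 1 * real N) ^ m / (exp 1 * real N))) sequentially"
      using eventually_ge_at_top[of 1]
    proof eventually_elim
      case (elim N)
      have "ln (exp 1 * real N) = 1 + ln (real N)" using elim by (simp add: ln_mult_pos)
      thus ?case using C[OF elim] elim by (simp add: abs_mult field_simps)
    qed
    have "filterlim (\<lambda>N. exp 1 * real N) at_top sequentially"
      by (intro filterlim_tendsto_pos_mult_at_top[OF tendsto_const _ filterlim_real_sequentially]) simp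
    from tendsto_mult_right_zero[OF filterlim_compose[OF ln_power_over_self_tendsto_0 this]]
    show "(\<lambda>N. C * exp 1 * (ln (exp 1 * real N) ^ m / (exp 1 * real N))) \<longlonglongrightarrow> 0" .
  qed
qed

lemma newton_polylog:
  assumes "\<And>j. j \<ge> 1 \<Longrightarrow> polylog (\<lambda>N. a N j)" "k \<le> M"
  shows "polylog (\<lambda>N. fps_nth (newton_fps (a N) M) k)"
  using assms(2)
proof (induction k rule: less_induct)
  case (less k)
  show ?case
  proof (cases "k = 0")
    case True
    thus ?thesis by (simp add: newton_fps_0)
  next
    case False
    have "polylog (\<lambda>N. 1 / real k * (\<Sum>j=1..k. a N j * fps_nth (newton_fps (a N) M) (k - j)))"
      using less by (intro polylog_mult polylog_sum polylog_const assms) auto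
    also have "(\<lambda>N. 1 / real k * (\<Sum>j=1..k. a N j * fps_nth (newton_fps (a N) M) (k - j))) =
        (\<lambda>N. fps_nth (newton_fps (a N) M) k)"
      unfolding newton_fps_rec[OF less.prems, symmetric] using False by simp
    finally show ?thesis .
  qed
qed

text \<open>Newton's recursion propagates an error of order \<open>1 / N\<close> up to logarithms,
  by \<open>a * A - b * B = (a - b) * A + b * (A - B)\<close> in each term.\<close>

lemma newton_diff_polylog:
  assumes "\<And>j. j \<ge> 1 \<Longrightarrow> polylog (\<lambda>N. b N j)" "\<And>j. j \<ge> 1 \<Longrightarrow> polylog (\<lambda>N. real N * (a N j - b N j))"
    "\<And>j. j \<ge> 1 \<Longrightarrow> polylog (\<lambda>N. a N j)" "k \<le> M"
  shows "polylog (\<lambda>N. real N * (fps_nth (newton_fps (a N) M) k - fps_nth (newton_fps (b N) M) k))"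
  using assms(4)
proof (induction k rule: less_induct)
  case (less k)
  let ?A = "\<lambda>N. fps_nth (newton_fps (a N) M)" and ?B = "\<lambda>N. fps_nth (newton_fps (b N) M)"
  show ?case
  proof (cases "k = 0")
    case True
    thus ?thesis by (simp add: newton_fps_0)
  next
    case False
    have "polylog (\<lambda>N. 1 / real k * (\<Sum>j=1..k. (real N * (a N j - b N j)) * ?A N (k - j) + b N j * (real N * (?A N (k - j) - ?B N (k - j)))))"
    proof (rule polylog_mult[OF polylog_const polylog_sum])
      fix j assume j: "j \<in> {1..k}"
      have "polylog (\<lambda>N. ?A N (k - j))" using less.prems by (intro newton_polylog assms) auto
      moreover have "polylog (\<lambda>N. real N * (?A N (k - j) - ?B N (k - j)))"
        using j less.prems by (intro less.IH) auto
      ultimately show "polylog (\<lambda>N. (real N * (a N j - b N j)) * ?A N (k - j) + b N j * (real N * (?A N (k - j) - ?B N (k - j))))"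
        using j by (intro polylog_add polylog_mult[OF assms(2)] polylog_mult[OF assms(1)]) auto
    qed
    also have "(\<lambda>N. 1 / real k * (\<Sum>j=1..k. (real N * (a N j - b N j)) * ?A N (k - j) + b N j * (real N * (?A N (k - j) - ?B N (k - j))))) =
        (\<lambda>N. real N * (?A N k - ?B N k))"
    proof
      fix N
      have "(\<Sum>j=1..k. (real N * (a N j - b N j)) * ?A N (k - j) + b N j * (real N * (?A N (k - j) - ?B N (k - j))))
          = real N * ((\<Sum>j=1..k. a N j * ?A N (k - j)) - (\<Sum>j=1..k. b N j * ?B N (k - j)))"
        unfolding sum_subtractf[symmetric] sum_distrib_left by (intro sum.cong refl) (simp add: algebra_simps)
      also have "\<dots> = real k * (real N * (?A N k - ?B N k))"
        unfolding newton_fps_rec[OF less.prems, symmetric] by (simp add: algebra_simps)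
      finally show "1 / real k * (\<Sum>j=1..k. (real N * (a N j - b N j)) * ?A N (k - j) + b N j * (real N * (?A N (k - j) - ?B N (k - j)))) =
          real N * (?A N k - ?B N k)" using False by simp
    qed
    finally show ?thesis .
  qed
qed

text \<open>The power sums \<open>prime_zeta (j * (1 + s))\<close> with their \<open>O(s)\<close>
  errors dropped, where \<open>Y = ln (1 / s)\<close>. Only the first depends on
  \<open>Y\<close>.\<close>

definition shifted_zeta :: "real \<Rightarrow> nat \<Rightarrow> real" where
  "shifted_zeta Y j = (if j = 1 then Y + (mertens_const - euler_mascheroni) else prime_zeta (real j))"

lemma omega_dirichlet_near_1:
  "(\<lambda>N. omega_dirichlet k (1 + 1 / real (Suc N)) - fps_nth (newton_fps (shifted_zeta (ln (real (Suc N)))) k) k) \<longlonglongrightarrow> 0"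
proof -
  let ?a = "\<lambda>N j. prime_zeta (real j * (1 + 1 / real N))" and ?b = "\<lambda>N. shifted_zeta (ln (real N))"
  have b: "polylog (\<lambda>N. ?b N j)" for j
    unfolding shifted_zeta_def by (cases "j = 1") (auto intro: polylog_ln)
  have diff: "\<exists>C. \<forall>N\<ge>1. \<bar>?a N j - ?b N j\<bar> \<le> C / real N" if "j \<ge> 1" for j
  proof (cases "j = 1")
    case True
    obtain C where C: "\<And>s. s > 0 \<Longrightarrow> \<bar>prime_zeta (1 + s) - (ln (1 / s) + (mertens_const - euler_mascheroni))\<bar> \<le> C * s"
      by (rule prime_zeta_near_1) blast
    have "\<bar>?a N j - ?b N j\<bar> \<le> C / real N" if "N \<ge> 1" for N
      using C[of "1 / real N"] that True by (simp add: shifted_zeta_def)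
    thus ?thesis by blast
  next
    case False
    hence "j \<ge> 2" using that by simp
    then obtain C where C: "\<And>s. s > 0 \<Longrightarrow> \<bar>prime_zeta (real j * (1 + s)) - prime_zeta (real j)\<bar> \<le> C * s"
      by (rule prime_zeta_near_ge_2) blast
    have "\<bar>?a N j - ?b N j\<bar> \<le> C / real N" if "N \<ge> 1" for N
      using C[of "1 / real N"] that False by (simp add: shifted_zeta_def)
    thus ?thesis by blast
  qed
  have d1: "polylog (\<lambda>N. real N * (?a N j - ?b N j))" if j: "j \<ge> 1" for j
  proof -
    from diff[OF j] obtain C where C: "\<And>N. N \<ge> 1 \<Longrightarrow> \<bar>?a N j - ?b N j\<bar> \<le> C / real N" by blast
    show ?thesis
    proof (rule polylogI[of _ C 0])
      fix N :: nat assume N: "N \<ge> 1"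
      have "\<bar>real N * (?a N j - ?b N j)\<bar> = real N * \<bar>?a N j - ?b N j\<bar>" by (simp only: abs_mult abs_of_nat)
      also have "\<dots> \<le> real N * (C / real N)" by (intro mult_left_mono C N) simp
      finally show "\<bar>real N * (?a N j - ?b N j)\<bar> \<le> C * (1 + ln (real N)) ^ 0" using N by simp
    qed
  qed
  have d2: "polylog (\<lambda>N. ?a N j - ?b N j)" if j: "j \<ge> 1" for j
  proof -
    from diff[OF j] obtain C where C: "\<And>N. N \<ge> 1 \<Longrightarrow> \<bar>?a N j - ?b N j\<bar> \<le> C / real N" by blast
    have "C \<ge> 0" using C[of 1] abs_ge_zero[of "?a 1 j - ?b 1 j"] by simp
    show ?thesis
    proof (rule polylogI[of _ C 0])
      fix N :: nat assume N: "N \<ge> 1"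
      have "C / real N \<le> C / 1" using N \<open>C \<ge> 0\<close> by (intro divide_left_mono) auto
      with C[OF N] show "\<bar>?a N j - ?b N j\<bar> \<le> C * (1 + ln (real N)) ^ 0" by simp
    qed
  qed
  have a: "polylog (\<lambda>N. ?a N j)" if "j \<ge> 1" for j
    using polylog_add[OF d2[OF that] b[of j]] by simp
  have "(\<lambda>N. fps_nth (newton_fps (?a N) k) k - fps_nth (newton_fps (?b N) k) k) \<longlonglongrightarrow> 0"
    by (rule polylog_over_self_tendsto_0, rule newton_diff_polylog[where a = ?a and b = ?b]) (use a b d1 in auto)
  \<comment> \<open>The index shift gives \<open>1 + 1 / real (Suc N) > 1\<close> for every
    \<open>N\<close>, as the Dirichlet series requires.\<close>
  from LIMSEQ_Suc[OF this] show ?thesis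
    by (subst omega_dirichlet_eq_newton[of _ _ k]) auto
qed

lemma poly_eq_0_of_tendsto:
  fixes p :: "real poly"
  assumes "(\<lambda>N. poly p (ln (real (Suc N)))) \<longlonglongrightarrow> 0"
  shows "p = 0"
proof (rule ccontr)
  assume "p \<noteq> 0"
  have lim: "filterlim (\<lambda>N. ln (real (Suc N))) at_top sequentially"
    by (rule filterlim_compose[OF ln_at_top filterlim_compose[OF filterlim_real_sequentially filterlim_Suc]])
  show False
  proof (cases "degree p = 0")
    case True
    then obtain c where c: "p = [:c:]" by (auto elim: degree_eq_zeroE)
    have "c = 0" using assms c by (simp add: LIMSEQ_const_iff)
    thus False using \<open>p \<noteq> 0\<close> c by simp
  next
    case False
    have "filterlim (\<lambda>N. poly p (ln (real (Suc N)))) at_infinity sequentially"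
      using False by (intro filterlim_compose[OF filterlim_poly_at_infinity filterlim_at_top_imp_at_infinity[OF lim]]) auto
    thus False using not_tendsto_and_filterlim_at_infinity[OF sequentially_bot assms] by blast
  qed
qed

text \<open>The truncation of \<open>exp (\<Sum>j\<ge>2. P(j) * z ^ j / j)\<close>, the factor
  independent of \<open>Y\<close>.\<close>

definition higher_zeta_fps :: "nat \<Rightarrow> real fps" where
  "higher_zeta_fps k = (\<Prod>j=2..k. dilated_exp j (prime_zeta (real j) / real j))"

lemma newton_shifted_zeta:
  assumes "k \<ge> 1"
  shows "newton_fps (shifted_zeta Y) k = fps_exp (Y + (mertens_const - euler_mascheroni)) * higher_zeta_fps k"
proof -
  have "newton_fps (shifted_zeta Y) k = dilated_exp (Suc 0) (shifted_zeta Y (Suc 0) / real (Suc 0)) *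
      (\<Prod>j\<in>{Suc (Suc 0)..k}. dilated_exp j (shifted_zeta Y j / real j))"
    using assms unfolding newton_fps_def One_nat_def by (subst prod.atLeast_Suc_atMost) auto
  also have "(\<Prod>j\<in>{Suc (Suc 0)..k}. dilated_exp j (shifted_zeta Y j / real j)) = higher_zeta_fps k"
    unfolding higher_zeta_fps_def by (intro prod.cong) (auto simp: shifted_zeta_def numeral_2_eq_2)
  also have "dilated_exp (Suc 0) (shifted_zeta Y (Suc 0) / real (Suc 0)) = fps_exp (Y + (mertens_const - euler_mascheroni))"
    by (simp add: dilated_exp_1 shifted_zeta_def)
  finally show ?thesis .
qed

lemma newton_fps_nth_mono:
  assumes "k \<le> M"
  shows "fps_nth (newton_fps a M) k = fps_nth (newton_fps a k) k"
  using newton_fps_unique[of "fps_nth (newton_fps a M)" k a k] assms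
  by (simp add: newton_fps_0 newton_fps_rec)

text \<open>The dependence on \<open>Y\<close> sits in one exponential factor, whose coefficients
  are polynomials in \<open>Y\<close>. Polynomiality is what allows equality to be deduced from a
  limit.\<close>

lemma newton_shifted_zeta_poly:
  "\<exists>p. \<forall>Y. poly p Y = fps_nth (newton_fps (shifted_zeta Y) k) k"
proof (cases "k = 0")
  case True
  thus ?thesis by (intro exI[of _ 1]) (simp add: newton_fps_0)
next
  case False
  let ?p = "\<Sum>i=0..k. smult (fps_nth (higher_zeta_fps k) (k - i) / fact i) ([:mertens_const - euler_mascheroni, 1:] ^ i)"
  have "poly ?p Y = fps_nth (newton_fps (shifted_zeta Y) k) k" for Y
  proof -
    have "k \<ge> 1" using False by simp
    show ?thesis
      unfolding newton_shifted_zeta[OF \<open>k \<ge> 1\<close>] fps_mult_nth poly_sum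
      by (intro sum.cong refl) (simp add: add.commute)
  qed
  thus ?thesis by blast
qed

text \<open>
  Both sides are polynomials in \<open>Y\<close>, and by the Laplace transform they differ by \<open>o(1)\<close> along \<open>Y = ln N\<close>.
\<close>

lemma asymptotic_poly_times_Gamma:
  fixes Q :: "nat \<Rightarrow> real poly"
  assumes Q: "Q 0 = 1" "\<And>k. pderiv (Q (Suc k)) = Q k"
    "\<And>k. \<exists>C. \<forall>v\<ge>exp 1. \<bar>recip_sum k (exp v) - poly (Q k) (ln v)\<bar> \<le> C * (real k * ln v ^ (k - 1) / v)"
  shows "fps_nth (Abs_fps (\<lambda>k. poly (Q k) Y) * Gamma_fps) k = fps_nth (newton_fps (shifted_zeta Y) k) k"
proof -
  let ?J = "\<lambda>Y. \<Sum>i\<le>k. poly (Q (k - i)) Y * (log_moment i / fact i)"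
  \<comment> \<open>Since \<open>ln (w * N) = ln w + ln N\<close>, the Taylor formula in powers of
    \<open>ln w\<close> turns the integral into log moments exactly.\<close>
  have int: "((\<lambda>w. exp (-w) * poly (Q k) (ln (w * real (Suc N)))) has_integral ?J (ln (real (Suc N)))) {0<..}" for N
  proof -
    let ?y = "ln (real (Suc N))"
    have "((\<lambda>w. \<Sum>i\<le>k. (poly (Q (k - i)) ?y / fact i) * (exp (-w) * ln w ^ i)) has_integral
        (\<Sum>i\<le>k. (poly (Q (k - i)) ?y / fact i) * log_moment i)) {0<..}"
      by (intro has_integral_sum has_integral_mult_right has_integral_log_moment) auto
    also have "(\<Sum>i\<le>k. (poly (Q (k - i)) ?y / fact i) * log_moment i) = ?J ?y"
      by (intro sum.cong refl) simp
    finally show ?thesis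
    proof (rule has_integral_eq[rotated])
      fix w :: real assume "w \<in> {0<..}"
      hence "ln (w * real (Suc N)) = ln w + ?y" by (intro ln_mult_pos) auto
      thus "(\<Sum>i\<le>k. (poly (Q (k - i)) ?y / fact i) * (exp (-w) * ln w ^ i)) = exp (-w) * poly (Q k) (ln (w * real (Suc N)))"
        by (simp only: pderiv_chain_taylor[OF Q(1,2)] sum_distrib_left) (intro sum.cong refl, simp)
    qed
  qed
  obtain C where C: "\<And>v. v \<ge> exp 1 \<Longrightarrow> \<bar>recip_sum k (exp v) - poly (Q k) (ln v)\<bar> \<le> C * (real k * ln v ^ (k - 1) / v)"
    using Q(3)[of k] by blast
  obtain p where p: "\<And>Y. poly p Y = fps_nth (newton_fps (shifted_zeta Y) k) k"
    using newton_shifted_zeta_poly[of k] by blast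
  define D where "D = p - (\<Sum>i\<le>k. smult (log_moment i / fact i) (Q (k - i)))"
  have D: "poly D Y = fps_nth (newton_fps (shifted_zeta Y) k) k - ?J Y" for Y
    by (simp add: D_def p poly_sum mult.commute)
  have "D = 0"
  proof (rule poly_eq_0_of_tendsto)
    have "(\<lambda>N. (omega_dirichlet k (1 + 1 / real (Suc N)) - ?J (ln (real (Suc N)))) -
        (omega_dirichlet k (1 + 1 / real (Suc N)) - fps_nth (newton_fps (shifted_zeta (ln (real (Suc N)))) k) k)) \<longlonglongrightarrow> 0 - 0"
      by (rule tendsto_diff[OF laplace_error_tendsto_0[OF C int] omega_dirichlet_near_1])
    thus "(\<lambda>N. poly D (ln (real (Suc N)))) \<longlonglongrightarrow> 0" unfolding D by (simp only: diff_diff_eq2 diff_add_cancel add_diff_cancel_left' diff_self) simp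
  qed
  hence "fps_nth (newton_fps (shifted_zeta Y) k) k = ?J Y" using D[of Y] by simp
  moreover have "fps_nth (Abs_fps (\<lambda>k. poly (Q k) Y) * Gamma_fps) k = ?J Y"
    unfolding mult.commute[of _ Gamma_fps] fps_mult_nth atMost_atLeast0
    by (intro sum.cong refl) (simp add: Gamma_fps_def)
  ultimately show ?thesis by simp
qed

text \<open>Division by \<open>Gamma_fps\<close> in the preceding identity. The coefficient of
  \<open>z ^ k\<close> uses only indices \<open>i \<le> k\<close>, where truncation at
  \<open>k\<close> and at \<open>i\<close> agree.\<close>

lemma asymptotic_poly_eq:
  fixes Q :: "nat \<Rightarrow> real poly"
  assumes Q: "Q 0 = 1" "\<And>k. pderiv (Q (Suc k)) = Q k"
    "\<And>k. \<exists>C. \<forall>v\<ge>exp 1. \<bar>recip_sum k (exp v) - poly (Q k) (ln v)\<bar> \<le> C * (real k * ln v ^ (k - 1) / v)"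
    and k: "k \<ge> 1"
  shows "poly (Q k) Y = fps_nth (fps_exp (Y + (mertens_const - euler_mascheroni)) * higher_zeta_fps k * inverse Gamma_fps) k"
proof -
  let ?q = "Abs_fps (\<lambda>k. poly (Q k) Y)"
  have "poly (Q k) Y = fps_nth (?q * Gamma_fps * inverse Gamma_fps) k"
    by (simp only: mult.assoc Gamma_fps_inverse mult_1_right fps_nth_Abs_fps)
  also have "\<dots> = fps_nth (newton_fps (shifted_zeta Y) k * inverse Gamma_fps) k"
    unfolding fps_mult_nth[of _ "inverse Gamma_fps"]
  proof (intro sum.cong refl)
    fix i assume "i \<in> {0..k}"
    hence "fps_nth (newton_fps (shifted_zeta Y) k) i = fps_nth (newton_fps (shifted_zeta Y) i) i"
      by (intro newton_fps_nth_mono) simp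
    thus "fps_nth (?q * Gamma_fps) i * fps_nth (inverse Gamma_fps) (k - i) =
        fps_nth (newton_fps (shifted_zeta Y) k) i * fps_nth (inverse Gamma_fps) (k - i)"
      by (simp only: asymptotic_poly_times_Gamma[OF Q])
  qed
  finally show ?thesis using k by (simp only: newton_shifted_zeta)
qed

text \<open>\<open>trinomial m i (n - m - i) / fact n\<close> is the product of three inverse
  factorials for \<open>i \<le> n\<close>, so the double sum is the convolution of
  \<open>exp (X * z)\<close>, \<open>exp (-\<gamma> * z)\<close> and the series of
  \<open>1 / Gamma (1 + z)\<close>.\<close>

lemma a_coeff_poly_eq:
  "(\<Sum>i=0..n. a_coeff i n / fact n * X ^ i) = fps_nth (fps_exp (X - euler_mascheroni) * inverse Gamma_fps) n"
proof -
  have a: "a_coeff i n / fact n = fps_nth (inverse Gamma_fps * fps_exp (- euler_mascheroni)) (n - i) / fact i"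
    if "i \<le> n" for i
  proof -
    have "a_coeff i n / fact n = (\<Sum>m=0..n-i. fps_nth (inverse Gamma_fps) m * ((- euler_mascheroni) ^ (n - i - m) / fact (n - i - m)) / fact i)"
      unfolding a_coeff_def sum_divide_distrib
    proof (intro sum.cong refl)
      fix m assume m: "m \<in> {0..n - i}"
      hence "m + i + (n - m - i) = n" "n - m - i = n - i - m" using that by auto
      thus "trinomial m i (n - m - i) * (- euler_mascheroni) ^ (n - m - i) * (deriv ^^ m) (\<lambda>s::real. 1 / Gamma s) 1 / fact n =
          fps_nth (inverse Gamma_fps) m * ((- euler_mascheroni) ^ (n - i - m) / fact (n - i - m)) / fact i"
        by (simp add: trinomial_def inverse_Gamma_fps_nth mult_ac)
    qed
    thus ?thesis by (simp add: fps_mult_nth sum_divide_distrib)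
  qed
  have "fps_exp (X - euler_mascheroni) = fps_exp X * fps_exp (- euler_mascheroni)"
    using fps_exp_add_mult[of X "- euler_mascheroni"] by simp
  hence "fps_nth (fps_exp (X - euler_mascheroni) * inverse Gamma_fps) n =
      fps_nth (fps_exp X * (inverse Gamma_fps * fps_exp (- euler_mascheroni))) n" by (simp add: mult_ac)
  also have "\<dots> = (\<Sum>i=0..n. a_coeff i n / fact n * X ^ i)"
    unfolding fps_mult_nth[of "fps_exp X"] by (intro sum.cong refl) (simp add: a)
  finally show ?thesis by simp
qed

text \<open>The sum over tuples is the coefficient of a product of dilated series. The entry for
  \<open>j = 1\<close> selects a coefficient of the exponential times the inverse Gamma series, the
  other entries select coefficients of \<open>exp (P(j) * z ^ j / j)\<close>.\<close>

lemma poly_R_poly_eq: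
  assumes "k \<ge> 1"
  shows "poly (R_poly k) X = fps_nth (fps_exp (X - euler_mascheroni) * inverse Gamma_fps * higher_zeta_fps k) k"
proof -
  define u where "u = fps_nth (fps_exp (X - euler_mascheroni) * inverse Gamma_fps)"
  define c where "c = (\<lambda>j n. if j = 1 then u n else (prime_zeta (real j) / real j) ^ n / fact n)"
  have ins: "{1..k} = insert 1 {2..k}" using assms by auto
  have "poly (R_poly k) X = (\<Sum>n\<in>weighted_tuples k. \<Prod>j\<in>{1..k}. c j (n j))"
    unfolding R_poly_def poly_sum
  proof (intro sum.cong refl)
    fix n
    have "(\<Prod>j\<in>{1..k}. c j (n j)) = u (n 1) * (\<Prod>j=2..k. (prime_zeta (real j) / real j) ^ n j / fact (n j))"
      unfolding ins by (subst prod.insert) (auto simp: c_def intro!: prod.cong)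
    moreover have "poly (\<Sum>i=0..n 1. monom (a_coeff i (n 1) / fact (n 1)) i) X = u (n 1)"
      unfolding u_def a_coeff_poly_eq[symmetric] poly_sum poly_monom by (rule refl)
    ultimately show "poly (smult (\<Prod>j=2..k. (prime_zeta (real j) / real j) ^ n j / fact (n j)) (\<Sum>i=0..n 1. monom (a_coeff i (n 1) / fact (n 1)) i)) X =
        (\<Prod>j\<in>{1..k}. c j (n j))"
      by (simp only: poly_smult mult.commute)
  qed
  also have "\<dots> = fps_nth (\<Prod>j\<in>{1..k}. dilated_fps j (c j)) k"
    unfolding weighted_tuples_eq by (rule prod_dilated_fps_nth[symmetric]) auto
  also have "(\<Prod>j\<in>{1..k}. dilated_fps j (c j)) = dilated_fps 1 (c 1) * (\<Prod>j=2..k. dilated_fps j (c j))"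
    unfolding ins by (subst prod.insert) auto
  also have "(\<Prod>j=2..k. dilated_fps j (c j)) = higher_zeta_fps k"
    unfolding higher_zeta_fps_def by (intro prod.cong) (auto simp: c_def)
  also have "dilated_fps 1 (c 1) = fps_exp (X - euler_mascheroni) * inverse Gamma_fps"
    by (simp add: dilated_fps_1 c_def u_def fps_nth_inverse)
  finally show ?thesis .
qed

section \<open>The degree of the polynomial and the passage to all x \<ge> 3\<close>

theorem theorem2p3:
  fixes k :: nat
  assumes "k \<ge> 1"
  shows "degree (R_poly k) = k \<and>
    (\<exists>C. \<forall>x::real. x \<ge> 3 \<longrightarrow>
       \<bar>recip_sum k x - poly (R_poly k) (ln (ln x) + mertens_const)\<bar>
         \<le> C * (ln (ln x) ^ (k - 1) / ln x))"
proof -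
  obtain Q :: "nat \<Rightarrow> real poly" where Q: "Q 0 = 1" "\<And>k. pderiv (Q (Suc k)) = Q k"
    "\<And>k. \<exists>C. \<forall>v\<ge>exp 1. \<bar>recip_sum k (exp v) - poly (Q k) (ln v)\<bar> \<le> C * (real k * ln v ^ (k - 1) / v)"
    by (rule recip_sum_asymptotics) blast
  \<comment> \<open>At \<open>X = Y + mertens_const\<close> the exponent
    \<open>X - euler_mascheroni\<close> is the one in \<open>asymptotic_poly_eq\<close>.\<close>
  have eq: "poly (R_poly k) (Y + mertens_const) = poly (Q k) Y" for Y
    unfolding poly_R_poly_eq[OF assms] asymptotic_poly_eq[OF Q assms]
    by (simp add: mult_ac add_diff_eq)
  \<comment> \<open>The derivative of \<open>Q (Suc m)\<close> is the nonzero \<open>Q m\<close>, so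
    the degree rises by exactly one; the later shift by a constant preserves it.\<close>
  have degQ: "degree (Q m) = m" for m
  proof (induction m)
    case (Suc m)
    have "pderiv (Q (Suc m)) \<noteq> 0"
    proof (cases m)
      case 0
      thus ?thesis using Q by simp
    next
      case (Suc l)
      with Suc.IH show ?thesis using Q(2)[of m] by auto
    qed
    hence "degree (Q (Suc m)) \<noteq> 0" by (simp add: pderiv_eq_0_iff)
    moreover have "degree (Q (Suc m)) - 1 = m"
      using Suc.IH degree_pderiv[of "Q (Suc m)"] Q(2)[of m] by simp
    ultimately show ?case by simp
  qed (simp add: Q)
  have "pcompose (R_poly k) [:mertens_const, 1:] = Q k"
    by (subst poly_eq_poly_eq_iff[symmetric]) (auto simp: fun_eq_iff poly_pcompose eq[symmetric] add.commute)
  hence "degree (R_poly k) = k"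
    using degQ[of k] degree_pcompose[of "R_poly k" "[:mertens_const, 1:]"] by simp
  moreover have "\<exists>C. \<forall>x::real. x \<ge> 3 \<longrightarrow>
       \<bar>recip_sum k x - poly (Q k) (ln (ln x))\<bar> \<le> C * (ln (ln x) ^ (k - 1) / ln x)"
  proof -
    obtain C where C: "\<And>v. v \<ge> exp 1 \<Longrightarrow> \<bar>recip_sum k (exp v) - poly (Q k) (ln v)\<bar> \<le> C * (real k * ln v ^ (k - 1) / v)"
      using Q(3)[of k] by blast
    \<comment> \<open>These constants serve \<open>3 \<le> x < exp (exp 1)\<close>. There
      \<open>ln (ln x)\<close> lies between \<open>l\<close> and 1, so \<open>S\<close> bounds the
      polynomial and \<open>B\<close> the whole difference, while the error term is at least
      \<open>l ^ (k - 1) / exp 1\<close>, which is positive because \<open>ln 3 > 1\<close>.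
      \<open>E\<close> is the quotient.\<close>
    define S where "S = (\<Sum>i\<le>degree (Q k). \<bar>coeff (Q k) i\<bar>)"
    define l where "l = ln (ln (3::real))"
    define B where "B = recip_sum k (exp (exp 1)) + S"
    define E where "E = B / (l ^ (k - 1) / exp 1)"
    have l: "l > 0" using ln3_gt_1 by (simp add: l_def)
    have B: "B \<ge> 0" unfolding B_def S_def by (intro add_nonneg_nonneg sum_nonneg recip_sum_nonneg) auto
    have "\<bar>recip_sum k x - poly (Q k) (ln (ln x))\<bar> \<le> (\<bar>C * real k\<bar> + E) * (ln (ln x) ^ (k - 1) / ln x)" if x: "x \<ge> 3" for x
    proof -
      have lnx: "ln x > 1" using ln3_gt_1 x by (smt (verit) ln_le_cancel_iff)
      have "ln 3 \<le> ln x" using x by simp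
      hence llx: "ln (ln x) \<ge> l" unfolding l_def using ln3_gt_1 lnx by (subst ln_le_cancel_iff) auto
      have pow: "l ^ (k - 1) \<le> ln (ln x) ^ (k - 1)" using l llx by (intro power_mono) auto
      have E0: "E \<ge> 0" using B l by (simp add: E_def)
      have T0: "ln (ln x) ^ (k - 1) / ln x \<ge> 0" using l llx lnx by (intro divide_nonneg_nonneg zero_le_power) linarith+
      show ?thesis
      proof (cases "ln x \<ge> exp 1")
        case True
        have "\<bar>recip_sum k x - poly (Q k) (ln (ln x))\<bar> \<le> (C * real k) * (ln (ln x) ^ (k - 1) / ln x)"
          using C[OF True] x by (simp add: mult.assoc)
        also have "\<dots> \<le> (\<bar>C * real k\<bar> + E) * (ln (ln x) ^ (k - 1) / ln x)"
          using E0 T0 by (intro mult_right_mono) linarith+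
        finally show ?thesis .
      next
        case False
        have le1: "ln (ln x) \<le> 1" using False lnx ln_le_cancel_iff[of "ln x" "exp 1"] by simp
        have "x \<le> exp (exp 1)" using False x by (metis exp_le_cancel_iff exp_ln less_eq_real_def linorder_not_less less_le_trans zero_less_numeral)
        hence "recip_sum k x \<le> recip_sum k (exp (exp 1))" by (rule recip_sum_mono)
        moreover have "\<bar>poly (Q k) (ln (ln x))\<bar> \<le> S"
          unfolding poly_altdef S_def
        proof (rule order_trans[OF sum_abs sum_mono])
          fix i
          have "ln (ln x) ^ i \<le> 1" using l llx le1 by (intro power_le_one) auto
          moreover have "ln (ln x) ^ i \<ge> 0" using l llx by (intro zero_le_power) auto
          ultimately show "\<bar>coeff (Q k) i * ln (ln x) ^ i\<bar> \<le> \<bar>coeff (Q k) i\<bar>"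
            unfolding abs_mult by (intro mult_left_le) auto
        qed
        ultimately have "\<bar>recip_sum k x - poly (Q k) (ln (ln x))\<bar> \<le> B"
          unfolding B_def using recip_sum_nonneg[of k x] by linarith
        also have "B = E * (l ^ (k - 1) / exp 1)" using l by (simp add: E_def)
        also have "\<dots> \<le> E * (ln (ln x) ^ (k - 1) / ln x)"
          using E0 pow lnx False l by (intro mult_left_mono frac_le) auto
        also have "\<dots> \<le> (\<bar>C * real k\<bar> + E) * (ln (ln x) ^ (k - 1) / ln x)"
          using T0 by (intro mult_right_mono) auto
        finally show ?thesis .
      qed
    qed
    thus ?thesis by blast
  qed
  ultimately show ?thesis by (simp only: eq)
qed

end
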